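(* Let $\mathbf h_N(t)$, $N=1,2,\dots$, be a sequence of Metropolis rate height processes such that $\frac1N\sum_{i=1}^N N^{-3}h_i(0)$ converges to some constant $M$ in probability as $N\to\infty$, and let $\mathbf w_N(t)=(w_1(t),\dots,w_N(t))$ be the corresponding third order finite difference processes. Suppose that: (i) $\mathbf w_N$ converges pointwise mesoscopically to $w$, i.e. $w$ is a continuous function of $(t,x)$, $t\ge 0$, $x\in\mathbb T$, such that $$\lim_{\epsilon\to0}\lim_{N\to\infty}\mathbb E\left|\overline{\mathbf w}_{N(x\pm\epsilon)}(t)-w(t,x)\right|^2=0\qquad\forall t\ge0,\ x\in\mathbb T;$$ (ii) there exists a continuous function $\hat J:\mathbb R\to\mathbb R$ such that for all $t>0$ and all $x\in\mathbb T$, $$\left|\mathbb E\,\bar J(\mathbf w_{N(x\pm\epsilon)}(t))-\hat J\left(\mathbb E\,\overline{\mathbf w}_{N(x\pm\epsilon)}(t)\right)\right|\to0\quad\text{as } N\to\infty\text{ and then }\epsilon\to0;$$ (iii) $\sup_N\sup_{i=1,\dots,N}\mathbb E|w_i(t)|<\infty$ for all $t\ge0$; (iv) $\sup_N\sup_{s\in(0,t]}\sup_{i=1,\dots,N}|\mathbb E J(w_i(s))|<\infty$ for all $t\ge0$. Then $\mathbf h_N$ has a hydrodynamic limit $h$ in the rough scaling regime, $h$ is three times continuously differentiable in $x$, and, with $h_0=h(0,\cdot)$ the macroscopic initial profile, $h$ is the weak solution to $$\partial_t h=-\partial_x\hat J(h_{xxx}),\quad t>0,\ x\in\mathbb T,\qquad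 h(0,x)=h_0(x),\quad x\in\mathbb T,$$ in the sense that $$\int_0^1\psi(x)\left[h(t,x)-h_0(x)\right]dx=\int_0^t\int_0^1\psi'(x)\hat J(h_{xxx}(s,x))\,dx\,ds$$ for all $t>0$ and $\psi\in C^1(\mathbb T)$.
   Context: $\mathbb T$ denotes the unit interval with periodic boundary conditions. Fix a constant $K>0$ (inverse temperature) and let $J(w)=2e^{-3K}\sinh(Kw)$. Metropolis rate height process: $\mathbf h_N(t)=(h_1(t),\dots,h_N(t))\in\mathbb Z^N$ is a continuous-time Markov jump process on height profiles over the periodic lattice $\{1,\dots,N\}$ (indices mod $N$), started from a random $\mathbf h_N(0)$. For $|i-j|=1$, the jump $\mathbf h\mapsto\mathbf h^{i,j}$ decreases $h_i$ by $1$, increases $h_j$ by $1$ and leaves the other heights unchanged. With $$w_i=z_{i-1}-2z_i+z_{i+1},\quad z_i=h_{i+1}-h_i,\qquad\text{i.e. } w_i=h_{i+2}-3h_{i+1}+3h_i-h_{i-1},$$ the jump $\mathbf h\mapsto\mathbf h^{i,i+1}$ occurs at rate $N^4e^{-3K+Kw_i}$ and the jump $\mathbf h\mapsto\mathbf h^{i+1,i}$ occurs at rate $N^4e^{-3K-Kw_i}$. The third order finite difference process is $\mathbf w_N(t)=(w_1(t),\dots,w_N(t))$ (all entries depend on $N$, suppressed in the notation). Window averages: for $x\in\mathbb T$, $\epsilon>0$, $i\in N(x\pm\epsilon)$ denotes those $i\in\{1,\dots,N\}$ with $|(i/N-x)\bmod 1|\le\epsilon$ (distance on the torus), and for a function $f:\mathbb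 R\to\mathbb R$ $$\overline{\mathbf w}_{N(x\pm\epsilon)}=\frac1{2N\epsilon}\sum_{i\in N(x\pm\epsilon)}w_i,\qquad \bar f(\mathbf w_{N(x\pm\epsilon)})=\frac1{2N\epsilon}\sum_{i\in N(x\pm\epsilon)}f(w_i).$$ Hydrodynamic limit in the rough scaling regime: $\mathbf h_N$ converges to $h$ in the rough scaling regime if there is a macroscopic initial profile $h_0:\mathbb T\to\mathbb R$ such that for every $\phi\in C(\mathbb T)$, $\frac1N\sum_{i=1}^N\phi(i/N)N^{-3}h_i(0)\to\int_{\mathbb T}\phi(x)h_0(x)dx$ in probability as $N\to\infty$, and for every $t>0$ and $\phi\in C(\mathbb T)$, $\frac1N\sum_{i=1}^N\phi(i/N)N^{-3}h_i(t)\to\int_{\mathbb T}\phi(x)h(t,x)dx$ in probability as $N\to\infty$ (the time scaling $N^4$ is already built into the jump rates). *)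

theory Defs
  imports "HOL-Probability.Probability" "HOL-Library.Periodic_Fun"
begin

(* The torus is the unit interval with periodic boundary conditions: functions on it are
   functions on the reals of period 1, i.e. functions satisfying periodic_fun_simple'. *)

section \<open>Markov jump processes\<close>

definition total_rate :: "'s set \<Rightarrow> ('s \<Rightarrow> 's \<Rightarrow> real) \<Rightarrow> 's \<Rightarrow> real" where
  "total_rate S q x = (\<Sum>\<^sub>\<infinity>y\<in>S. q x y)"

text \<open>
  Jump chain / holding time definition of a continuous-time Markov jump process with jump
  rates \<open>q\<close> on a countable state space \<open>S\<close>, with arbitrary (random) initial state:
  the jump chain \<open>Y\<close> is a Markov chain with transition probabilities \<open>q x y / total_rate S q x\<close>,
  and given \<open>Y\<close> the holding times \<open>\<sigma>\<close> are independent and exponentially distributed with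
  parameters \<open>total_rate S q (Y n)\<close>.
  A positive rate \<open>q x x\<close> is allowed and stands for a jump without effect; this does not change
  the law of \<open>X\<close>. All total rates are meant to be positive and finite.
  The process is defined for all times, so the jump times tend to infinity almost surely.
\<close>
definition markov_jump_process ::
  "'a measure \<Rightarrow> 's set \<Rightarrow> ('s \<Rightarrow> 's \<Rightarrow> real) \<Rightarrow> (real \<Rightarrow> 'a \<Rightarrow> 's) \<Rightarrow> bool" where
  "markov_jump_process M S q X \<longleftrightarrow>
     prob_space M \<and> countable S \<and> (\<forall>t\<ge>0. X t \<in> M \<rightarrow>\<^sub>M count_space S) \<and>
     (\<exists>(Y :: nat \<Rightarrow> 'a \<Rightarrow> 's) (\<sigma> :: nat \<Rightarrow> 'a \<Rightarrow> real).
        (\<forall>n. Y n \<in> M \<rightarrow>\<^sub>M count_space S) \<and> (\<forall>n. \<sigma> n \<in> borel_measurable M) \<and>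
        (\<forall>n y. (\<forall>k\<le>n. y k \<in> S) \<longrightarrow>
           measure M {\<omega> \<in> space M. \<forall>k\<le>n. Y k \<omega> = y k} =
           measure M {\<omega> \<in> space M. Y 0 \<omega> = y 0} *
             (\<Prod>k<n. q (y k) (y (Suc k)) / total_rate S q (y k))) \<and>
        (\<forall>n y s. (\<forall>k\<le>n. y k \<in> S \<and> 0 \<le> s k) \<longrightarrow>
           measure M {\<omega> \<in> space M. \<forall>k\<le>n. Y k \<omega> = y k \<and> s k < \<sigma> k \<omega>} =
           measure M {\<omega> \<in> space M. \<forall>k\<le>n. Y k \<omega> = y k} *
             (\<Prod>k\<le>n. exp (- (total_rate S q (y k) * s k)))) \<and>
        (AE \<omega> in M.
           filterlim (\<lambda>n. \<Sum>k<n. \<sigma> k \<omega>) at_top sequentially \<and>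
           (\<forall>n t. (\<Sum>k<n. \<sigma> k \<omega>) \<le> t \<and> t < (\<Sum>k<Suc n. \<sigma> k \<omega>) \<longrightarrow> X t \<omega> = Y n \<omega>)))"

section \<open>The Metropolis rate height process\<close>

(* A height profile over the periodic lattice {1..N} is an integer-indexed sequence of period N. *)
definition profiles :: "nat \<Rightarrow> (int \<Rightarrow> int) set" where
  "profiles N = {h. periodic_fun_simple h (int N)}"

definition slope :: "(int \<Rightarrow> int) \<Rightarrow> int \<Rightarrow> int" where
  "slope h i = h (i + 1) - h i"

definition third_diff :: "(int \<Rightarrow> int) \<Rightarrow> int \<Rightarrow> int" where
  "third_diff h i = slope h (i - 1) - 2 * slope h i + slope h (i + 1)"

lemma third_diff_expand:
  "third_diff h i = h (i + 2) - 3 * h (i + 1) + 3 * h i - h (i - 1)"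
  by (simp add: third_diff_def slope_def algebra_simps)

definition hop :: "nat \<Rightarrow> int \<Rightarrow> int \<Rightarrow> (int \<Rightarrow> int) \<Rightarrow> (int \<Rightarrow> int)" where
  "hop N i j h = (\<lambda>k. h k - of_bool (k mod int N = i mod int N) + of_bool (k mod int N = j mod int N))"

lemma hop_in_profiles: "h \<in> profiles N \<Longrightarrow> hop N i j h \<in> profiles N"
  by (auto simp: profiles_def hop_def periodic_fun_simple_def periodic_fun_def algebra_simps)

(* For N <= 2 different jumps can lead to the same profile; their rates add up. *)
definition metropolis_rate :: "real \<Rightarrow> nat \<Rightarrow> (int \<Rightarrow> int) \<Rightarrow> (int \<Rightarrow> int) \<Rightarrow> real" where
  "metropolis_rate K N h g =
     (\<Sum>i\<in>{1..int N}.
        of_bool (g = hop N i (i + 1) h) *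
          (real N ^ 4 * exp (- 3 * K + K * real_of_int (third_diff h i))) +
        of_bool (g = hop N (i + 1) i h) *
          (real N ^ 4 * exp (- 3 * K - K * real_of_int (third_diff h i))))"

definition metropolis_process ::
  "real \<Rightarrow> nat \<Rightarrow> 'a measure \<Rightarrow> (real \<Rightarrow> 'a \<Rightarrow> int \<Rightarrow> int) \<Rightarrow> bool" where
  "metropolis_process K N M H \<longleftrightarrow>
     markov_jump_process M (profiles N) (metropolis_rate K N) H"

definition J :: "real \<Rightarrow> real \<Rightarrow> real" where
  "J K u = 2 * exp (- 3 * K) * sinh (K * u)"

section \<open>Window averages\<close>

(* infdist _ Ints is the distance modulo 1. *)
definition window :: "nat \<Rightarrow> real \<Rightarrow> real \<Rightarrow> int set" where
  "window N x \<epsilon> = {i \<in> {1..int N}. infdist (real_of_int i / real N - x) \<int> \<le> \<epsilon>}"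

definition window_avg ::
  "(real \<Rightarrow> real) \<Rightarrow> nat \<Rightarrow> real \<Rightarrow> real \<Rightarrow> (int \<Rightarrow> int) \<Rightarrow> real" where
  "window_avg f N x \<epsilon> h =
     1 / (2 * real N * \<epsilon>) * (\<Sum>i\<in>window N x \<epsilon>. f (real_of_int (third_diff h i)))"

section \<open>Hydrodynamic limit in the rough scaling regime\<close>

definition tends_in_prob ::
  "(nat \<Rightarrow> 'a measure) \<Rightarrow> (nat \<Rightarrow> 'a \<Rightarrow> real) \<Rightarrow> real \<Rightarrow> bool" where
  "tends_in_prob M Z c \<longleftrightarrow>
     (\<forall>\<delta>>0. (\<lambda>N. measure (M N) {\<omega> \<in> space (M N). \<bar>Z N \<omega> - c\<bar> > \<delta>}) \<longlonglongrightarrow> 0)"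

definition height_avg :: "(real \<Rightarrow> real) \<Rightarrow> nat \<Rightarrow> (int \<Rightarrow> int) \<Rightarrow> real" where
  "height_avg \<phi> N h =
     1 / real N * (\<Sum>i\<in>{1..int N}. \<phi> (real_of_int i / real N) * (real_of_int (h i) / real N ^ 3))"

definition profile_limit ::
  "(nat \<Rightarrow> 'a measure) \<Rightarrow> (nat \<Rightarrow> 'a \<Rightarrow> int \<Rightarrow> int) \<Rightarrow> (real \<Rightarrow> real) \<Rightarrow> bool" where
  "profile_limit M H g \<longleftrightarrow>
     periodic_fun_simple' g \<and> set_integrable lborel {0..1} g \<and>
     (\<forall>\<phi>. periodic_fun_simple' \<phi> \<and> continuous_on UNIV \<phi> \<longrightarrow>
        tends_in_prob M (\<lambda>N \<omega>. height_avg \<phi> N (H N \<omega>)) (LBINT x:{0..1}. \<phi> x * g x))"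

(* h0 is the macroscopic initial profile. *)
definition rough_hydrodynamic_limit ::
  "(nat \<Rightarrow> 'a measure) \<Rightarrow> (nat \<Rightarrow> real \<Rightarrow> 'a \<Rightarrow> int \<Rightarrow> int) \<Rightarrow>
   (real \<Rightarrow> real) \<Rightarrow> (real \<Rightarrow> real \<Rightarrow> real) \<Rightarrow> bool" where
  "rough_hydrodynamic_limit M H h0 h \<longleftrightarrow>
     profile_limit M (\<lambda>N. H N 0) h0 \<and> (\<forall>t>0. profile_limit M (\<lambda>N. H N t) (h t))"

abbreviation dx :: "nat \<Rightarrow> (real \<Rightarrow> real \<Rightarrow> real) \<Rightarrow> real \<Rightarrow> real \<Rightarrow> real" where
  "dx k h t \<equiv> (deriv ^^ k) (h t)"

(* The derivatives in x are continuous jointly in (t,x). *)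
definition C3_in_x :: "(real \<Rightarrow> real \<Rightarrow> real) \<Rightarrow> bool" where
  "C3_in_x h \<longleftrightarrow>
     (\<forall>k<3. \<forall>t\<ge>0. \<forall>x. dx k h t differentiable (at x)) \<and>
     (\<forall>k\<le>3. continuous_on ({0..} \<times> UNIV) (\<lambda>(t, x). dx k h t x))"

end

theory Submission
  imports Defs
begin

text \<open>
  The law of large numbers for the heights is a statement about the third differences \<open>w\<close> alone, and
  the dynamics enters only through the mean current \<open>E J(w\<^sub>i)\<close>.

  \<^emph>\<open>From window averages to test functions.\<close> Pointwise convergence of window averages yields
  convergence of \<open>1/N \<Sum>\<^sub>i \<phi>(i/N) w\<^sub>i\<close> in \<open>L\<^sup>1\<close> (\<open>mesoscopic_average\<close>). Mollifying \<open>\<phi>\<close> at scale \<open>\<epsilon>\<close> turns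
  the sum into the integral over \<open>x\<close> of \<open>\<phi>(x)\<close> times the window average at \<open>x\<close>; the first moments
  of the \<open>w\<^sub>i\<close> bound the cost of the mollification uniformly in \<open>N\<close>, and Tonelli's theorem, the
  reverse Fatou lemma (in \<open>N\<close>) and dominated convergence (in \<open>\<epsilon>\<close>) carry the pointwise limits under
  the integral. The same lemma, applied to the deterministic array \<open>E J(w\<^sub>i(s))\<close>, shows that the mean
  current converges weakly to \<open>J_hat(w(s, \<cdot>))\<close>.

  \<^emph>\<open>From third differences to heights.\<close> Let \<open>\<Phi>\<close> be the threefold periodic mean-zero antiderivative of
  \<open>\<phi>\<close> minus its mean. By the mean value theorem the third difference of \<open>\<Phi>\<close> on the lattice of mesh
  \<open>1/N\<close> is \<open>N\<^sup>-\<^sup>3\<close> times this function up to a uniformly small error, so summation by parts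
  (\<open>centred_avg_third_diff\<close>) transfers the limit from \<open>w\<close> to the heights without their spatial mean.
  That mean is conserved by every jump, hence converges to \<open>m\<close> at all times. The limit profile is
  \<open>m\<close> plus the threefold antiderivative of \<open>w(t, \<cdot>)\<close>, which exists on the torus because third
  differences sum to zero over a period. Regularity in \<open>x\<close> is read off from this formula.

  \<^emph>\<open>The equation.\<close> Dynkin's formula for the average of the heights against \<open>\<psi>\<close> expresses the change of
  its mean as the time integral of \<open>\<Sum>\<^sub>i (\<psi>((i+1)/N) - \<psi>(i/N)) E J(w\<^sub>i(s))\<close>. For each \<open>s\<close> this sum converges to
  the integral of \<open>\<psi>' J_hat(w(s, \<cdot>))\<close>, and boundedness of the mean current permits passing to the limit
  under the time integral.

  \<^emph>\<open>Why Dynkin's formula holds.\<close> The rates are exponential in \<open>w\<close>, so the number of jumps has to be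
  controlled. A jump changes the sum of the squared slopes by \<open>- 2 w\<^sub>i\<close> or \<open>2 w\<^sub>i\<close> up to a bounded term, and jumps
  that lower it are exponentially favoured. The square root of one plus this energy is therefore a
  Lyapunov function: its drift is at most a constant minus a multiple of the total jump rate
  (\<open>rms_drift\<close>). It grows linearly in \<open>w\<close>, so the first moments of \<open>w\<^sub>i(0)\<close> suffice to conclude that the
  number of jumps up to any time has finite mean. The formula itself is derived from the jump chain:
  given the visited states the holding times are independent and exponential, whence the next
  jump leads from \<open>x\<close> to \<open>z\<close> and occurs by time \<open>t\<close> with probability \<open>q x z\<close> times the mean time that is
  spent in \<open>x\<close> before this jump and before \<open>t\<close> (\<open>step\<close>).
\<close>

section \<open>Exponential waiting times\<close>

lemma (in prob_space) nn_integral_indep_var: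
  assumes indep: "indep_var borel X borel T" and [measurable]: "F \<in> borel_measurable (borel \<Otimes>\<^sub>M borel)"
  shows "(\<integral>\<^sup>+\<omega>. F (X \<omega>, T \<omega>) \<partial>M) = (\<integral>\<^sup>+\<omega>. (\<integral>\<^sup>+\<omega>'. F (X \<omega>', T \<omega>) \<partial>M) \<partial>M)"
proof -
  have rv[measurable]: "random_variable borel X" "random_variable borel T"
    and eq: "distr M borel X \<Otimes>\<^sub>M distr M borel T = distr M (borel \<Otimes>\<^sub>M borel) (\<lambda>x. (X x, T x))"
    using indep unfolding indep_var_distribution_eq by auto
  interpret X: prob_space "distr M borel X" by (rule prob_space_distr) fact
  interpret Y: prob_space "distr M borel T" by (rule prob_space_distr) fact
  interpret pair_prob_space "distr M borel X" "distr M borel T" ..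
  have "(\<integral>\<^sup>+\<omega>. F (X \<omega>, T \<omega>) \<partial>M) = (\<integral>\<^sup>+z. F z \<partial>(distr M (borel \<Otimes>\<^sub>M borel) (\<lambda>x. (X x, T x))))"
    by (subst nn_integral_distr) auto
  also have "\<dots> = (\<integral>\<^sup>+z. F z \<partial>(distr M borel X \<Otimes>\<^sub>M distr M borel T))"
    by (simp add: eq)
  also have "\<dots> = (\<integral>\<^sup>+y. (\<integral>\<^sup>+x. F (x, y) \<partial>distr M borel X) \<partial>distr M borel T)"
    by (subst nn_integral_snd[symmetric]) auto
  also have "\<dots> = (\<integral>\<^sup>+\<omega>. (\<integral>\<^sup>+x. F (x, T \<omega>) \<partial>distr M borel X) \<partial>M)"
    by (subst nn_integral_distr) auto
  also have "\<dots> = (\<integral>\<^sup>+\<omega>. (\<integral>\<^sup>+\<omega>'. F (X \<omega>', T \<omega>) \<partial>M) \<partial>M)"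
    by (intro nn_integral_cong) (subst nn_integral_distr, auto)
  finally show ?thesis .
qed

text \<open>
  The length of the part of \<open>[a, b)\<close> that lies in \<open>[0, t]\<close>, written as an integral over time so that
  it can be exchanged with expectations.
\<close>
definition holding :: "real \<Rightarrow> real \<Rightarrow> real \<Rightarrow> ennreal" where
  "holding t a b = (\<integral>\<^sup>+s. indicator {0..t} s * indicator {a..<b} s \<partial>lborel)"

lemma holding_eq: "0 \<le> a \<Longrightarrow> a \<le> b \<Longrightarrow> holding t a b = ennreal (min b t - min a t)"
proof -
  assume ab: "0 \<le> a" "a \<le> b"
  have "holding t a b = (\<integral>\<^sup>+s. indicator ({0..t} \<inter> {a..<b}) s \<partial>lborel)"
    unfolding holding_def by (intro nn_integral_cong) (auto split: split_indicator)
  also have "\<dots> = emeasure lborel ({0..t} \<inter> {a..<b})" by simp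
  also have "\<dots> = ennreal (min b t - min a t)"
  proof (cases "b \<le> t")
    case True
    then have "{0..t} \<inter> {a..<b} = {a..<b}" using ab by auto
    then show ?thesis using True ab by (simp add: min_def)
  next
    case False
    then have "{0..t} \<inter> {a..<b} = {a..t}" using ab by auto
    then show ?thesis using False ab by (cases "a \<le> t") (simp_all add: min_def)
  qed
  finally show ?thesis .
qed

lemma holding_measurable[measurable]: "(\<lambda>z. holding t (fst z) (snd z)) \<in> borel_measurable (borel \<Otimes>\<^sub>M borel)"
proof -
  have "(\<lambda>z::(real \<times> real) \<times> real. indicator {0..t} (snd z) * (if fst (fst z) \<le> snd z \<and> snd z < snd (fst z) then 1 else 0 :: ennreal)) \<in> borel_measurable ((borel \<Otimes>\<^sub>M borel) \<Otimes>\<^sub>M lborel)"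
    by measurable
  then have "(\<lambda>z::real \<times> real. \<integral>\<^sup>+s. indicator {0..t} s * (if fst z \<le> s \<and> s < snd z then 1 else 0 :: ennreal) \<partial>lborel) \<in> borel_measurable (borel \<Otimes>\<^sub>M borel)"
    by (intro sigma_finite_measure.borel_measurable_nn_integral) (auto simp: case_prod_beta' sigma_finite_lborel)
  also have "(\<lambda>z::real \<times> real. \<integral>\<^sup>+s. indicator {0..t} s * (if fst z \<le> s \<and> s < snd z then 1 else 0 :: ennreal) \<partial>lborel) = (\<lambda>z. holding t (fst z) (snd z))"
    unfolding holding_def by (intro ext nn_integral_cong) (auto split: split_indicator)
  finally show ?thesis .
qed

lemma measurable_holding[measurable (raw)]:
  assumes [measurable]: "f \<in> borel_measurable M" "g \<in> borel_measurable M"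
  shows "(\<lambda>x. holding t (f x) (g x)) \<in> borel_measurable M"
  using measurable_compose[OF _ holding_measurable, of "\<lambda>x. (f x, g x)" M t] by simp

lemma exp_decay_nn_integral:
  assumes "0 < l"
  shows "ennreal l * (\<integral>\<^sup>+s. indicator {a..t} s * ennreal (exp (- (l * (s - a)))) \<partial>lborel) = (if a \<le> t then ennreal (1 - exp (- (l * (t - a)))) else 0)"
proof (cases "a \<le> t")
  case True
  have "(\<integral>\<^sup>+s. ennreal (l * exp (- (l * (s - a)))) * indicator {a..t} s \<partial>lborel) = - exp (- (l * (t - a))) - (- exp (- (l * (a - a))))"
    using assms True by (intro nn_integral_FTC_Icc) (auto intro!: derivative_eq_intros)
  moreover have "ennreal l * (\<integral>\<^sup>+s. indicator {a..t} s * ennreal (exp (- (l * (s - a)))) \<partial>lborel) = (\<integral>\<^sup>+s. ennreal (l * exp (- (l * (s - a)))) * indicator {a..t} s \<partial>lborel)"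
    using assms by (subst nn_integral_cmult[symmetric]) (auto intro!: nn_integral_cong simp: ennreal_mult mult_ac)
  ultimately show ?thesis using True by simp
qed simp

text \<open>
  For a clock started at a fixed time \<open>a\<close>, both sides equal \<open>1 - exp (- l (t - a))\<close>: the probability
  of ringing by time \<open>t\<close> is the rate times the mean time the clock runs within \<open>[0, t]\<close>. Independence
  allows \<open>a\<close> to be replaced by the random starting time.
\<close>
lemma (in prob_space) exponential_waiting:
  assumes indep: "indep_var borel X borel T" and l: "0 < l"
    and X: "\<And>a. 0 \<le> a \<Longrightarrow> prob {\<omega>\<in>space M. a < X \<omega>} = exp (- (l * a))"
    and T: "AE \<omega> in M. 0 \<le> T \<omega>"
  shows "emeasure M {\<omega>\<in>space M. T \<omega> + X \<omega> \<le> t} = ennreal l * (\<integral>\<^sup>+\<omega>. holding t (T \<omega>) (T \<omega> + X \<omega>) \<partial>M)"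
proof -
  have rv[measurable]: "random_variable borel X" "random_variable borel T"
    using indep unfolding indep_var_distribution_eq by auto
  have inner: "(\<integral>\<^sup>+\<omega>. (if a + X \<omega> \<le> t then 1 else 0) \<partial>M) = ennreal l * (\<integral>\<^sup>+\<omega>. holding t a (a + X \<omega>) \<partial>M)"
    if a: "0 \<le> a" for a
  proof -
    have gt: "emeasure M {\<omega>\<in>space M. s < a + X \<omega>} = ennreal (exp (- (l * (s - a))))" if "a \<le> s" for s
    proof -
      have "{\<omega>\<in>space M. s < a + X \<omega>} = {\<omega>\<in>space M. s - a < X \<omega>}" by auto
      then show ?thesis using X[of "s - a"] that by (simp add: emeasure_eq_measure)
    qed
    have pos: "AE \<omega> in M. 0 < X \<omega>"
    proof -
      have "prob {\<omega>\<in>space M. 0 < X \<omega>} = 1" using X[of 0] by simp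
      then show ?thesis by (subst (asm) prob_Collect_eq_1) auto
    qed
    have "(\<integral>\<^sup>+\<omega>. holding t a (a + X \<omega>) \<partial>M)
        = (\<integral>\<^sup>+\<omega>. (\<integral>\<^sup>+s. indicator {a..t} s * indicator {\<omega>. s < a + X \<omega>} \<omega> \<partial>lborel) \<partial>M)"
      unfolding holding_def using a by (intro nn_integral_cong) (auto split: split_indicator)
    also have "\<dots> = (\<integral>\<^sup>+s. (\<integral>\<^sup>+\<omega>. indicator {a..t} s * indicator {\<omega>. s < a + X \<omega>} \<omega> \<partial>M) \<partial>lborel)"
    proof -
      interpret P: pair_sigma_finite lborel M ..
      show ?thesis
        by (rule P.Fubini') (auto simp: case_prod_beta' indicator_def)
    qed
    also have "\<dots> = (\<integral>\<^sup>+s. indicator {a..t} s * ennreal (exp (- (l * (s - a)))) \<partial>lborel)"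
    proof (intro nn_integral_cong)
      fix s
      have "(\<integral>\<^sup>+\<omega>. indicator {a..t} s * indicator {\<omega>. s < a + X \<omega>} \<omega> \<partial>M) = (\<integral>\<^sup>+\<omega>. indicator {a..t} s * indicator {\<omega>\<in>space M. s < a + X \<omega>} \<omega> \<partial>M)"
        by (intro nn_integral_cong) (auto split: split_indicator)
      also have "\<dots> = indicator {a..t} s * emeasure M {\<omega>\<in>space M. s < a + X \<omega>}"
        by (subst nn_integral_cmult_indicator) auto
      also have "\<dots> = indicator {a..t} s * ennreal (exp (- (l * (s - a))))"
        using gt[of s] by (auto split: split_indicator)
      finally show "(\<integral>\<^sup>+\<omega>. indicator {a..t} s * indicator {\<omega>. s < a + X \<omega>} \<omega> \<partial>M) = indicator {a..t} s * ennreal (exp (- (l * (s - a))))" .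
    qed
    finally have R: "ennreal l * (\<integral>\<^sup>+\<omega>. holding t a (a + X \<omega>) \<partial>M) = (if a \<le> t then ennreal (1 - exp (- (l * (t - a)))) else 0)"
      using exp_decay_nn_integral[OF l] by simp
    have "(\<integral>\<^sup>+\<omega>. (if a + X \<omega> \<le> t then 1 else 0) \<partial>M) = (\<integral>\<^sup>+\<omega>. indicator {\<omega>\<in>space M. a + X \<omega> \<le> t} \<omega> \<partial>M)"
      by (intro nn_integral_cong) (auto split: split_indicator)
    also have "\<dots> = emeasure M {\<omega>\<in>space M. a + X \<omega> \<le> t}" by (subst nn_integral_indicator) auto
    also have "\<dots> = (if a \<le> t then ennreal (1 - exp (- (l * (t - a)))) else 0)"
    proof (cases "a \<le> t")
      case True
      have "prob {\<omega>\<in>space M. a + X \<omega> \<le> t} = 1 - prob {\<omega>\<in>space M. t - a < X \<omega>}"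
        by (subst prob_compl[symmetric]) (auto intro!: arg_cong[where f = prob])
      then show ?thesis using True X[of "t - a"] by (simp add: emeasure_eq_measure)
    next
      case False
      have "AE \<omega> in M. \<not> (a + X \<omega> \<le> t)" using pos by eventually_elim (use False in auto)
      then have "emeasure M {\<omega>\<in>space M. a + X \<omega> \<le> t} = 0" by (subst (asm) AE_iff_measurable[OF _ refl]) auto
      then show ?thesis using False by simp
    qed
    finally show ?thesis using R by simp
  qed
  have "emeasure M {\<omega>\<in>space M. T \<omega> + X \<omega> \<le> t} = (\<integral>\<^sup>+\<omega>. indicator {\<omega>\<in>space M. T \<omega> + X \<omega> \<le> t} \<omega> \<partial>M)"
    by (subst nn_integral_indicator) auto
  also have "\<dots> = (\<integral>\<^sup>+\<omega>. (\<lambda>z. if snd z + fst z \<le> t then 1 else 0) (X \<omega>, T \<omega>) \<partial>M)"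
    by (intro nn_integral_cong) (auto split: split_indicator)
  also have "\<dots> = (\<integral>\<^sup>+\<omega>. (\<integral>\<^sup>+\<omega>'. (\<lambda>z. if snd z + fst z \<le> t then 1 else 0) (X \<omega>', T \<omega>) \<partial>M) \<partial>M)"
    by (rule nn_integral_indep_var[OF indep]) measurable
  also have "\<dots> = (\<integral>\<^sup>+\<omega>. ennreal l * (\<integral>\<^sup>+\<omega>'. holding t (T \<omega>) (T \<omega> + X \<omega>') \<partial>M) \<partial>M)"
    by (intro nn_integral_cong_AE) (use T in eventually_elim, simp add: inner)
  also have "\<dots> = ennreal l * (\<integral>\<^sup>+\<omega>. (\<integral>\<^sup>+\<omega>'. holding t (T \<omega>) (T \<omega> + X \<omega>') \<partial>M) \<partial>M)"
    by (rule nn_integral_cmult) measurable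
  also have "(\<integral>\<^sup>+\<omega>. (\<integral>\<^sup>+\<omega>'. holding t (T \<omega>) (T \<omega> + X \<omega>') \<partial>M) \<partial>M) = (\<integral>\<^sup>+\<omega>. holding t (T \<omega>) (T \<omega> + X \<omega>) \<partial>M)"
    using nn_integral_indep_var[OF indep, of "\<lambda>z. holding t (snd z) (snd z + fst z)"] by simp
  finally show ?thesis .
qed

text \<open>
  Open right half-lines together with the whole line form an intersection-stable generator of the
  Borel sets, so independence need only be tested on them; the whole line and half-lines that start
  below zero are covered because the variables are almost surely positive.
\<close>
lemma (in prob_space) exponential_tails_indep:
  fixes \<sigma> :: "nat \<Rightarrow> 'a \<Rightarrow> real"
  assumes [measurable]: "\<And>k. random_variable borel (\<sigma> k)" and l: "\<And>k. k \<le> n \<Longrightarrow> 0 < l k"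
    and tail: "\<And>s. (\<And>k. k \<le> n \<Longrightarrow> 0 \<le> s k) \<Longrightarrow>
      prob {\<omega>\<in>space M. \<forall>k\<le>n. s k < \<sigma> k \<omega>} = (\<Prod>k\<le>n. exp (- (l k * s k)))"
  shows "indep_vars (\<lambda>_. borel) \<sigma> {..n}"
    and "k \<le> n \<Longrightarrow> distributed M lborel (\<sigma> k) (exponential_density (l k))"
    and "k \<le> n \<Longrightarrow> 0 \<le> a \<Longrightarrow> prob {\<omega>\<in>space M. a < \<sigma> k \<omega>} = exp (- (l k * a))"
proof -
  have pos: "AE \<omega> in M. \<forall>k\<le>n. 0 < \<sigma> k \<omega>"
  proof -
    have "prob {\<omega>\<in>space M. \<forall>k\<le>n. 0 < \<sigma> k \<omega>} = 1" using tail[of "\<lambda>_. 0"] by simp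
    then show ?thesis by (subst (asm) prob_Collect_eq_1) auto
  qed
  have tail': "prob {\<omega>\<in>space M. \<forall>k\<le>n. s k < \<sigma> k \<omega>} = (\<Prod>k\<le>n. exp (- (l k * max (s k) 0)))" for s
  proof -
    have "prob {\<omega>\<in>space M. \<forall>k\<le>n. s k < \<sigma> k \<omega>} = prob {\<omega>\<in>space M. \<forall>k\<le>n. max (s k) 0 < \<sigma> k \<omega>}"
    proof (intro finite_measure_eq_AE)
      show "AE \<omega> in M. (\<omega> \<in> {\<omega>\<in>space M. \<forall>k\<le>n. s k < \<sigma> k \<omega>}) = (\<omega> \<in> {\<omega>\<in>space M. \<forall>k\<le>n. max (s k) 0 < \<sigma> k \<omega>})"
        using pos by eventually_elim auto
    qed auto
    also have "\<dots> = (\<Prod>k\<le>n. exp (- (l k * max (s k) 0)))" by (rule tail) auto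
    finally show ?thesis .
  qed
  have single: "prob {\<omega>\<in>space M. a < \<sigma> k \<omega>} = exp (- (l k * max a 0))" if "k \<le> n" for k a
  proof -
    have "prob {\<omega>\<in>space M. a < \<sigma> k \<omega>} = prob {\<omega>\<in>space M. \<forall>j\<le>n. (if j = k then a else 0) < \<sigma> j \<omega>}"
    proof (intro finite_measure_eq_AE)
      show "AE \<omega> in M. (\<omega> \<in> {\<omega>\<in>space M. a < \<sigma> k \<omega>}) = (\<omega> \<in> {\<omega>\<in>space M. \<forall>j\<le>n. (if j = k then a else 0) < \<sigma> j \<omega>})"
        using pos by eventually_elim (use that in auto)
    qed auto
    also have "\<dots> = (\<Prod>j\<le>n. exp (- (l j * max (if j = k then a else 0) 0)))" by (rule tail')
    also have "\<dots> = (\<Prod>j\<le>n. if j = k then exp (- (l k * max a 0)) else 1)" by (intro prod.cong) auto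
    also have "\<dots> = exp (- (l k * max a 0))" using that by simp
    finally show ?thesis .
  qed
  then show gt: "k \<le> n \<Longrightarrow> 0 \<le> a \<Longrightarrow> prob {\<omega>\<in>space M. a < \<sigma> k \<omega>} = exp (- (l k * a))" for k a
    by (simp add: max_def)
  have le: "prob {\<omega>\<in>space M. \<sigma> k \<omega> \<le> a} = 1 - exp (- a * l k)" if "k \<le> n" "0 \<le> a" for k a
  proof -
    have "prob {\<omega>\<in>space M. \<sigma> k \<omega> \<le> a} = 1 - prob {\<omega>\<in>space M. a < \<sigma> k \<omega>}"
      by (subst prob_compl[symmetric]) (auto intro!: arg_cong[where f = prob])
    then show ?thesis using gt[OF that] by (simp add: mult.commute)
  qed
  show "k \<le> n \<Longrightarrow> distributed M lborel (\<sigma> k) (exponential_density (l k))"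
    using l le by (subst exponential_distributed_iff) auto
  let ?E = "insert UNIV (range greaterThan) :: real set set"
  have "indep_vars (\<lambda>_. borel) \<sigma> {..n} \<longleftrightarrow> (\<forall>A\<in>(\<Pi> i\<in>{..n}. ?E). prob (\<Inter>j\<in>{..n}. \<sigma> j -` A j \<inter> space M) = (\<Prod>j\<in>{..n}. prob (\<sigma> j -` A j \<inter> space M)))"
  proof (rule indep_vars_finite)
    show "sets borel = sigma_sets (space borel) ?E"
    proof -
      have "sets (borel :: real measure) = sigma_sets UNIV (range greaterThan)"
        by (subst borel_Ioi) simp
      also have "\<dots> = sigma_sets UNIV ?E"
        by (intro sigma_sets_eqI) (auto intro: sigma_sets_top)
      finally show ?thesis by simp
    qed
    have Int: "{a<..} \<inter> {b<..} = {max a b<..}" for a b :: real by auto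
    show "Int_stable ?E"
    proof (rule Int_stableI)
      fix A B assume "A \<in> ?E" "B \<in> ?E"
      then show "A \<inter> B \<in> ?E"
        by (elim insertE imageE) (simp_all add: Int)
    qed
  qed auto
  also have \<dots>
  proof
    fix A assume A: "A \<in> (\<Pi> i\<in>{..n}. ?E)"
    have "\<forall>j\<in>{..n}. \<exists>a. AE \<omega> in M. \<sigma> j \<omega> \<in> A j \<longleftrightarrow> a < \<sigma> j \<omega>"
    proof
      fix j assume j: "j \<in> {..n}"
      show "\<exists>a. AE \<omega> in M. \<sigma> j \<omega> \<in> A j \<longleftrightarrow> a < \<sigma> j \<omega>"
      proof (cases "A j = UNIV")
        case True
        have "AE \<omega> in M. \<sigma> j \<omega> \<in> A j \<longleftrightarrow> 0 < \<sigma> j \<omega>"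
          using pos by eventually_elim (use True j in auto)
        then show ?thesis by blast
      next
        case False
        then obtain a where "A j = {a<..}" using A j by auto
        then show ?thesis by (intro exI[of _ a]) auto
      qed
    qed
    from bchoice[OF this] obtain s where s': "\<forall>j\<in>{..n}. AE \<omega> in M. \<sigma> j \<omega> \<in> A j \<longleftrightarrow> s j < \<sigma> j \<omega>"
      by blast
    have A_sets: "A j \<in> sets borel" if "j \<le> n" for j
    proof -
      have "A j \<in> ?E" using Pi_mem[OF A, of j] that by simp
      then show ?thesis by (elim insertE imageE) simp_all
    qed
    have pre_sets: "\<sigma> j -` A j \<inter> space M \<in> sets M" if "j \<le> n" for j
      by (rule measurable_sets[OF _ A_sets[OF that]]) simp
    have s_all: "AE \<omega> in M. \<forall>j\<in>{..n}. \<sigma> j \<omega> \<in> A j \<longleftrightarrow> s j < \<sigma> j \<omega>"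
      by (rule AE_finite_allI[OF finite_atMost]) (use s' in blast)
    have "prob (\<Inter>j\<in>{..n}. \<sigma> j -` A j \<inter> space M) = prob {\<omega>\<in>space M. \<forall>k\<le>n. s k < \<sigma> k \<omega>}"
    proof (rule finite_measure_eq_AE)
      show "AE \<omega> in M. (\<omega> \<in> (\<Inter>j\<in>{..n}. \<sigma> j -` A j \<inter> space M)) = (\<omega> \<in> {\<omega>\<in>space M. \<forall>k\<le>n. s k < \<sigma> k \<omega>})"
        using s_all AE_space by eventually_elim auto
      show "(\<Inter>j\<in>{..n}. \<sigma> j -` A j \<inter> space M) \<in> sets M"
        by (rule sets.finite_INT) (use pre_sets in \<open>simp_all\<close>)
    qed measurable
    also have "\<dots> = (\<Prod>k\<le>n. exp (- (l k * max (s k) 0)))" by (rule tail')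
    also have "\<dots> = (\<Prod>k\<le>n. prob {\<omega>\<in>space M. s k < \<sigma> k \<omega>})" by (intro prod.cong) (auto simp: single)
    also have "\<dots> = (\<Prod>k\<le>n. prob (\<sigma> k -` A k \<inter> space M))"
    proof (intro prod.cong refl)
      fix k assume k: "k \<in> {..n}"
      show "prob {\<omega>\<in>space M. s k < \<sigma> k \<omega>} = prob (\<sigma> k -` A k \<inter> space M)"
      proof (rule finite_measure_eq_AE)
        show "AE \<omega> in M. (\<omega> \<in> {\<omega>\<in>space M. s k < \<sigma> k \<omega>}) = (\<omega> \<in> \<sigma> k -` A k \<inter> space M)"
          using bspec[OF s' k] AE_space by eventually_elim auto
        show "\<sigma> k -` A k \<inter> space M \<in> sets M" by (rule pre_sets) (use k in simp)
      qed measurable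
    qed
    finally show "prob (\<Inter>j\<in>{..n}. \<sigma> j -` A j \<inter> space M) = (\<Prod>j\<in>{..n}. prob (\<sigma> j -` A j \<inter> space M))" .
  qed
  finally show "indep_vars (\<lambda>_. borel) \<sigma> {..n}" .
qed

section \<open>Jump chains with exponential holding times\<close>

text \<open>
  The right-hand side depends on the rates only. This is what makes the holding times comparable
  under two different conditional measures.
\<close>
lemma exponential_tails_law:
  fixes \<sigma> :: "nat \<Rightarrow> 'a \<Rightarrow> real"
  assumes "prob_space P" and [measurable]: "\<And>k. \<sigma> k \<in> borel_measurable P" and l: "\<And>k. k \<le> n \<Longrightarrow> 0 < l k"
    and tail: "\<And>s. (\<And>k. k \<le> n \<Longrightarrow> 0 \<le> s k) \<Longrightarrow>
      measure P {\<omega>\<in>space P. \<forall>k\<le>n. s k < \<sigma> k \<omega>} = (\<Prod>k\<le>n. exp (- (l k * s k)))"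
  shows "distr P (\<Pi>\<^sub>M k\<in>{..n}. borel) (\<lambda>\<omega>. \<lambda>k\<in>{..n}. \<sigma> k \<omega>) = (\<Pi>\<^sub>M k\<in>{..n}. density lborel (exponential_density (l k)))"
proof -
  interpret prob_space P by fact
  have "indep_vars (\<lambda>_. borel) \<sigma> {..n}"
    by (rule exponential_tails_indep(1)[where l = l]) (use assms in auto)
  then have "distr P (\<Pi>\<^sub>M k\<in>{..n}. borel) (\<lambda>\<omega>. \<lambda>k\<in>{..n}. \<sigma> k \<omega>) = (\<Pi>\<^sub>M k\<in>{..n}. distr P borel (\<sigma> k))"
    by (subst (asm) indep_vars_iff_distr_eq_PiM') auto
  also have "\<dots> = (\<Pi>\<^sub>M k\<in>{..n}. density lborel (exponential_density (l k)))"
  proof (rule PiM_cong[OF refl])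
    fix k assume k: "k \<in> {..n}"
    have "distributed P lborel (\<sigma> k) (exponential_density (l k))"
      by (rule exponential_tails_indep(2)[where l = l and n = n]) (use assms k in auto)
    then have "distr P lborel (\<sigma> k) = density lborel (exponential_density (l k))"
      by (rule distributed_distr_eq_density)
    moreover have "distr P borel (\<sigma> k) = distr P lborel (\<sigma> k)"
      by (rule distr_cong) auto
    ultimately show "distr P borel (\<sigma> k) = density lborel (exponential_density (l k))"
      by simp
  qed
  finally show ?thesis .
qed

text \<open>
  The jump chain description of a Markov jump process whose rates admit finitely many targets from
  each state, so that its generator is a finite sum.
\<close>
locale jump_chain = prob_space M for M :: "'a measure" +
  fixes S :: "'s set" and q :: "'s \<Rightarrow> 's \<Rightarrow> real"
    and X :: "real \<Rightarrow> 'a \<Rightarrow> 's" and Y :: "nat \<Rightarrow> 'a \<Rightarrow> 's" and \<sigma> :: "nat \<Rightarrow> 'a \<Rightarrow> real"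
  assumes countable_S: "countable S"
    and X_measurable: "\<And>t. 0 \<le> t \<Longrightarrow> X t \<in> M \<rightarrow>\<^sub>M count_space S"
    and Y_measurable[measurable]: "\<And>n. Y n \<in> M \<rightarrow>\<^sub>M count_space S"
    and \<sigma>_measurable[measurable]: "\<And>n. \<sigma> n \<in> borel_measurable M"
    and chain: "\<And>n y. (\<And>k. k \<le> n \<Longrightarrow> y k \<in> S) \<Longrightarrow>
           measure M {\<omega> \<in> space M. \<forall>k\<le>n. Y k \<omega> = y k} =
           measure M {\<omega> \<in> space M. Y 0 \<omega> = y 0} *
             (\<Prod>k<n. q (y k) (y (Suc k)) / total_rate S q (y k))"
    and hold: "\<And>n y s. (\<And>k. k \<le> n \<Longrightarrow> y k \<in> S \<and> 0 \<le> s k) \<Longrightarrow>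
           measure M {\<omega> \<in> space M. \<forall>k\<le>n. Y k \<omega> = y k \<and> s k < \<sigma> k \<omega>} =
           measure M {\<omega> \<in> space M. \<forall>k\<le>n. Y k \<omega> = y k} *
             (\<Prod>k\<le>n. exp (- (total_rate S q (y k) * s k)))"
    and path: "AE \<omega> in M.
           filterlim (\<lambda>n. \<Sum>k<n. \<sigma> k \<omega>) at_top sequentially \<and>
           (\<forall>n t. (\<Sum>k<n. \<sigma> k \<omega>) \<le> t \<and> t < (\<Sum>k<Suc n. \<sigma> k \<omega>) \<longrightarrow> X t \<omega> = Y n \<omega>)"
    and rate_nonneg: "\<And>x y. x \<in> S \<Longrightarrow> y \<in> S \<Longrightarrow> 0 \<le> q x y"
    and rate_finite: "\<And>x. x \<in> S \<Longrightarrow> finite {y \<in> S. q x y \<noteq> 0}"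
    and rate_pos: "\<And>x. x \<in> S \<Longrightarrow> 0 < total_rate S q x"
begin

abbreviation R :: "'s \<Rightarrow> real" where "R \<equiv> total_rate S q"

definition T :: "nat \<Rightarrow> 'a \<Rightarrow> real" where "T n \<omega> = (\<Sum>k<n. \<sigma> k \<omega>)"

definition cyl :: "nat \<Rightarrow> (nat \<Rightarrow> 's) \<Rightarrow> 'a set" where
  "cyl n y = {\<omega> \<in> space M. \<forall>k\<le>n. Y k \<omega> = y k}"

abbreviation (input) jumped :: "nat \<Rightarrow> real \<Rightarrow> 'a set" where
  "jumped n t \<equiv> {\<omega>\<in>space M. T (Suc n) \<omega> \<le> t}"

lemma T_measurable[measurable]: "T n \<in> borel_measurable M"
  unfolding T_def[abs_def] by measurable

lemma T_Suc: "T (Suc n) \<omega> = T n \<omega> + \<sigma> n \<omega>" by (simp add: T_def)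

lemma Y_in_S: "\<omega> \<in> space M \<Longrightarrow> Y n \<omega> \<in> S"
  using measurable_space[OF Y_measurable] by simp

lemma Y_eq_sets[measurable]: "{\<omega> \<in> space M. Y n \<omega> = x} \<in> sets M"
proof (cases "x \<in> S")
  case True
  have "{\<omega> \<in> space M. Y n \<omega> = x} = Y n -` {x} \<inter> space M" by auto
  then show ?thesis using measurable_sets[OF Y_measurable, of "{x}" n] True by simp
next
  case False
  then have "{\<omega> \<in> space M. Y n \<omega> = x} = {}" using Y_in_S by auto
  then show ?thesis by simp
qed

lemma cyl_sets[measurable]: "cyl n y \<in> sets M"
proof -
  have "cyl n y = (\<Inter>k\<in>{..n}. {\<omega> \<in> space M. Y k \<omega> = y k})" unfolding cyl_def by auto
  also have "\<dots> \<in> sets M" by (intro sets.finite_INT) auto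
  finally show ?thesis .
qed

lemma Y_compose_measurable[measurable]: "(\<lambda>\<omega>. f (Y n \<omega>) :: 'b::topological_space) \<in> borel_measurable M"
  using measurable_compose[OF Y_measurable, of f] by simp

text \<open>
  Initial paths of a given length are countable in number. Probabilities can therefore be computed
  cylinder by cylinder, and on a cylinder the holding times are explicit.
\<close>
lemma emeasure_paths:
  assumes B: "B \<in> sets M"
  shows "emeasure M B = (\<integral>\<^sup>+y. emeasure M (B \<inter> cyl n y) \<partial>count_space ({..n} \<rightarrow>\<^sub>E S))"
proof -
  have "B = (\<Union>y\<in>{..n} \<rightarrow>\<^sub>E S. B \<inter> cyl n y)"
  proof
    show "B \<subseteq> (\<Union>y\<in>{..n} \<rightarrow>\<^sub>E S. B \<inter> cyl n y)"
    proof
      fix \<omega> assume \<omega>: "\<omega> \<in> B"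
      then have sp: "\<omega> \<in> space M" using sets.sets_into_space[OF B] by auto
      then have "restrict (\<lambda>k. Y k \<omega>) {..n} \<in> {..n} \<rightarrow>\<^sub>E S" "\<omega> \<in> cyl n (restrict (\<lambda>k. Y k \<omega>) {..n})"
        using Y_in_S by (auto simp: cyl_def)
      then show "\<omega> \<in> (\<Union>y\<in>{..n} \<rightarrow>\<^sub>E S. B \<inter> cyl n y)" using \<omega> by blast
    qed
  qed auto
  moreover have "emeasure M (\<Union>y\<in>{..n} \<rightarrow>\<^sub>E S. B \<inter> cyl n y) = (\<integral>\<^sup>+y. emeasure M (B \<inter> cyl n y) \<partial>count_space ({..n} \<rightarrow>\<^sub>E S))"
  proof (rule emeasure_UN_countable)
    show "countable ({..n} \<rightarrow>\<^sub>E S)" by (intro countable_PiE) (auto simp: countable_S)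
    show "disjoint_family_on (\<lambda>y. B \<inter> cyl n y) ({..n} \<rightarrow>\<^sub>E S)"
    proof (unfold disjoint_family_on_def, intro ballI impI)
      fix y z assume yz: "y \<in> {..n} \<rightarrow>\<^sub>E S" "z \<in> {..n} \<rightarrow>\<^sub>E S" "y \<noteq> z"
      then obtain k where "k \<le> n" "y k \<noteq> z k" by (metis PiE_ext atMost_iff)
      then show "(B \<inter> cyl n y) \<inter> (B \<inter> cyl n z) = {}" by (auto simp: cyl_def)
    qed
  qed (use B in auto)
  ultimately show ?thesis by simp
qed

lemma null_if_null_on_paths:
  assumes "B \<in> sets M" "\<And>y. y \<in> {..n} \<rightarrow>\<^sub>E S \<Longrightarrow> emeasure M (B \<inter> cyl n y) = 0"
  shows "emeasure M B = 0"
  unfolding emeasure_paths[OF assms(1), of n]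
  by (subst nn_integral_cong[of _ _ "\<lambda>_. 0"]) (use assms in auto)

lemma AE_\<sigma>_pos: "AE \<omega> in M. \<forall>n. 0 < \<sigma> n \<omega>"
proof (subst AE_all_countable, intro allI)
  fix n
  have "emeasure M {\<omega>\<in>space M. \<not> 0 < \<sigma> n \<omega>} = 0"
  proof (rule null_if_null_on_paths[where n = n])
    fix y assume y: "y \<in> {..n} \<rightarrow>\<^sub>E S"
    let ?G = "{\<omega> \<in> space M. \<forall>k\<le>n. Y k \<omega> = y k \<and> 0 < \<sigma> k \<omega>}"
    have G_eq: "?G = cyl n y \<inter> {\<omega>\<in>space M. \<forall>k\<le>n. 0 < \<sigma> k \<omega>}" by (auto simp: cyl_def)
    have G: "?G \<in> sets M" unfolding G_eq by measurable
    have "measure M ?G = measure M (cyl n y)"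
      using hold[of n y "\<lambda>_. 0"] y by (auto simp: cyl_def)
    then have "measure M (cyl n y - ?G) = 0"
      using G by (subst finite_measure_Diff) (auto simp: cyl_def)
    then have "emeasure M (cyl n y - ?G) = 0" by (simp add: emeasure_eq_measure)
    then show "emeasure M ({\<omega>\<in>space M. \<not> 0 < \<sigma> n \<omega>} \<inter> cyl n y) = 0"
      by (rule emeasure_eq_0[rotated]) (use G in \<open>auto simp: cyl_def\<close>)
  qed auto
  then show "AE \<omega> in M. 0 < \<sigma> n \<omega>"
    by (subst AE_iff_measurable[OF _ refl]) auto
qed

lemma cyl_Suc_measure:
  assumes "y \<in> {..n} \<rightarrow> S" "z \<in> S"
  shows "measure M (cyl (Suc n) (y(Suc n := z))) = measure M (cyl n y) * (q (y n) z / R (y n))"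
proof -
  have "measure M (cyl (Suc n) (y(Suc n := z))) = measure M {\<omega> \<in> space M. Y 0 \<omega> = y 0} *
             (\<Prod>k<Suc n. q ((y(Suc n := z)) k) ((y(Suc n := z)) (Suc k)) / R ((y(Suc n := z)) k))"
    unfolding cyl_def using assms by (subst chain) auto
  also have "\<dots> = measure M {\<omega> \<in> space M. Y 0 \<omega> = y 0} * (\<Prod>k<n. q (y k) (y (Suc k)) / R (y k)) * (q (y n) z / R (y n))"
    by (simp add: mult.assoc)
  also have "measure M {\<omega> \<in> space M. Y 0 \<omega> = y 0} * (\<Prod>k<n. q (y k) (y (Suc k)) / R (y k)) = measure M (cyl n y)"
    unfolding cyl_def using assms by (subst chain) auto
  finally show ?thesis .
qed

lemma AE_jump_rate: "AE \<omega> in M. \<forall>n. q (Y n \<omega>) (Y (Suc n) \<omega>) \<noteq> 0"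
proof (subst AE_all_countable, intro allI)
  fix n
  have zero_rate_sets: "{\<omega>\<in>space M. q (Y n \<omega>) (Y (Suc n) \<omega>) = 0} \<in> sets M"
  proof -
    have "{\<omega>\<in>space M. q (Y n \<omega>) (Y (Suc n) \<omega>) = 0} = (\<Union>x\<in>S. \<Union>y\<in>{y\<in>S. q x y = 0}. {\<omega>\<in>space M. Y n \<omega> = x} \<inter> {\<omega>\<in>space M. Y (Suc n) \<omega> = y})"
      using Y_in_S by auto
    also have "\<dots> \<in> sets M" 
    proof (intro sets.countable_UN'')
      show "countable S" "\<And>x. countable {y\<in>S. q x y = 0}"
        using countable_S by (auto intro: countable_subset)
    qed measurable
    finally show ?thesis .
  qed
  have "emeasure M {\<omega>\<in>space M. q (Y n \<omega>) (Y (Suc n) \<omega>) = 0} = 0"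
  proof (rule null_if_null_on_paths[where n = "Suc n"])
    fix y assume y: "y \<in> {..Suc n} \<rightarrow>\<^sub>E S"
    show "emeasure M ({\<omega>\<in>space M. q (Y n \<omega>) (Y (Suc n) \<omega>) = 0} \<inter> cyl (Suc n) y) = 0"
    proof (cases "q (y n) (y (Suc n)) = 0")
      case True
      have "measure M (cyl (Suc n) (y(Suc n := y (Suc n)))) = measure M (cyl n y) * (q (y n) (y (Suc n)) / R (y n))"
        by (rule cyl_Suc_measure) (use y in auto)
      then have "emeasure M (cyl (Suc n) y) = 0" using True by (simp add: emeasure_eq_measure)
      then show ?thesis by (rule emeasure_eq_0[rotated]) auto
    next
      case False
      then have "{\<omega>\<in>space M. q (Y n \<omega>) (Y (Suc n) \<omega>) = 0} \<inter> cyl (Suc n) y = {}" by (auto simp: cyl_def)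
      then show ?thesis by simp
    qed
  qed (rule zero_rate_sets)
  then show "AE \<omega> in M. q (Y n \<omega>) (Y (Suc n) \<omega>) \<noteq> 0"
  proof (intro AE_I')
    assume "emeasure M {\<omega>\<in>space M. q (Y n \<omega>) (Y (Suc n) \<omega>) = 0} = 0"
    then show "{\<omega>\<in>space M. q (Y n \<omega>) (Y (Suc n) \<omega>) = 0} \<in> null_sets M"
      using zero_rate_sets by (rule null_setsI)
  qed blast
qed

text \<open>
  The path may be longer than the list of holding times considered: the remaining thresholds are set
  to zero, which holding times exceed almost surely.
\<close>
lemma cyl_tails:
  assumes y: "\<And>k. k \<le> m \<Longrightarrow> y k \<in> S" and nm: "n \<le> m" and s: "\<And>k. k \<le> n \<Longrightarrow> 0 \<le> s k"
  shows "measure M (cyl m y \<inter> {\<omega>\<in>space M. \<forall>k\<le>n. s k < \<sigma> k \<omega>}) = measure M (cyl m y) * (\<Prod>k\<le>n. exp (- (R (y k) * s k)))"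
proof -
  let ?s = "\<lambda>k. if k \<le> n then s k else 0"
  have "measure M (cyl m y \<inter> {\<omega>\<in>space M. \<forall>k\<le>n. s k < \<sigma> k \<omega>}) = measure M {\<omega> \<in> space M. \<forall>k\<le>m. Y k \<omega> = y k \<and> ?s k < \<sigma> k \<omega>}"
  proof (rule finite_measure_eq_AE)
    show "AE \<omega> in M. (\<omega> \<in> cyl m y \<inter> {\<omega>\<in>space M. \<forall>k\<le>n. s k < \<sigma> k \<omega>}) = (\<omega> \<in> {\<omega> \<in> space M. \<forall>k\<le>m. Y k \<omega> = y k \<and> ?s k < \<sigma> k \<omega>})"
      using AE_\<sigma>_pos by eventually_elim (use nm in \<open>auto simp: cyl_def\<close>)
    have "{\<omega> \<in> space M. \<forall>k\<le>m. Y k \<omega> = y k \<and> ?s k < \<sigma> k \<omega>} = cyl m y \<inter> {\<omega>\<in>space M. \<forall>k\<le>m. ?s k < \<sigma> k \<omega>}"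
      by (auto simp: cyl_def)
    also have "\<dots> \<in> sets M" by measurable
    finally show "{\<omega> \<in> space M. \<forall>k\<le>m. Y k \<omega> = y k \<and> ?s k < \<sigma> k \<omega>} \<in> sets M" .
  qed measurable
  also have "\<dots> = measure M {\<omega> \<in> space M. \<forall>k\<le>m. Y k \<omega> = y k} * (\<Prod>k\<le>m. exp (- (R (y k) * ?s k)))"
    by (rule hold) (use y s in auto)
  also have "(\<Prod>k\<le>m. exp (- (R (y k) * ?s k))) = (\<Prod>k\<le>n. exp (- (R (y k) * s k)))"
    using nm by (intro prod.mono_neutral_cong_right) auto
  finally show ?thesis by (simp add: cyl_def)
qed

lemma conditional_tails:
  assumes y: "\<And>k. k \<le> m \<Longrightarrow> y k \<in> S" and nm: "n \<le> m" and s: "\<And>k. k \<le> n \<Longrightarrow> 0 \<le> s k"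
    and pos: "measure M (cyl m y) \<noteq> 0"
  shows "measure (uniform_measure M (cyl m y)) {\<omega>\<in>space (uniform_measure M (cyl m y)). \<forall>k\<le>n. s k < \<sigma> k \<omega>} = (\<Prod>k\<le>n. exp (- (R (y k) * s k)))"
proof -
  have "measure (uniform_measure M (cyl m y)) {\<omega>\<in>space M. \<forall>k\<le>n. s k < \<sigma> k \<omega>} = measure M (cyl m y \<inter> {\<omega>\<in>space M. \<forall>k\<le>n. s k < \<sigma> k \<omega>}) / measure M (cyl m y)"
    using pos by (intro measure_uniform_measure) (auto simp: emeasure_eq_measure)
  also have "\<dots> = (\<Prod>k\<le>n. exp (- (R (y k) * s k)))"
    using pos by (subst cyl_tails[OF y nm s]) auto
  finally show ?thesis by simp
qed

text \<open>
  The law of a jump time, given the path, does not involve the states entered at or after that jump.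
\<close>
lemma conditional_law:
  assumes y: "\<And>k. k \<le> m \<Longrightarrow> y k \<in> S" and nm: "n \<le> m" and pos: "measure M (cyl m y) \<noteq> 0"
  shows "emeasure (uniform_measure M (cyl m y)) (jumped n t)
    = emeasure (\<Pi>\<^sub>M k\<in>{..n}. density lborel (exponential_density (R (y k)))) {f\<in>space (\<Pi>\<^sub>M k\<in>{..n}. borel). (\<Sum>k\<le>n. f k) \<le> t}"
proof -
  let ?Q = "uniform_measure M (cyl m y)"
  have ps: "prob_space ?Q" using pos by (intro prob_space_uniform_measure) (auto simp: emeasure_eq_measure)
  have [measurable]: "\<sigma> k \<in> borel_measurable ?Q" for k by simp
  have [measurable]: "{f\<in>space (\<Pi>\<^sub>M k\<in>{..n}. borel). (\<Sum>k\<le>n. f k) \<le> t} \<in> sets (\<Pi>\<^sub>M k\<in>{..n}. borel :: real measure)"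
    by measurable
  have "distr ?Q (\<Pi>\<^sub>M k\<in>{..n}. borel) (\<lambda>\<omega>. \<lambda>k\<in>{..n}. \<sigma> k \<omega>) = (\<Pi>\<^sub>M k\<in>{..n}. density lborel (exponential_density (R (y k))))"
    by (rule exponential_tails_law[OF ps]) (use rate_pos y nm conditional_tails[OF y nm _ pos] in auto)
  then have "emeasure (\<Pi>\<^sub>M k\<in>{..n}. density lborel (exponential_density (R (y k)))) {f\<in>space (\<Pi>\<^sub>M k\<in>{..n}. borel). (\<Sum>k\<le>n. f k) \<le> t}
     = emeasure (distr ?Q (\<Pi>\<^sub>M k\<in>{..n}. borel) (\<lambda>\<omega>. \<lambda>k\<in>{..n}. \<sigma> k \<omega>)) {f\<in>space (\<Pi>\<^sub>M k\<in>{..n}. borel). (\<Sum>k\<le>n. f k) \<le> t}"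
    by simp
  also have "\<dots> = emeasure ?Q ((\<lambda>\<omega>. \<lambda>k\<in>{..n}. \<sigma> k \<omega>) -` {f\<in>space (\<Pi>\<^sub>M k\<in>{..n}. borel). (\<Sum>k\<le>n. f k) \<le> t} \<inter> space ?Q)"
    by (rule emeasure_distr) measurable
  also have "(\<lambda>\<omega>. \<lambda>k\<in>{..n}. \<sigma> k \<omega>) -` {f\<in>space (\<Pi>\<^sub>M k\<in>{..n}. borel). (\<Sum>k\<le>n. f k) \<le> t} \<inter> space ?Q = (jumped n t)"
    by (auto simp: space_PiM T_def lessThan_Suc_atMost)
  finally show ?thesis by simp
qed

text \<open>
  Given the states visited so far, the current holding time is exponential and independent of the
  previous ones, so the identity for a single exponential clock applies.
\<close>
lemma conditional_waiting:
  assumes y: "y \<in> {..n} \<rightarrow> S"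
  shows "emeasure M (cyl n y \<inter> (jumped n t)) = ennreal (R (y n)) * (\<integral>\<^sup>+\<omega>. holding t (T n \<omega>) (T (Suc n) \<omega>) * indicator (cyl n y) \<omega> \<partial>M)"
proof (cases "measure M (cyl n y) = 0")
  case True
  then have 0: "emeasure M (cyl n y) = 0" by (simp add: emeasure_eq_measure)
  then have "AE \<omega> in M. \<omega> \<notin> cyl n y" by (intro AE_not_in) auto
  then have "(\<integral>\<^sup>+\<omega>. holding t (T n \<omega>) (T (Suc n) \<omega>) * indicator (cyl n y) \<omega> \<partial>M) = (\<integral>\<^sup>+\<omega>. 0 \<partial>M)"
    by (intro nn_integral_cong_AE) (auto elim!: eventually_mono)
  moreover have "emeasure M (cyl n y \<inter> (jumped n t)) = 0" by (rule emeasure_eq_0[OF _ 0]) auto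
  ultimately show ?thesis by simp
next
  case False
  let ?Q = "uniform_measure M (cyl n y)"
  have ne: "emeasure M (cyl n y) \<noteq> 0" "emeasure M (cyl n y) \<noteq> \<infinity>" using False by (auto simp: emeasure_eq_measure)
  interpret Q: prob_space ?Q using ne by (intro prob_space_uniform_measure) auto
  have [measurable]: "\<sigma> k \<in> borel_measurable ?Q" for k by simp
  have indep: "Q.indep_vars (\<lambda>_. borel) \<sigma> {..n}"
    and gt: "\<And>a. 0 \<le> a \<Longrightarrow> Q.prob {\<omega>\<in>space ?Q. a < \<sigma> n \<omega>} = exp (- (R (y n) * a))"
  proof -
    have yS: "y k \<in> S" if "k \<le> n" for k using y that by auto
    have l: "0 < R (y k)" if "k \<le> n" for k using yS that rate_pos by auto
    note tails = Q.exponential_tails_indep[of \<sigma> n "\<lambda>k. R (y k)", OF _ l conditional_tails[OF yS order_refl _ False]]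
    show "Q.indep_vars (\<lambda>_. borel) \<sigma> {..n}" by (rule tails(1)) auto
    show "Q.prob {\<omega>\<in>space ?Q. a < \<sigma> n \<omega>} = exp (- (R (y n) * a))" if "0 \<le> a" for a
      using that by (intro tails(3)) auto
  qed
  have "Q.indep_var borel (\<sigma> n) borel (\<lambda>\<omega>. \<Sum>k<n. \<sigma> k \<omega>)"
    by (rule Q.indep_vars_sum) (use indep in \<open>auto simp flip: lessThan_Suc lessThan_Suc_atMost\<close>)
  then have iv: "Q.indep_var borel (\<sigma> n) borel (T n)" by (simp add: T_def[abs_def])
  have Tpos: "AE \<omega> in ?Q. 0 \<le> T n \<omega>"
    using AE_\<sigma>_pos by (intro AE_uniform_measureI) (auto elim!: eventually_mono simp: T_def less_imp_le intro!: sum_nonneg)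
  have e: "emeasure ?Q {\<omega>\<in>space ?Q. T n \<omega> + \<sigma> n \<omega> \<le> t} = ennreal (R (y n)) * (\<integral>\<^sup>+\<omega>. holding t (T n \<omega>) (T n \<omega> + \<sigma> n \<omega>) \<partial>?Q)"
    by (rule Q.exponential_waiting[OF iv _ gt Tpos]) (use y rate_pos in auto)
  have "emeasure ?Q {\<omega>\<in>space ?Q. T n \<omega> + \<sigma> n \<omega> \<le> t} = emeasure M (cyl n y \<inter> (jumped n t)) / emeasure M (cyl n y)"
    by (simp add: T_Suc)
  moreover have "(\<integral>\<^sup>+\<omega>. holding t (T n \<omega>) (T n \<omega> + \<sigma> n \<omega>) \<partial>?Q) = (\<integral>\<^sup>+\<omega>. holding t (T n \<omega>) (T (Suc n) \<omega>) * indicator (cyl n y) \<omega> \<partial>M) / emeasure M (cyl n y)"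
    by (subst nn_integral_uniform_measure) (auto simp: T_Suc)
  ultimately have eq: "emeasure M (cyl n y \<inter> (jumped n t)) / emeasure M (cyl n y) = (ennreal (R (y n)) * (\<integral>\<^sup>+\<omega>. holding t (T n \<omega>) (T (Suc n) \<omega>) * indicator (cyl n y) \<omega> \<partial>M)) / emeasure M (cyl n y)"
    using e by (simp add: ennreal_times_divide)
  have "a = b" if "a / c = b / c" "c \<noteq> 0" "c \<noteq> \<infinity>" for a b c :: ennreal
    using that by (metis ennreal_divide_times ennreal_mult_divide_eq infinity_ennreal_def mult.commute mult_divide_eq_ennreal)
  from this[OF eq ne] show ?thesis .
qed

text \<open>
  The next state is conditionally independent of the holding times, since appending it to the path
  leaves their conditional law unchanged. It contributes the factor \<open>q (y n) z / R (y n)\<close>, and the total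
  rate cancels against the one in the waiting time identity.
\<close>
lemma path_step:
  assumes y: "y \<in> {..n} \<rightarrow> S" and z: "z \<in> S"
  shows "emeasure M (cyl n y \<inter> {\<omega>\<in>space M. Y (Suc n) \<omega> = z \<and> T (Suc n) \<omega> \<le> t}) = ennreal (q (y n) z) * (\<integral>\<^sup>+\<omega>. holding t (T n \<omega>) (T (Suc n) \<omega>) * indicator (cyl n y) \<omega> \<partial>M)"
proof -
  let ?y = "y(Suc n := z)" and ?E = "(jumped n t)"
  have yS: "?y k \<in> S" if "k \<le> Suc n" for k using that y z by auto
  have cS: "cyl n y \<inter> {\<omega>\<in>space M. Y (Suc n) \<omega> = z \<and> T (Suc n) \<omega> \<le> t} = cyl (Suc n) ?y \<inter> ?E"
    by (auto simp: cyl_def le_Suc_eq)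
  have sub: "cyl (Suc n) ?y \<subseteq> cyl n y" by (auto simp: cyl_def le_Suc_eq)
  have Rp: "0 < R (y n)" using y rate_pos by auto
  have q0: "0 \<le> q (y n) z" using rate_nonneg y z by auto
  have m: "measure M (cyl (Suc n) ?y) = measure M (cyl n y) * (q (y n) z / R (y n))"
    by (rule cyl_Suc_measure) fact+
  have "measure M (cyl (Suc n) ?y \<inter> ?E) = q (y n) z / R (y n) * measure M (cyl n y \<inter> ?E)"
  proof (cases "measure M (cyl (Suc n) ?y) = 0")
    case True
    have 1: "measure M (cyl (Suc n) ?y \<inter> ?E) = 0"
      using finite_measure_mono[of "cyl (Suc n) ?y \<inter> ?E" "cyl (Suc n) ?y"] True measure_nonneg[of M "cyl (Suc n) ?y \<inter> ?E"] by auto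
    from m True Rp consider "measure M (cyl n y) = 0" | "q (y n) z = 0" by auto
    then show ?thesis
    proof cases
      case 1
      have "measure M (cyl n y \<inter> ?E) = 0"
        using finite_measure_mono[of "cyl n y \<inter> ?E" "cyl n y"] 1 measure_nonneg[of M "cyl n y \<inter> ?E"] by auto
      then show ?thesis using \<open>measure M (cyl (Suc n) ?y \<inter> ?E) = 0\<close> by simp
    qed (use 1 in simp)
  next
    case False
    then have F: "measure M (cyl n y) \<noteq> 0" using m by auto
    have "emeasure (uniform_measure M (cyl (Suc n) ?y)) ?E = emeasure (uniform_measure M (cyl n y)) ?E"
    proof -
      have "emeasure (uniform_measure M (cyl (Suc n) ?y)) ?E = emeasure (\<Pi>\<^sub>M k\<in>{..n}. density lborel (exponential_density (R (?y k)))) {f\<in>space (\<Pi>\<^sub>M k\<in>{..n}. borel). (\<Sum>k\<le>n. f k) \<le> t}"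
        by (rule conditional_law) (use yS False in auto)
      also have "(\<Pi>\<^sub>M k\<in>{..n}. density lborel (exponential_density (R (?y k)))) = (\<Pi>\<^sub>M k\<in>{..n}. density lborel (exponential_density (R (y k))))"
        by (rule PiM_cong) auto
      also have "emeasure \<dots> {f\<in>space (\<Pi>\<^sub>M k\<in>{..n}. borel). (\<Sum>k\<le>n. f k) \<le> t} = emeasure (uniform_measure M (cyl n y)) ?E"
        by (rule conditional_law[symmetric]) (use y F in auto)
      finally show ?thesis .
    qed
    then have "measure (uniform_measure M (cyl (Suc n) ?y)) ?E = measure (uniform_measure M (cyl n y)) ?E"
      by (simp add: measure_def)
    moreover have "measure (uniform_measure M (cyl (Suc n) ?y)) ?E = measure M (cyl (Suc n) ?y \<inter> ?E) / measure M (cyl (Suc n) ?y)"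
      using False by (intro measure_uniform_measure) (auto simp: emeasure_eq_measure)
    moreover have "measure (uniform_measure M (cyl n y)) ?E = measure M (cyl n y \<inter> ?E) / measure M (cyl n y)"
      using F by (intro measure_uniform_measure) (auto simp: emeasure_eq_measure)
    ultimately have "measure M (cyl (Suc n) ?y \<inter> ?E) / measure M (cyl (Suc n) ?y) = measure M (cyl n y \<inter> ?E) / measure M (cyl n y)" by simp
    then have "measure M (cyl (Suc n) ?y \<inter> ?E) = measure M (cyl (Suc n) ?y) * measure M (cyl n y \<inter> ?E) / measure M (cyl n y)"
      using False by (simp add: field_simps)
    also have "\<dots> = q (y n) z / R (y n) * measure M (cyl n y \<inter> ?E)" unfolding m using F by simp
    finally show ?thesis .
  qed
  then have "emeasure M (cyl (Suc n) ?y \<inter> ?E) = ennreal (q (y n) z / R (y n)) * emeasure M (cyl n y \<inter> ?E)"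
    using q0 Rp by (simp add: emeasure_eq_measure flip: ennreal_mult)
  also have "\<dots> = ennreal (q (y n) z / R (y n) * R (y n)) * (\<integral>\<^sup>+\<omega>. holding t (T n \<omega>) (T (Suc n) \<omega>) * indicator (cyl n y) \<omega> \<partial>M)"
    using q0 Rp by (subst conditional_waiting[OF y]) (simp add: ennreal_mult mult.assoc del: times_divide_eq_left)
  finally show ?thesis using Rp cS by simp
qed

text \<open>
  The infinitesimal description of the process in integrated form: while the chain sits in \<open>x\<close>, a jump
  to \<open>z\<close> occurs at rate \<open>q x z\<close>.
\<close>
lemma step:
  assumes x: "x \<in> S" and z: "z \<in> S"
  shows "emeasure M {\<omega>\<in>space M. Y n \<omega> = x \<and> Y (Suc n) \<omega> = z \<and> T (Suc n) \<omega> \<le> t}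
    = ennreal (q x z) * (\<integral>\<^sup>+\<omega>. holding t (T n \<omega>) (T (Suc n) \<omega>) * indicator {\<omega>\<in>space M. Y n \<omega> = x} \<omega> \<partial>M)"
proof -
  let ?h = "\<lambda>\<omega>. holding t (T n \<omega>) (T (Suc n) \<omega>)"
  let ?B = "{\<omega>\<in>space M. Y n \<omega> = x \<and> Y (Suc n) \<omega> = z \<and> T (Suc n) \<omega> \<le> t}"
  have "?B = {\<omega>\<in>space M. Y n \<omega> = x} \<inter> {\<omega>\<in>space M. Y (Suc n) \<omega> = z} \<inter> (jumped n t)" by auto
  also have "\<dots> \<in> sets M" by measurable
  finally have B: "?B \<in> sets M" .
  have paths: "(\<integral>\<^sup>+\<omega>. ?h \<omega> * indicator {\<omega>\<in>space M. Y n \<omega> = x} \<omega> \<partial>M) = (\<integral>\<^sup>+y. (\<integral>\<^sup>+\<omega>. ?h \<omega> * indicator ({\<omega>\<in>space M. Y n \<omega> = x} \<inter> cyl n y) \<omega> \<partial>M) \<partial>count_space ({..n} \<rightarrow>\<^sub>E S))"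
  proof -
    have eq: "?h \<omega> * indicator {\<omega>\<in>space M. Y n \<omega> = x} \<omega> = (\<integral>\<^sup>+y. ?h \<omega> * indicator ({\<omega>\<in>space M. Y n \<omega> = x} \<inter> cyl n y) \<omega> \<partial>count_space ({..n} \<rightarrow>\<^sub>E S))" if \<omega>: "\<omega> \<in> space M" for \<omega>
    proof -
      let ?r = "restrict (\<lambda>k. Y k \<omega>) {..n}"
      have r: "?r \<in> {..n} \<rightarrow>\<^sub>E S" using Y_in_S \<omega> by auto
      have "(\<integral>\<^sup>+y. ?h \<omega> * indicator ({\<omega>\<in>space M. Y n \<omega> = x} \<inter> cyl n y) \<omega> \<partial>count_space ({..n} \<rightarrow>\<^sub>E S)) = (\<Sum>y\<in>{?r}. ?h \<omega> * indicator ({\<omega>\<in>space M. Y n \<omega> = x} \<inter> cyl n y) \<omega>)"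
      proof (rule nn_integral_count_space')
        fix y assume y: "y \<in> {..n} \<rightarrow>\<^sub>E S" "y \<notin> {?r}"
        then have "\<omega> \<notin> cyl n y" using PiE_ext[OF y(1) r] by (auto simp: cyl_def)
        then show "?h \<omega> * indicator ({\<omega>\<in>space M. Y n \<omega> = x} \<inter> cyl n y) \<omega> = 0" by simp
      qed (use r in auto)
      also have "\<dots> = ?h \<omega> * indicator {\<omega>\<in>space M. Y n \<omega> = x} \<omega>"
        using \<omega> by (auto simp: cyl_def split: split_indicator)
      finally show ?thesis by simp
    qed
    have "(\<integral>\<^sup>+\<omega>. ?h \<omega> * indicator {\<omega>\<in>space M. Y n \<omega> = x} \<omega> \<partial>M) = (\<integral>\<^sup>+\<omega>. (\<integral>\<^sup>+y. ?h \<omega> * indicator ({\<omega>\<in>space M. Y n \<omega> = x} \<inter> cyl n y) \<omega> \<partial>count_space ({..n} \<rightarrow>\<^sub>E S)) \<partial>M)"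
      by (intro nn_integral_cong eq)
    also have "\<dots> = (\<integral>\<^sup>+y. (\<integral>\<^sup>+\<omega>. ?h \<omega> * indicator ({\<omega>\<in>space M. Y n \<omega> = x} \<inter> cyl n y) \<omega> \<partial>M) \<partial>count_space ({..n} \<rightarrow>\<^sub>E S))"
      by (rule nn_integral_count_space_nn_integral) (auto intro!: countable_PiE simp: countable_S)
    finally show ?thesis .
  qed
  have "emeasure M ?B = (\<integral>\<^sup>+y. emeasure M (?B \<inter> cyl n y) \<partial>count_space ({..n} \<rightarrow>\<^sub>E S))"
    by (rule emeasure_paths) fact
  also have "\<dots> = (\<integral>\<^sup>+y. ennreal (q x z) * (\<integral>\<^sup>+\<omega>. ?h \<omega> * indicator ({\<omega>\<in>space M. Y n \<omega> = x} \<inter> cyl n y) \<omega> \<partial>M) \<partial>count_space ({..n} \<rightarrow>\<^sub>E S))"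
  proof (rule nn_integral_cong)
    fix y assume "y \<in> space (count_space ({..n} \<rightarrow>\<^sub>E S))"
    then have y: "y \<in> {..n} \<rightarrow>\<^sub>E S" by simp
    show "emeasure M (?B \<inter> cyl n y) = ennreal (q x z) * (\<integral>\<^sup>+\<omega>. ?h \<omega> * indicator ({\<omega>\<in>space M. Y n \<omega> = x} \<inter> cyl n y) \<omega> \<partial>M)"
    proof (cases "y n = x")
      case True
      have "?B \<inter> cyl n y = cyl n y \<inter> {\<omega>\<in>space M. Y (Suc n) \<omega> = z \<and> T (Suc n) \<omega> \<le> t}" "{\<omega>\<in>space M. Y n \<omega> = x} \<inter> cyl n y = cyl n y"
        using True by (auto simp: cyl_def)
      then show ?thesis using path_step[of y n z t] y z True by (auto simp: PiE_iff)
    next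
      case False
      then have "?B \<inter> cyl n y = {}" "{\<omega>\<in>space M. Y n \<omega> = x} \<inter> cyl n y = {}" by (auto simp: cyl_def)
      then show ?thesis by (simp only: emeasure_empty) simp
    qed
  qed
  also have "\<dots> = ennreal (q x z) * (\<integral>\<^sup>+\<omega>. ?h \<omega> * indicator {\<omega>\<in>space M. Y n \<omega> = x} \<omega> \<partial>M)"
    by (subst nn_integral_cmult) (auto simp: paths)
  finally show ?thesis .
qed

section \<open>Expected increments along the jump chain\<close>

definition succs :: "'s \<Rightarrow> 's set" where "succs x = {z \<in> S. q x z \<noteq> 0}"

definition generator :: "('s \<Rightarrow> real) \<Rightarrow> 's \<Rightarrow> real" where
  "generator f x = (\<Sum>z\<in>succs x. q x z * (f z - f x))"

text \<open>
  The almost sure properties of paths, collected so that the remaining pathwise arguments can be made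
  outcome by outcome.
\<close>
definition good :: "'a \<Rightarrow> bool" where
  "good \<omega> \<longleftrightarrow> (\<forall>n. 0 < \<sigma> n \<omega>) \<and> (\<forall>n. Y (Suc n) \<omega> \<in> succs (Y n \<omega>)) \<and> (\<forall>n. Y n \<omega> \<in> S)
     \<and> filterlim (\<lambda>n. T n \<omega>) at_top sequentially
     \<and> (\<forall>n t. T n \<omega> \<le> t \<and> t < T (Suc n) \<omega> \<longrightarrow> X t \<omega> = Y n \<omega>)"

text \<open>
  The time before \<open>t\<close> that is spent in the state \<open>Y n\<close> after the \<open>n\<close>-th jump.
\<close>
definition occ :: "nat \<Rightarrow> real \<Rightarrow> 'a \<Rightarrow> real" where
  "occ n t \<omega> = min (T (Suc n) \<omega>) t - min (T n \<omega>) t"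

lemma occ_measurable[measurable]: "occ n t \<in> borel_measurable M"
  unfolding occ_def[abs_def] by measurable

lemma finite_succs: "x \<in> S \<Longrightarrow> finite (succs x)"
  unfolding succs_def by (rule rate_finite)

lemma succs_in_S: "z \<in> succs x \<Longrightarrow> z \<in> S"
  by (simp add: succs_def)

lemma R_eq: assumes "x \<in> S" shows "R x = (\<Sum>z\<in>succs x. q x z)"
proof -
  have "R x = infsum (q x) (succs x)"
    unfolding total_rate_def by (rule infsum_cong_neutral) (auto simp: succs_def)
  then show ?thesis using finite_succs[OF assms] by simp
qed

lemma AE_good: "AE \<omega> in M. good \<omega>"
proof -
  have "AE \<omega> in M. \<omega> \<in> space M" by (rule AE_space)
  then show ?thesis using AE_\<sigma>_pos AE_jump_rate path
  proof eventually_elim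
    case (elim \<omega>)
    then show ?case using Y_in_S unfolding good_def succs_def T_def by auto
  qed
qed

lemma good_T_nonneg: assumes "good \<omega>" shows "0 \<le> T n \<omega>"
proof -
  have "0 \<le> \<sigma> k \<omega>" for k using assms unfolding good_def by (simp add: less_imp_le)
  then show ?thesis unfolding T_def by (intro sum_nonneg)
qed

lemma good_T_less: "good \<omega> \<Longrightarrow> T n \<omega> < T (Suc n) \<omega>"
  unfolding good_def by (simp add: T_Suc)

lemma good_holding: "good \<omega> \<Longrightarrow> holding t (T n \<omega>) (T (Suc n) \<omega>) = ennreal (occ n t \<omega>)"
  unfolding occ_def using good_T_nonneg good_T_less by (intro holding_eq) (auto simp: less_imp_le)

lemma good_occ: "good \<omega> \<Longrightarrow> 0 \<le> occ n t \<omega>"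
  unfolding occ_def using good_T_less[of \<omega> n] by (auto simp: min_def)

lemma sum_occ: "0 \<le> t \<Longrightarrow> (\<Sum>k<n. occ k t \<omega>) = min (T n \<omega>) t"
  unfolding occ_def by (subst sum_lessThan_telescope) (simp add: T_def)

lemma good_time:
  assumes "good \<omega>" "0 \<le> t"
  obtains n where "T n \<omega> \<le> t" "t < T (Suc n) \<omega>"
proof -
  have "eventually (\<lambda>n. t < T n \<omega>) sequentially"
    using assms unfolding good_def filterlim_at_top_dense by auto
  then have ex: "\<exists>n. t < T n \<omega>" by (auto simp: eventually_sequentially)
  define m where "m = (LEAST n. t < T n \<omega>)"
  have m: "t < T m \<omega>" unfolding m_def using ex by (rule LeastI_ex)
  have "m \<noteq> 0" using m assms(2) by (intro notI) (simp add: T_def)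
  then obtain n where n: "m = Suc n" by (cases m) auto
  then have "\<not> t < T n \<omega>" using not_less_Least[of n "\<lambda>n. t < T n \<omega>"] unfolding m_def by simp
  then show thesis using that[of n] m n by (simp add: not_less)
qed

lemma X_measurable'[measurable]: "0 \<le> t \<Longrightarrow> (\<lambda>\<omega>. f (X t \<omega>) :: 'b::topological_space) \<in> borel_measurable M"
  using measurable_compose[OF X_measurable, of t f] by simp

lemma AE_X_0: "AE \<omega> in M. X 0 \<omega> = Y 0 \<omega>"
  using AE_good
proof eventually_elim
  case (elim \<omega>)
  then have "T 0 \<omega> \<le> 0 \<and> 0 < T (Suc 0) \<omega>" using good_T_less[of \<omega> 0] by (simp add: T_def)
  then show ?case using elim unfolding good_def by auto
qed

lemma invariant_conserved:
  assumes inv: "\<And>x z. x \<in> S \<Longrightarrow> z \<in> succs x \<Longrightarrow> f z = f x" and t: "0 \<le> t"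
  shows "AE \<omega> in M. f (X t \<omega>) = f (X 0 \<omega>)"
  using AE_good AE_X_0
proof eventually_elim
  case (elim \<omega>)
  have "f (Y n \<omega>) = f (Y 0 \<omega>)" for n
  proof (induction n)
    case (Suc n)
    have "f (Y (Suc n) \<omega>) = f (Y n \<omega>)"
      using elim(1) inv[of "Y n \<omega>" "Y (Suc n) \<omega>"] unfolding good_def by blast
    then show ?case using Suc by simp
  qed simp
  moreover obtain n where "T n \<omega> \<le> t" "t < T (Suc n) \<omega>" using good_time elim t by blast
  then have "X t \<omega> = Y n \<omega>" using elim unfolding good_def by auto
  ultimately show ?case using elim by simp
qed

lemma nn_integral_split_Y:
  assumes [measurable]: "\<And>x. x \<in> S \<Longrightarrow> F x \<in> borel_measurable M"
  shows "(\<integral>\<^sup>+\<omega>. F (Y n \<omega>) \<omega> \<partial>M) = (\<integral>\<^sup>+x. (\<integral>\<^sup>+\<omega>. F x \<omega> * indicator {\<omega>\<in>space M. Y n \<omega> = x} \<omega> \<partial>M) \<partial>count_space S)"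
proof -
  have "(\<integral>\<^sup>+\<omega>. F (Y n \<omega>) \<omega> \<partial>M) = (\<integral>\<^sup>+\<omega>. (\<integral>\<^sup>+x. F x \<omega> * indicator {\<omega>\<in>space M. Y n \<omega> = x} \<omega> \<partial>count_space S) \<partial>M)"
  proof (rule nn_integral_cong)
    fix \<omega> assume \<omega>: "\<omega> \<in> space M"
    have "(\<integral>\<^sup>+x. F x \<omega> * indicator {\<omega>\<in>space M. Y n \<omega> = x} \<omega> \<partial>count_space S) = (\<Sum>x\<in>{Y n \<omega>}. F x \<omega> * indicator {\<omega>\<in>space M. Y n \<omega> = x} \<omega>)"
      by (rule nn_integral_count_space') (use Y_in_S[OF \<omega>] in auto)
    then show "F (Y n \<omega>) \<omega> = (\<integral>\<^sup>+x. F x \<omega> * indicator {\<omega>\<in>space M. Y n \<omega> = x} \<omega> \<partial>count_space S)"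
      using \<omega> by simp
  qed
  also have "\<dots> = (\<integral>\<^sup>+x. (\<integral>\<^sup>+\<omega>. F x \<omega> * indicator {\<omega>\<in>space M. Y n \<omega> = x} \<omega> \<partial>M) \<partial>count_space S)"
    by (rule nn_integral_count_space_nn_integral) (use countable_S in auto)
  finally show ?thesis .
qed

lemma jump_nn_integral:
  assumes G: "\<And>x z. x \<in> S \<Longrightarrow> z \<in> S \<Longrightarrow> 0 \<le> G x z"
  shows "(\<integral>\<^sup>+\<omega>. ennreal (G (Y n \<omega>) (Y (Suc n) \<omega>)) * indicator (jumped n t) \<omega> \<partial>M)
    = (\<integral>\<^sup>+\<omega>. ennreal (\<Sum>z\<in>succs (Y n \<omega>). q (Y n \<omega>) z * G (Y n \<omega>) z) * holding t (T n \<omega>) (T (Suc n) \<omega>) \<partial>M)"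
proof -
  let ?I = "\<lambda>\<omega>. indicator (jumped n t) \<omega> :: ennreal"
  let ?h = "\<lambda>\<omega>. holding t (T n \<omega>) (T (Suc n) \<omega>)"
  let ?i = "\<lambda>n x. indicator {\<omega>\<in>space M. Y n \<omega> = x} :: 'a \<Rightarrow> ennreal"
  have "(\<integral>\<^sup>+\<omega>. ennreal (G (Y n \<omega>) (Y (Suc n) \<omega>)) * ?I \<omega> \<partial>M)
      = (\<integral>\<^sup>+x. (\<integral>\<^sup>+\<omega>. ennreal (G x (Y (Suc n) \<omega>)) * ?I \<omega> * ?i n x \<omega> \<partial>M) \<partial>count_space S)"
    by (rule nn_integral_split_Y[of "\<lambda>x \<omega>. ennreal (G x (Y (Suc n) \<omega>)) * ?I \<omega>" n]) measurable
  also have "\<dots> = (\<integral>\<^sup>+x. (\<integral>\<^sup>+\<omega>. ennreal (\<Sum>z\<in>succs x. q x z * G x z) * ?h \<omega> * ?i n x \<omega> \<partial>M) \<partial>count_space S)"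
  proof (rule nn_integral_cong)
    fix x assume "x \<in> space (count_space S)"
    then have x: "x \<in> S" by simp
    let ?o = "\<integral>\<^sup>+\<omega>. ?h \<omega> * ?i n x \<omega> \<partial>M"
    have "(\<integral>\<^sup>+\<omega>. ennreal (G x (Y (Suc n) \<omega>)) * ?I \<omega> * ?i n x \<omega> \<partial>M)
       = (\<integral>\<^sup>+z. (\<integral>\<^sup>+\<omega>. ennreal (G x z) * ?I \<omega> * ?i n x \<omega> * ?i (Suc n) z \<omega> \<partial>M) \<partial>count_space S)"
      by (rule nn_integral_split_Y[of "\<lambda>z \<omega>. ennreal (G x z) * ?I \<omega> * ?i n x \<omega>" "Suc n"]) measurable
    also have "\<dots> = (\<integral>\<^sup>+z. ennreal (q x z * G x z) * ?o \<partial>count_space S)"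
    proof (rule nn_integral_cong)
      fix z assume "z \<in> space (count_space S)"
      then have z: "z \<in> S" by simp
      let ?B = "{\<omega>\<in>space M. Y n \<omega> = x \<and> Y (Suc n) \<omega> = z \<and> T (Suc n) \<omega> \<le> t}"
      have "?B = {\<omega>\<in>space M. Y n \<omega> = x} \<inter> {\<omega>\<in>space M. Y (Suc n) \<omega> = z} \<inter> (jumped n t)" by auto
      also have "\<dots> \<in> sets M" by measurable
      finally have B: "?B \<in> sets M" .
      have "(\<integral>\<^sup>+\<omega>. ennreal (G x z) * ?I \<omega> * ?i n x \<omega> * ?i (Suc n) z \<omega> \<partial>M) = (\<integral>\<^sup>+\<omega>. ennreal (G x z) * indicator ?B \<omega> \<partial>M)"
        by (rule nn_integral_cong) (auto split: split_indicator)
      also have "\<dots> = ennreal (G x z) * emeasure M ?B" by (rule nn_integral_cmult_indicator[OF B])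
      also have "\<dots> = ennreal (q x z * G x z) * ?o"
        using step[OF x z] G[OF x z] rate_nonneg[OF x z] by (simp add: ennreal_mult mult_ac)
      finally show "(\<integral>\<^sup>+\<omega>. ennreal (G x z) * ?I \<omega> * ?i n x \<omega> * ?i (Suc n) z \<omega> \<partial>M) = ennreal (q x z * G x z) * ?o" .
    qed
    also have "\<dots> = (\<Sum>z\<in>succs x. ennreal (q x z * G x z) * ?o)"
      by (rule nn_integral_count_space') (use finite_succs[OF x] in \<open>auto simp: succs_def\<close>)
    also have "\<dots> = (\<Sum>z\<in>succs x. ennreal (q x z * G x z)) * ?o" by (simp add: sum_distrib_right)
    also have "(\<Sum>z\<in>succs x. ennreal (q x z * G x z)) = ennreal (\<Sum>z\<in>succs x. q x z * G x z)"
      using G rate_nonneg x by (intro sum_ennreal) (auto simp: succs_def)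
    also have "\<dots> * ?o = (\<integral>\<^sup>+\<omega>. ennreal (\<Sum>z\<in>succs x. q x z * G x z) * ?h \<omega> * ?i n x \<omega> \<partial>M)"
      by (subst nn_integral_cmult[symmetric]) (auto simp: mult.assoc)
    finally show "(\<integral>\<^sup>+\<omega>. ennreal (G x (Y (Suc n) \<omega>)) * ?I \<omega> * ?i n x \<omega> \<partial>M) = (\<integral>\<^sup>+\<omega>. ennreal (\<Sum>z\<in>succs x. q x z * G x z) * ?h \<omega> * ?i n x \<omega> \<partial>M)" .
  qed
  also have "\<dots> = (\<integral>\<^sup>+\<omega>. ennreal (\<Sum>z\<in>succs (Y n \<omega>). q (Y n \<omega>) z * G (Y n \<omega>) z) * ?h \<omega> \<partial>M)"
    by (rule nn_integral_split_Y[of "\<lambda>x \<omega>. ennreal (\<Sum>z\<in>succs x. q x z * G x z) * ?h \<omega>" n, symmetric]) measurable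
  finally show ?thesis .
qed

text \<open>
  Unbounded rates do no harm here: the expectation on the jump side is at most \<open>D\<close>, and it equals the
  expectation on the rate side.
\<close>
lemma jump_integral_nonneg:
  fixes n :: nat and t :: real
  assumes G: "\<And>x z. x \<in> S \<Longrightarrow> z \<in> S \<Longrightarrow> 0 \<le> G x z" and D: "\<And>x z. x \<in> S \<Longrightarrow> z \<in> succs x \<Longrightarrow> G x z \<le> D"
  defines "A \<equiv> \<lambda>\<omega>. G (Y n \<omega>) (Y (Suc n) \<omega>) * indicator (jumped n t) \<omega>"
    and "B \<equiv> \<lambda>\<omega>. (\<Sum>z\<in>succs (Y n \<omega>). q (Y n \<omega>) z * G (Y n \<omega>) z) * occ n t \<omega>"
  shows "integrable M A" "integrable M B" "integral\<^sup>L M A = integral\<^sup>L M B"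
proof -
  have Gm[measurable]: "(\<lambda>\<omega>. G (Y n \<omega>) (Y (Suc n) \<omega>)) \<in> borel_measurable M"
  proof (rule measurable_compose_countable'[where f = "\<lambda>x \<omega>. G x (Y (Suc n) \<omega>)" and g = "Y n" and I = S, OF _ Y_measurable countable_S])
    show "(\<lambda>\<omega>. G x (Y (Suc n) \<omega>)) \<in> borel_measurable M" for x by measurable
  qed
  have A_nonneg: "AE \<omega> in M. 0 \<le> A \<omega>"
    using AE_good by eventually_elim (auto simp: A_def good_def G split: split_indicator)
  have L_nonneg: "0 \<le> (\<Sum>z\<in>succs x. q x z * G x z)" if "x \<in> S" for x
    using that G rate_nonneg by (intro sum_nonneg mult_nonneg_nonneg) (auto simp: succs_def)
  have B_nonneg: "AE \<omega> in M. 0 \<le> B \<omega>"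
    using AE_good by eventually_elim (auto simp: B_def good_def[of \<omega> for \<omega>] intro!: mult_nonneg_nonneg L_nonneg good_occ)
  have [measurable]: "A \<in> borel_measurable M" "B \<in> borel_measurable M"
    unfolding A_def B_def by measurable
  show iA: "integrable M A"
  proof (rule integrable_const_bound[of _ D])
    show "AE \<omega> in M. norm (A \<omega>) \<le> D"
      using AE_good
    proof eventually_elim
      case (elim \<omega>)
      then have "Y n \<omega> \<in> S" "Y (Suc n) \<omega> \<in> succs (Y n \<omega>)" by (auto simp: good_def)
      then have "0 \<le> G (Y n \<omega>) (Y (Suc n) \<omega>)" "G (Y n \<omega>) (Y (Suc n) \<omega>) \<le> D"
        using G D succs_in_S by blast+
      then show ?case by (auto simp: A_def split: split_indicator)
    qed
  qed measurable
  have eq: "(\<integral>\<^sup>+\<omega>. ennreal (A \<omega>) \<partial>M) = (\<integral>\<^sup>+\<omega>. ennreal (B \<omega>) \<partial>M)"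
  proof -
    have "(\<integral>\<^sup>+\<omega>. ennreal (A \<omega>) \<partial>M) = (\<integral>\<^sup>+\<omega>. ennreal (G (Y n \<omega>) (Y (Suc n) \<omega>)) * indicator (jumped n t) \<omega> \<partial>M)"
      by (rule nn_integral_cong) (auto simp: A_def split: split_indicator)
    also have "\<dots> = (\<integral>\<^sup>+\<omega>. ennreal (\<Sum>z\<in>succs (Y n \<omega>). q (Y n \<omega>) z * G (Y n \<omega>) z) * holding t (T n \<omega>) (T (Suc n) \<omega>) \<partial>M)"
      by (rule jump_nn_integral) (rule G)
    also have "\<dots> = (\<integral>\<^sup>+\<omega>. ennreal (B \<omega>) \<partial>M)"
    proof (rule nn_integral_cong_AE)
      show "AE \<omega> in M. ennreal (\<Sum>z\<in>succs (Y n \<omega>). q (Y n \<omega>) z * G (Y n \<omega>) z) * holding t (T n \<omega>) (T (Suc n) \<omega>) = ennreal (B \<omega>)"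
        using AE_good
      proof eventually_elim
        case (elim \<omega>)
        then have "Y n \<omega> \<in> S" by (auto simp: good_def)
        then show ?case using elim L_nonneg good_occ[OF elim, of n t] by (simp add: good_holding B_def ennreal_mult)
      qed
    qed
    finally show ?thesis .
  qed
  show iB: "integrable M B"
  proof (rule integrableI_nonneg)
    have "(\<integral>\<^sup>+\<omega>. ennreal (A \<omega>) \<partial>M) = ennreal (integral\<^sup>L M A)" by (rule nn_integral_eq_integral[OF iA A_nonneg])
    then show "(\<integral>\<^sup>+\<omega>. ennreal (B \<omega>) \<partial>M) < \<infinity>" using eq by simp
  qed (use B_nonneg in auto)
  show "integral\<^sup>L M A = integral\<^sup>L M B"
    using eq by (simp add: integral_eq_nn_integral A_nonneg B_nonneg)
qed

text \<open>
  The integral of the total rate over one sojourn has as its mean the probability that the sojourn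
  ends before \<open>t\<close>. In particular, the mean number of jumps is the mean of the integrated total rate.
\<close>
lemma jump_probability:
  shows "integrable M (\<lambda>\<omega>. R (Y n \<omega>) * occ n t \<omega>)"
    and "(\<integral>\<omega>. R (Y n \<omega>) * occ n t \<omega> \<partial>M) = prob (jumped n t)"
proof -
  note j = jump_integral_nonneg[of "\<lambda>_ _. 1" 1 n t]
  have eq: "(\<Sum>z\<in>succs (Y n \<omega>). q (Y n \<omega>) z * 1) * occ n t \<omega> = R (Y n \<omega>) * occ n t \<omega>" if "\<omega> \<in> space M" for \<omega>
    using R_eq[OF Y_in_S[OF that]] by simp
  show "integrable M (\<lambda>\<omega>. R (Y n \<omega>) * occ n t \<omega>)"
  proof -
    have "integrable M (\<lambda>\<omega>. (\<Sum>z\<in>succs (Y n \<omega>). q (Y n \<omega>) z * 1) * occ n t \<omega>)" by (rule j(2)) auto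
    then show ?thesis by (subst (asm) Bochner_Integration.integrable_cong[OF refl eq])
  qed
  have "(\<integral>\<omega>. R (Y n \<omega>) * occ n t \<omega> \<partial>M) = (\<integral>\<omega>. (\<Sum>z\<in>succs (Y n \<omega>). q (Y n \<omega>) z * 1) * occ n t \<omega> \<partial>M)"
    by (rule Bochner_Integration.integral_cong[OF refl eq[symmetric]])
  also have "\<dots> = (\<integral>\<omega>. 1 * indicator (jumped n t) \<omega> \<partial>M)"
    by (rule j(3)[symmetric]) auto
  finally show "(\<integral>\<omega>. R (Y n \<omega>) * occ n t \<omega> \<partial>M) = prob (jumped n t)" by simp
qed

text \<open>
  Dynkin's formula for a single jump.
\<close>
lemma jump_integral:
  fixes n :: nat and t :: real
  assumes D: "\<And>x z. x \<in> S \<Longrightarrow> z \<in> succs x \<Longrightarrow> \<bar>f z - f x\<bar> \<le> D"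
  defines "A \<equiv> \<lambda>\<omega>. (f (Y (Suc n) \<omega>) - f (Y n \<omega>)) * indicator (jumped n t) \<omega>"
    and "B \<equiv> \<lambda>\<omega>. generator f (Y n \<omega>) * occ n t \<omega>"
  shows "integrable M A" "integrable M B" "integral\<^sup>L M A = integral\<^sup>L M B"
proof -
  let ?P = "\<lambda>x z. max 0 (f z - f x)" and ?N = "\<lambda>x z. max 0 (f x - f z)"
  have DP: "?P x z \<le> D" "?N x z \<le> D" if "x \<in> S" "z \<in> succs x" for x z
    using D[OF that] by auto
  note P = jump_integral_nonneg[of ?P D n t, OF _ DP(1), simplified]
  note N = jump_integral_nonneg[of ?N D n t, OF _ DP(2), simplified]
  have A: "A = (\<lambda>\<omega>. ?P (Y n \<omega>) (Y (Suc n) \<omega>) * indicator (jumped n t) \<omega>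
      - ?N (Y n \<omega>) (Y (Suc n) \<omega>) * indicator (jumped n t) \<omega>)"
    unfolding A_def by (auto simp: max_def fun_eq_iff split: split_indicator)
  have "q x z * (f z - f x) = q x z * ?P x z - q x z * ?N x z" for x z
    by (auto simp: max_def algebra_simps)
  then have B: "B = (\<lambda>\<omega>. (\<Sum>z\<in>succs (Y n \<omega>). q (Y n \<omega>) z * ?P (Y n \<omega>) z) * occ n t \<omega>
      - (\<Sum>z\<in>succs (Y n \<omega>). q (Y n \<omega>) z * ?N (Y n \<omega>) z) * occ n t \<omega>)"
    unfolding B_def generator_def by (simp add: sum_subtractf left_diff_distrib)
  show "integrable M A" unfolding A by (intro Bochner_Integration.integrable_diff P N)
  show "integrable M B" unfolding B by (intro Bochner_Integration.integrable_diff P N)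
  show "integral\<^sup>L M A = integral\<^sup>L M B"
    unfolding A B using P N by (simp add: Bochner_Integration.integral_diff)
qed

text \<open>
  Adding up the increments along the first \<open>n\<close> jumps, as far as they happen by time \<open>t\<close>, gives the
  value at the state that is occupied after the last of them.
\<close>
lemma good_telescope:
  assumes "good \<omega>" "0 \<le> t" "\<omega> \<in> space M"
  shows "\<exists>m\<le>n. f (Y 0 \<omega>) + (\<Sum>k<n. (f (Y (Suc k) \<omega>) - f (Y k \<omega>)) * indicator (jumped k t) \<omega>) = (f (Y m \<omega>) :: real)
     \<and> T m \<omega> \<le> t \<and> (T n \<omega> \<le> t \<longrightarrow> m = n) \<and> (t < T n \<omega> \<longrightarrow> t < T (Suc m) \<omega>)"
proof (induction n)
  case 0
  then show ?case using assms by (simp add: T_def)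
next
  case (Suc n)
  then obtain m where m: "m \<le> n" "f (Y 0 \<omega>) + (\<Sum>k<n. (f (Y (Suc k) \<omega>) - f (Y k \<omega>)) * indicator (jumped k t) \<omega>) = f (Y m \<omega>)"
     "T m \<omega> \<le> t" "T n \<omega> \<le> t \<longrightarrow> m = n" "t < T n \<omega> \<longrightarrow> t < T (Suc m) \<omega>" by blast
  show ?case
  proof (cases "T (Suc n) \<omega> \<le> t")
    case True
    then have "m = n" using m good_T_less[OF assms(1), of n] by auto
    then show ?thesis using True m assms by (intro exI[of _ "Suc n"]) auto
  next
    case False
    then show ?thesis using m assms by (intro exI[of _ m]) (auto simp: not_le)
  qed
qed

text \<open>
  The Foster-Lyapunov argument. Stop after \<open>n\<close> jumps: since \<open>V\<close> stays nonnegative, its accumulated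
  drift cannot fall below \<open>- E V(X\<^sub>0)\<close>, and the drift bound leaves at most \<open>(E V(X\<^sub>0) + a t) / b\<close> for the
  mean integrated total rate, which is the mean number of jumps. The bound is uniform in \<open>n\<close>.
\<close>
lemma expected_jumps_finite:
  assumes V: "\<And>x. x \<in> S \<Longrightarrow> 0 \<le> V x" and D: "\<And>x z. x \<in> S \<Longrightarrow> z \<in> succs x \<Longrightarrow> \<bar>V z - V x\<bar> \<le> D"
    and int: "integrable M (\<lambda>\<omega>. V (X 0 \<omega>))" and b: "0 < b" and a: "0 \<le> a"
    and drift: "\<And>x. x \<in> S \<Longrightarrow> generator V x \<le> a - b * R x" and t: "0 \<le> t"
  shows "summable (\<lambda>k. prob (jumped k t))"
proof (rule summableI_nonneg_bounded)
  fix n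
  let ?A = "\<lambda>k \<omega>. (V (Y (Suc k) \<omega>) - V (Y k \<omega>)) * indicator (jumped k t) \<omega>"
  note j = jump_integral[of V D _ t, OF D]
  have int0: "integrable M (\<lambda>\<omega>. V (Y 0 \<omega>))"
    using int by (rule integrable_cong_AE_imp) (use AE_X_0 in \<open>auto elim!: eventually_mono\<close>)
  have occ_int: "integrable M (occ k t)" for k
  proof (rule integrable_const_bound[of _ t])
    show "AE \<omega> in M. norm (occ k t \<omega>) \<le> t"
      using AE_good
    proof eventually_elim
      case (elim \<omega>)
      then show ?case
        using good_occ[OF elim, of k t] good_T_nonneg[OF elim, of k] t by (simp add: occ_def min_def split: if_splits)
    qed
  qed measurable
  have "0 \<le> (\<integral>\<omega>. V (Y 0 \<omega>) + (\<Sum>k<n. ?A k \<omega>) \<partial>M)"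
  proof (rule integral_nonneg_AE)
    show "AE \<omega> in M. 0 \<le> V (Y 0 \<omega>) + (\<Sum>k<n. ?A k \<omega>)"
      using AE_good AE_space
    proof eventually_elim
      case (elim \<omega>)
      then obtain m where "V (Y 0 \<omega>) + (\<Sum>k<n. ?A k \<omega>) = V (Y m \<omega>)"
        using good_telescope[OF elim(1) t elim(2), of n V] by blast
      then show ?case using V Y_in_S[OF elim(2)] by simp
    qed
  qed
  also have "\<dots> = (\<integral>\<omega>. V (Y 0 \<omega>) \<partial>M) + (\<Sum>k<n. \<integral>\<omega>. generator V (Y k \<omega>) * occ k t \<omega> \<partial>M)"
  proof -
    have A_int: "integrable M (?A k)" for k by (rule j(1))
    have A_eq: "integral\<^sup>L M (?A k) = (\<integral>\<omega>. generator V (Y k \<omega>) * occ k t \<omega> \<partial>M)" for k by (rule j(3))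
    have "(\<integral>\<omega>. V (Y 0 \<omega>) + (\<Sum>k<n. ?A k \<omega>) \<partial>M) = (\<integral>\<omega>. V (Y 0 \<omega>) \<partial>M) + (\<integral>\<omega>. (\<Sum>k<n. ?A k \<omega>) \<partial>M)"
      using int0 A_int by (intro Bochner_Integration.integral_add Bochner_Integration.integrable_sum)
    also have "(\<integral>\<omega>. (\<Sum>k<n. ?A k \<omega>) \<partial>M) = (\<Sum>k<n. integral\<^sup>L M (?A k))"
      using A_int by (intro Bochner_Integration.integral_sum)
    finally show ?thesis unfolding A_eq .
  qed
  also have "(\<Sum>k<n. \<integral>\<omega>. generator V (Y k \<omega>) * occ k t \<omega> \<partial>M) \<le> (\<Sum>k<n. \<integral>\<omega>. a * occ k t \<omega> - b * (R (Y k \<omega>) * occ k t \<omega>) \<partial>M)"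
  proof (intro sum_mono integral_mono_AE)
    fix k
    show "AE \<omega> in M. generator V (Y k \<omega>) * occ k t \<omega> \<le> a * occ k t \<omega> - b * (R (Y k \<omega>) * occ k t \<omega>)"
      using AE_good
    proof eventually_elim
      case (elim \<omega>)
      have "generator V (Y k \<omega>) * occ k t \<omega> \<le> (a - b * R (Y k \<omega>)) * occ k t \<omega>"
        using elim drift good_occ[OF elim] by (intro mult_right_mono) (auto simp: good_def)
      then show ?case by (simp add: algebra_simps)
    qed
  qed (use j occ_int jump_probability in auto)
  also have "\<dots> = (\<Sum>k<n. a * (\<integral>\<omega>. occ k t \<omega> \<partial>M) - b * prob (jumped k t))"
    using occ_int jump_probability by (simp add: Bochner_Integration.integral_diff)
  also have "\<dots> = a * (\<integral>\<omega>. (\<Sum>k<n. occ k t \<omega>) \<partial>M) - b * (\<Sum>k<n. prob (jumped k t))"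
    using occ_int by (simp add: sum_subtractf sum_distrib_left Bochner_Integration.integral_sum)
  also have "(\<integral>\<omega>. (\<Sum>k<n. occ k t \<omega>) \<partial>M) = (\<integral>\<omega>. min (T n \<omega>) t \<partial>M)" using t by (simp add: sum_occ)
  also have "a * (\<integral>\<omega>. min (T n \<omega>) t \<partial>M) \<le> a * t"
  proof (intro mult_left_mono a)
    have "integrable M (\<lambda>\<omega>. min (T n \<omega>) t)"
      by (rule integrable_const_bound[of _ t]) (use AE_good t in \<open>auto elim!: eventually_mono simp: good_T_nonneg min_def\<close>)
    then have "(\<integral>\<omega>. min (T n \<omega>) t \<partial>M) \<le> (\<integral>\<omega>. t \<partial>M)" by (intro integral_mono) auto
    then show "(\<integral>\<omega>. min (T n \<omega>) t \<partial>M) \<le> t" by (simp add: prob_space)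
  qed
  finally have "b * (\<Sum>k<n. prob (jumped k t)) \<le> (\<integral>\<omega>. V (Y 0 \<omega>) \<partial>M) + a * t" by simp
  then show "(\<Sum>k<n. prob (jumped k t)) \<le> ((\<integral>\<omega>. V (Y 0 \<omega>) \<partial>M) + a * t) / b"
    using b by (simp add: field_simps)
qed simp

section \<open>Dynkin's formula\<close>

lemma generator_bound:
  assumes D: "\<And>z. z \<in> succs x \<Longrightarrow> \<bar>f z - f x\<bar> \<le> D" and x: "x \<in> S"
  shows "\<bar>generator f x\<bar> \<le> D * R x"
proof -
  have "\<bar>generator f x\<bar> \<le> (\<Sum>z\<in>succs x. \<bar>q x z * (f z - f x)\<bar>)" unfolding generator_def by (rule sum_abs)
  also have "\<dots> \<le> (\<Sum>z\<in>succs x. q x z * D)"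
  proof (rule sum_mono)
    fix z assume z: "z \<in> succs x"
    have "0 \<le> q x z" using rate_nonneg x z succs_in_S by blast
    then show "\<bar>q x z * (f z - f x)\<bar> \<le> q x z * D" using D[OF z] by (simp add: abs_mult mult_left_mono)
  qed
  also have "\<dots> = D * R x" using R_eq[OF x] by (simp add: sum_distrib_left mult.commute)
  finally show ?thesis .
qed

text \<open>
  Only finitely many jumps occur by time \<open>t\<close>, so \<open>f(X\<^sub>t) - f(X\<^sub>0)\<close> is almost surely a finite sum of
  increments. Each is at most \<open>D\<close> in size, and the mean number of jumps dominates the series.
\<close>
lemma dynkin_increments:
  assumes D: "\<And>x z. x \<in> S \<Longrightarrow> z \<in> succs x \<Longrightarrow> \<bar>f z - f x\<bar> \<le> D"
    and int: "integrable M (\<lambda>\<omega>. f (X 0 \<omega>))" and t: "0 \<le> t"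
    and jumps: "summable (\<lambda>k. prob (jumped k t))"
  shows "integrable M (\<lambda>\<omega>. f (X t \<omega>))"
    and "(\<lambda>k. \<integral>\<omega>. generator f (Y k \<omega>) * occ k t \<omega> \<partial>M) sums ((\<integral>\<omega>. f (X t \<omega>) \<partial>M) - (\<integral>\<omega>. f (X 0 \<omega>) \<partial>M))"
proof -
  let ?A = "\<lambda>k \<omega>. (f (Y (Suc k) \<omega>) - f (Y k \<omega>)) * indicator (jumped k t) \<omega>"
  note j = jump_integral[of f D _ t, OF D]
  have fin: "AE \<omega> in M. (\<exists>n. \<forall>k\<ge>n. ?A k \<omega> = 0) \<and> (\<Sum>k. ?A k \<omega>) = f (X t \<omega>) - f (X 0 \<omega>)"
    using AE_good AE_X_0 AE_space
  proof eventually_elim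
    case (elim \<omega>)
    obtain n where n: "T n \<omega> \<le> t" "t < T (Suc n) \<omega>" using good_time[OF elim(1) t] by blast
    have late: "t < T (Suc k) \<omega>" if "n \<le> k" for k
      using that by (induction k rule: dec_induct) (use n good_T_less[OF elim(1)] in \<open>auto intro: less_trans\<close>)
    have zero: "\<forall>k\<ge>n. ?A k \<omega> = 0" using late by (auto simp: not_le split: split_indicator)
    have "(\<Sum>k. ?A k \<omega>) = (\<Sum>k<n. ?A k \<omega>)"
      by (rule suminf_finite) (use zero in \<open>auto simp: not_less\<close>)
    moreover obtain m where "f (Y 0 \<omega>) + (\<Sum>k<n. ?A k \<omega>) = f (Y m \<omega>)" "T n \<omega> \<le> t \<longrightarrow> m = n"
      using good_telescope[OF elim(1) t elim(3), of n f] by blast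
    moreover have "X t \<omega> = Y n \<omega>" using elim(1) n unfolding good_def by blast
    ultimately have "(\<Sum>k. ?A k \<omega>) = f (X t \<omega>) - f (X 0 \<omega>)" using n elim(2) by simp
    then show ?case using zero by blast
  qed
  have "AE \<omega> in M. summable (\<lambda>k. norm (?A k \<omega>))"
    using fin
  proof eventually_elim
    case (elim \<omega>)
    then obtain n where "\<forall>k\<ge>n. ?A k \<omega> = 0" by blast
    then show ?case by (intro summable_finite[of "{..<n}"]) (auto simp: not_less)
  qed
  moreover have "summable (\<lambda>k. \<integral>\<omega>. norm (?A k \<omega>) \<partial>M)"
  proof (rule summable_comparison_test'[where g = "\<lambda>k. D * prob (jumped k t)" and N = 0])
    show "summable (\<lambda>k. D * prob (jumped k t))" by (rule summable_mult[OF jumps])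
    fix k
    have "(\<integral>\<omega>. norm (?A k \<omega>) \<partial>M) \<le> (\<integral>\<omega>. D * indicator (jumped k t) \<omega> \<partial>M)"
    proof (rule integral_mono_AE)
      show "integrable M (\<lambda>\<omega>. norm (?A k \<omega>))" using j(1) by (rule integrable_norm)
      show "AE \<omega> in M. norm (?A k \<omega>) \<le> D * indicator (jumped k t) \<omega>"
        using AE_good
      proof eventually_elim
        case (elim \<omega>)
        then have "\<bar>f (Y (Suc k) \<omega>) - f (Y k \<omega>)\<bar> \<le> D" using D unfolding good_def by blast
        then show ?case by (simp add: abs_mult split: split_indicator)
      qed
      show "integrable M (\<lambda>\<omega>. D * indicator (jumped k t) \<omega>)"
        by (intro integrable_mult_right integrable_real_indicator) (auto simp: emeasure_eq_measure)
    qed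
    then show "norm (\<integral>\<omega>. norm (?A k \<omega>) \<partial>M) \<le> D * prob (jumped k t)" by simp
  qed
  ultimately have int_sum: "integrable M (\<lambda>\<omega>. \<Sum>k. ?A k \<omega>)"
    and sums: "(\<lambda>k. integral\<^sup>L M (?A k)) sums (\<integral>\<omega>. (\<Sum>k. ?A k \<omega>) \<partial>M)"
    using j(1) by (auto intro!: integrable_suminf sums_integral)
  have int2: "integrable M (\<lambda>\<omega>. (\<Sum>k. ?A k \<omega>) + f (X 0 \<omega>))"
    using int_sum int by (rule Bochner_Integration.integrable_add)
  have eq: "AE \<omega> in M. (\<Sum>k. ?A k \<omega>) + f (X 0 \<omega>) = f (X t \<omega>)"
    using fin by eventually_elim simp
  show intt: "integrable M (\<lambda>\<omega>. f (X t \<omega>))"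
    by (rule integrable_cong_AE_imp[OF int2]) (use t eq in \<open>auto elim: eventually_mono\<close>)
  have "(\<integral>\<omega>. (\<Sum>k. ?A k \<omega>) \<partial>M) = (\<integral>\<omega>. f (X t \<omega>) - f (X 0 \<omega>) \<partial>M)"
    by (rule integral_cong_AE) (use int_sum int intt fin in \<open>auto elim: eventually_mono\<close>)
  then show "(\<lambda>k. \<integral>\<omega>. generator f (Y k \<omega>) * occ k t \<omega> \<partial>M) sums ((\<integral>\<omega>. f (X t \<omega>) \<partial>M) - (\<integral>\<omega>. f (X 0 \<omega>) \<partial>M))"
    using sums int intt by (simp add: j(3) Bochner_Integration.integral_diff)
qed

text \<open>
  At each time exactly one sojourn is in progress, so \<open>g(X\<^sub>s)\<close> is the sum over \<open>k\<close> of \<open>g(Y\<^sub>k)\<close> restricted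
  to the \<open>k\<close>-th sojourn. The summands are integrable over time and probability space with summable
  norms, and the claim is Fubini's theorem for their sum.
\<close>
lemma time_integral:
  assumes g: "\<And>x. x \<in> S \<Longrightarrow> \<bar>g x\<bar> \<le> D * R x" and t: "0 \<le> t"
    and jumps: "summable (\<lambda>k. prob (jumped k t))"
  shows "set_integrable lborel {0..t} (\<lambda>s. \<integral>\<omega>. g (X s \<omega>) \<partial>M)"
    and "(\<lambda>k. \<integral>\<omega>. g (Y k \<omega>) * occ k t \<omega> \<partial>M) sums (LBINT s:{0..t}. (\<integral>\<omega>. g (X s \<omega>) \<partial>M))"
proof -
  define f :: "nat \<Rightarrow> real \<times> 'a \<Rightarrow> real" where "f = (\<lambda>k z. g (Y k (snd z)) * indicator {0..t} (fst z) * (if T k (snd z) \<le> fst z \<and> fst z < T (Suc k) (snd z) then 1 else 0))"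
  interpret P: pair_sigma_finite lborel M ..
  have [measurable]: "f k \<in> borel_measurable (lborel \<Otimes>\<^sub>M M)" for k
  proof -
    have [measurable]: "(\<lambda>z::real \<times> 'a. g (Y k (snd z))) \<in> borel_measurable (lborel \<Otimes>\<^sub>M M)" "(\<lambda>z::real \<times> 'a. T j (snd z)) \<in> borel_measurable (lborel \<Otimes>\<^sub>M M)" for j
      by (rule measurable_compose[OF measurable_snd], measurable)+
    show ?thesis unfolding f_def by measurable
  qed
  have f_norm: "(\<integral>\<^sup>+s. ennreal (norm (f k (s, \<omega>))) \<partial>lborel) = ennreal (\<bar>g (Y k \<omega>)\<bar> * occ k t \<omega>)" if "good \<omega>" for k \<omega>
  proof -
    have "(\<integral>\<^sup>+s. ennreal (norm (f k (s, \<omega>))) \<partial>lborel) = (\<integral>\<^sup>+s. ennreal \<bar>g (Y k \<omega>)\<bar> * (indicator {0..t} s * indicator {T k \<omega>..<T (Suc k) \<omega>} s) \<partial>lborel)"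
      by (rule nn_integral_cong) (auto simp: f_def split: split_indicator)
    also have "\<dots> = ennreal \<bar>g (Y k \<omega>)\<bar> * holding t (T k \<omega>) (T (Suc k) \<omega>)"
      unfolding holding_def by (rule nn_integral_cmult) measurable
    finally show ?thesis using good_holding[OF that] good_occ[OF that] by (simp add: ennreal_mult)
  qed
  have f_nn: "(\<integral>\<^sup>+z. ennreal (norm (f k z)) \<partial>(lborel \<Otimes>\<^sub>M M)) = (\<integral>\<^sup>+\<omega>. ennreal (\<bar>g (Y k \<omega>)\<bar> * occ k t \<omega>) \<partial>M)" for k
  proof -
    have "(\<integral>\<^sup>+z. ennreal (norm (f k z)) \<partial>(lborel \<Otimes>\<^sub>M M)) = (\<integral>\<^sup>+\<omega>. (\<integral>\<^sup>+s. ennreal (norm (f k (s, \<omega>))) \<partial>lborel) \<partial>M)"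
      by (rule P.nn_integral_snd[symmetric]) measurable
    also have "\<dots> = (\<integral>\<^sup>+\<omega>. ennreal (\<bar>g (Y k \<omega>)\<bar> * occ k t \<omega>) \<partial>M)"
      by (rule nn_integral_cong_AE) (use AE_good in eventually_elim, rule f_norm)
    finally show ?thesis .
  qed
  have f_le: "(\<integral>\<^sup>+z. ennreal (norm (f k z)) \<partial>(lborel \<Otimes>\<^sub>M M)) \<le> ennreal (D * prob (jumped k t))" for k
  proof -
    have i: "integrable M (\<lambda>\<omega>. D * (R (Y k \<omega>) * occ k t \<omega>))" using jump_probability(1) by simp
    have le: "AE \<omega> in M. \<bar>g (Y k \<omega>)\<bar> * occ k t \<omega> \<le> D * (R (Y k \<omega>) * occ k t \<omega>)"
      using AE_good
    proof eventually_elim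
      case (elim \<omega>)
      then have "Y k \<omega> \<in> S" unfolding good_def by blast
      from mult_right_mono[OF g[OF this] good_occ[OF elim]] show ?case by (simp add: mult.assoc)
    qed
    have "(\<integral>\<^sup>+\<omega>. ennreal (\<bar>g (Y k \<omega>)\<bar> * occ k t \<omega>) \<partial>M) \<le> (\<integral>\<^sup>+\<omega>. ennreal (D * (R (Y k \<omega>) * occ k t \<omega>)) \<partial>M)"
      by (rule nn_integral_mono_AE) (use le in eventually_elim, rule ennreal_leI)
    also have "\<dots> = ennreal (\<integral>\<omega>. D * (R (Y k \<omega>) * occ k t \<omega>) \<partial>M)"
    proof (rule nn_integral_eq_integral[OF i])
      show "AE \<omega> in M. 0 \<le> D * (R (Y k \<omega>) * occ k t \<omega>)"
        using le AE_good
      proof eventually_elim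
        case (elim \<omega>)
        have "0 \<le> \<bar>g (Y k \<omega>)\<bar> * occ k t \<omega>" using good_occ[OF elim(2)] by simp
        then show ?case using elim by linarith
      qed
    qed
    finally show ?thesis unfolding f_nn using jump_probability(2)[of k t] by simp
  qed
  have f_int: "integrable (lborel \<Otimes>\<^sub>M M) (f k)" for k
    by (rule integrableI_bounded) (use le_less_trans[OF f_le] in auto)
  have sum_norm: "summable (\<lambda>k. \<integral>z. norm (f k z) \<partial>(lborel \<Otimes>\<^sub>M M))"
  proof (rule summable_comparison_test'[where g = "\<lambda>k. D * prob (jumped k t)" and N = 0])
    show "summable (\<lambda>k. D * prob (jumped k t))" by (rule summable_mult[OF jumps])
    fix k
    have D0: "0 \<le> D"
    proof -
      obtain \<omega> where \<omega>: "\<omega> \<in> space M" using not_empty by auto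
      have "0 \<le> D * R (Y 0 \<omega>)" using g[OF Y_in_S[OF \<omega>, of 0]] by linarith
      then show ?thesis using rate_pos[OF Y_in_S[OF \<omega>, of 0]] by (simp add: zero_le_mult_iff)
    qed
    have "ennreal (\<integral>z. norm (f k z) \<partial>(lborel \<Otimes>\<^sub>M M)) \<le> ennreal (D * prob (jumped k t))"
      using f_le[of k] nn_integral_eq_integral[OF integrable_norm[OF f_int[of k]]] by simp
    then show "norm (\<integral>z. norm (f k z) \<partial>(lborel \<Otimes>\<^sub>M M)) \<le> D * prob (jumped k t)"
      using D0 by (simp add: ennreal_le_iff)
  qed
  have ae: "AE z in lborel \<Otimes>\<^sub>M M. summable (\<lambda>k. norm (f k z))"
  proof -
    have "(\<integral>\<^sup>+z. (\<Sum>k. ennreal (norm (f k z))) \<partial>(lborel \<Otimes>\<^sub>M M)) = (\<Sum>k. \<integral>\<^sup>+z. ennreal (norm (f k z)) \<partial>(lborel \<Otimes>\<^sub>M M))"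
      by (rule nn_integral_suminf) measurable
    also have "\<dots> = (\<Sum>k. ennreal (\<integral>z. norm (f k z) \<partial>(lborel \<Otimes>\<^sub>M M)))"
      by (intro arg_cong[where f = suminf] ext nn_integral_eq_integral integrable_norm f_int) auto
    also have "\<dots> = ennreal (\<Sum>k. \<integral>z. norm (f k z) \<partial>(lborel \<Otimes>\<^sub>M M))"
      by (rule suminf_ennreal2[OF _ sum_norm]) simp
    finally have "AE z in lborel \<Otimes>\<^sub>M M. (\<Sum>k. ennreal (norm (f k z))) \<noteq> \<infinity>"
      by (intro nn_integral_PInf_AE borel_measurable_suminf) simp_all
    then show ?thesis
    proof eventually_elim
      case (elim z)
      then show ?case by (intro summable_suminf_not_top) simp_all
    qed
  qed
  let ?F = "\<lambda>z. \<Sum>k. f k z"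
  have F_int: "integrable (lborel \<Otimes>\<^sub>M M) ?F" and F_sums: "(\<lambda>k. integral\<^sup>L (lborel \<Otimes>\<^sub>M M) (f k)) sums integral\<^sup>L (lborel \<Otimes>\<^sub>M M) ?F"
    using integrable_suminf[OF f_int ae sum_norm] sums_integral[OF f_int ae sum_norm] by auto
  have F_eq: "(\<integral>\<omega>. ?F (s, \<omega>) \<partial>M) = indicator {0..t} s * (\<integral>\<omega>. g (X s \<omega>) \<partial>M)" for s
  proof (cases "s \<in> {0..t}")
    case True
    then have s: "0 \<le> s" by simp
    have "(\<integral>\<omega>. ?F (s, \<omega>) \<partial>M) = (\<integral>\<omega>. g (X s \<omega>) \<partial>M)"
    proof (rule integral_cong_AE)
      show "(\<lambda>\<omega>. g (X s \<omega>)) \<in> borel_measurable M" by (rule X_measurable'[OF s])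
      show "AE \<omega> in M. ?F (s, \<omega>) = g (X s \<omega>)"
        using AE_good
      proof eventually_elim
        case (elim \<omega>)
        obtain n where n: "T n \<omega> \<le> s" "s < T (Suc n) \<omega>" using good_time[OF elim, of s] True by auto
        have mono: "T i \<omega> \<le> T j \<omega>" if "i \<le> j" for i j
          using that by (induction j rule: dec_induct) (use good_T_less[OF elim] in \<open>auto intro: order_trans less_imp_le\<close>)
        have "(T k \<omega> \<le> s \<and> s < T (Suc k) \<omega>) \<longleftrightarrow> k = n" for k
          using n mono[of "Suc k" n] mono[of "Suc n" k] by (cases k n rule: linorder_cases) auto
        then have "?F (s, \<omega>) = (\<Sum>k. if k = n then g (Y n \<omega>) else 0)"
          using True by (intro arg_cong[where f = suminf] ext) (simp add: f_def)
        also have "\<dots> = g (Y n \<omega>)" using suminf_finite[of "{n}" "\<lambda>k. if k = n then g (Y n \<omega>) else 0"] by simp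
        also have "Y n \<omega> = X s \<omega>" using elim n unfolding good_def by metis
        finally show ?case .
      qed
    qed measurable
    then show ?thesis using True by simp
  qed (simp add: f_def)
  have "integrable lborel (\<lambda>s. \<integral>\<omega>. ?F (s, \<omega>) \<partial>M)" by (rule P.integrable_fst'[OF F_int])
  then show "set_integrable lborel {0..t} (\<lambda>s. \<integral>\<omega>. g (X s \<omega>) \<partial>M)"
    unfolding F_eq set_integrable_def by simp
  have "integral\<^sup>L (lborel \<Otimes>\<^sub>M M) ?F = (LBINT s:{0..t}. (\<integral>\<omega>. g (X s \<omega>) \<partial>M))"
    unfolding P.integral_fst'[OF F_int, symmetric] F_eq set_lebesgue_integral_def by simp
  moreover have "integral\<^sup>L (lborel \<Otimes>\<^sub>M M) (f k) = (\<integral>\<omega>. g (Y k \<omega>) * occ k t \<omega> \<partial>M)" for k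
  proof -
    have "integral\<^sup>L (lborel \<Otimes>\<^sub>M M) (f k) = (\<integral>\<omega>. (\<integral>s. f k (s, \<omega>) \<partial>lborel) \<partial>M)"
      using P.integral_snd[of "\<lambda>s \<omega>. f k (s, \<omega>)"] f_int[of k] by (simp add: case_prod_beta')
    also have "\<dots> = (\<integral>\<omega>. g (Y k \<omega>) * occ k t \<omega> \<partial>M)"
    proof (rule integral_cong_AE)
      show "AE \<omega> in M. (\<integral>s. f k (s, \<omega>) \<partial>lborel) = g (Y k \<omega>) * occ k t \<omega>"
        using AE_good
      proof eventually_elim
        case (elim \<omega>)
        let ?I = "{0..t} \<inter> {T k \<omega>..<T (Suc k) \<omega>}"
        have "(\<integral>s. f k (s, \<omega>) \<partial>lborel) = (\<integral>s. g (Y k \<omega>) * indicator ?I s \<partial>lborel)"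
          by (rule Bochner_Integration.integral_cong) (auto simp: f_def split: split_indicator)
        also have "\<dots> = g (Y k \<omega>) * measure lborel ?I" by simp
        also have "emeasure lborel ?I = (\<integral>\<^sup>+s. indicator ?I s \<partial>lborel)" by simp
        then have "emeasure lborel ?I = holding t (T k \<omega>) (T (Suc k) \<omega>)"
          unfolding holding_def indicator_inter_arith by simp
        then have "measure lborel ?I = occ k t \<omega>"
          using good_holding[OF elim] good_occ[OF elim] by (simp add: measure_def)
        finally show ?case .
      qed
    qed measurable
    finally show ?thesis .
  qed
  ultimately show "(\<lambda>k. \<integral>\<omega>. g (Y k \<omega>) * occ k t \<omega> \<partial>M) sums (LBINT s:{0..t}. (\<integral>\<omega>. g (X s \<omega>) \<partial>M))"
    using F_sums by simp
qed

theorem dynkin: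
  assumes D: "\<And>x z. x \<in> S \<Longrightarrow> z \<in> succs x \<Longrightarrow> \<bar>f z - f x\<bar> \<le> D"
    and int: "integrable M (\<lambda>\<omega>. f (X 0 \<omega>))" and t: "0 \<le> t"
    and jumps: "summable (\<lambda>k. prob (jumped k t))"
  shows "integrable M (\<lambda>\<omega>. f (X t \<omega>))"
    and "set_integrable lborel {0..t} (\<lambda>s. \<integral>\<omega>. generator f (X s \<omega>) \<partial>M)"
    and "(\<integral>\<omega>. f (X t \<omega>) \<partial>M) - (\<integral>\<omega>. f (X 0 \<omega>) \<partial>M) = (LBINT s:{0..t}. (\<integral>\<omega>. generator f (X s \<omega>) \<partial>M))"
proof -
  note inc = dynkin_increments[of f D t, OF _ int t jumps]
  have b: "\<bar>generator f x\<bar> \<le> D * R x" if "x \<in> S" for x by (rule generator_bound) (use D that in auto)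
  show "integrable M (\<lambda>\<omega>. f (X t \<omega>))" by (rule inc(1)) (rule D)
  show "set_integrable lborel {0..t} (\<lambda>s. \<integral>\<omega>. generator f (X s \<omega>) \<partial>M)"
    by (rule time_integral(1)[OF b t jumps])
  show "(\<integral>\<omega>. f (X t \<omega>) \<partial>M) - (\<integral>\<omega>. f (X 0 \<omega>) \<partial>M) = (LBINT s:{0..t}. (\<integral>\<omega>. generator f (X s \<omega>) \<partial>M))"
    by (rule sums_unique2[OF inc(2) time_integral(2)[OF b t jumps]]) (rule D)
qed

end

section \<open>Periodic sequences and height profiles\<close>

abbreviation (input) grid :: "nat \<Rightarrow> int \<Rightarrow> real" where
  "grid N i \<equiv> real_of_int i / real N"

abbreviation (input) curv :: "(int \<Rightarrow> int) \<Rightarrow> int \<Rightarrow> real" where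
  "curv h i \<equiv> real_of_int (third_diff h i)"

abbreviation periodic :: "nat \<Rightarrow> (int \<Rightarrow> 'b) \<Rightarrow> bool" where
  "periodic N a \<equiv> periodic_fun_simple a (int N)"

lemma periodicD: "periodic N a \<Longrightarrow> a (i + int N) = a i"
  by (simp add: periodic_fun_simple_def)

lemma periodic_shift: "periodic N a \<Longrightarrow> periodic N (\<lambda>i. a (i + m))"
  unfolding periodic_fun_simple_def by (metis add.assoc add.commute)

lemma periodic_mod: assumes "periodic N a" shows "a (i mod int N) = a i"
proof -
  interpret periodic_fun_simple a "int N" by fact
  have "a (i mod int N + of_int (i div int N) * int N) = a (i mod int N)" by (rule plus_of_int)
  then show ?thesis by simp
qed

lemma period_representative:
  assumes "N \<ge> 1"
  obtains r where "r \<in> {1..int N}" "r mod int N = i mod int N"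
    "\<And>k. k \<in> {1..int N} \<Longrightarrow> k mod int N = i mod int N \<longleftrightarrow> k = r"
proof -
  define r where "r = (if i mod int N = 0 then int N else i mod int N)"
  have b: "0 \<le> i mod int N" "i mod int N < int N" using assms by auto
  from b(1) have "i mod int N = 0 \<or> 1 \<le> i mod int N" by linarith
  then have r: "r \<in> {1..int N}" using less_imp_le[OF b(2)] assms by (elim disjE) (simp_all add: r_def)
  have rm: "r mod int N = i mod int N" by (simp add: r_def)
  have "k mod int N = i mod int N \<longleftrightarrow> k = r" if k: "k \<in> {1..int N}" for k
  proof
    assume e: "k mod int N = i mod int N"
    show "k = r"
    proof (cases "k = int N")
      case False
      then have "k mod int N = k" using k by simp
      then show ?thesis using e k by (simp add: r_def)
    qed (use e in \<open>simp add: r_def\<close>)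
  qed (use rm in simp)
  then show thesis using that r rm by blast
qed

lemma sum_period_shift:
  fixes a :: "int \<Rightarrow> 'b::ab_group_add"
  assumes "periodic N a"
  shows "(\<Sum>i\<in>{1..int N}. a (i + 1)) = (\<Sum>i\<in>{1..int N}. a i)"
proof -
  have "(\<Sum>i\<in>{1..int n}. a (i + 1)) - (\<Sum>i\<in>{1..int n}. a i) = a (int n + 1) - a 1" for n
  proof (induction n)
    case (Suc n)
    have "{1..int (Suc n)} = insert (int n + 1) {1..int n}" by auto
    moreover have "a (2 + int n) = a (int n + 2)" by (simp add: add.commute)
    ultimately show ?case using Suc by (simp add: algebra_simps)
  qed simp
  from this[of N] periodicD[OF assms, of 1] show ?thesis by (simp add: add.commute)
qed

lemma sum_period_shift':
  fixes a :: "int \<Rightarrow> 'b::ab_group_add"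
  assumes "periodic N a"
  shows "(\<Sum>i\<in>{1..int N}. a (i + int m)) = (\<Sum>i\<in>{1..int N}. a i)"
proof (induction m)
  case (Suc m)
  have "(\<Sum>i\<in>{1..int N}. a (i + int (Suc m))) = (\<Sum>i\<in>{1..int N}. a ((i + 1) + int m))"
    by (simp add: algebra_simps)
  also have "\<dots> = (\<Sum>i\<in>{1..int N}. a (i + int m))"
    by (rule sum_period_shift[OF periodic_shift[OF assms]])
  finally show ?case using Suc by simp
qed simp

lemma sum_period_shift_neg:
  fixes a :: "int \<Rightarrow> 'b::ab_group_add"
  assumes "periodic N a"
  shows "(\<Sum>i\<in>{1..int N}. a (i - int m)) = (\<Sum>i\<in>{1..int N}. a i)"
  using sum_period_shift'[OF periodic_shift[OF assms, of "- int m"], of m] by simp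

lemma sum_residue:
  fixes a :: "int \<Rightarrow> 'b::ring_1"
  assumes "periodic N a" and N: "N \<ge> 1"
  shows "(\<Sum>k\<in>{1..int N}. a k * of_bool (k mod int N = j mod int N)) = a j"
proof -
  obtain r where r: "r \<in> {1..int N}" and rm: "r mod int N = j mod int N"
    and uniq: "\<And>k. k \<in> {1..int N} \<Longrightarrow> k mod int N = j mod int N \<longleftrightarrow> k = r"
    by (rule period_representative[OF N, of j]) blast
  have "(\<Sum>k\<in>{1..int N}. a k * of_bool (k mod int N = j mod int N)) = (\<Sum>k\<in>{1..int N}. if k = r then a r else 0)"
    by (intro sum.cong) (use uniq in auto)
  also have "\<dots> = a r" using r by simp
  also have "\<dots> = a j" using periodic_mod[OF assms(1), of r] periodic_mod[OF assms(1), of j] rm by simp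
  finally show ?thesis .
qed

lemma abs_diff_le_variation:
  fixes a :: "int \<Rightarrow> real"
  assumes "i \<in> {1..int N}" "k \<in> {1..int N}"
  shows "\<bar>a k - a i\<bar> \<le> (\<Sum>j\<in>{1..int N}. \<bar>a (j + 1) - a j\<bar>)"
proof -
  have *: "\<bar>a k - a i\<bar> \<le> (\<Sum>j\<in>{i..<k}. \<bar>a (j + 1) - a j\<bar>)" if "i \<le> k" for i k
    using that
  proof (induction k rule: int_ge_induct)
    case (step k)
    then have "{i..<k + 1} = insert k {i..<k}" by auto
    then show ?case using step by simp
  qed simp
  have **: "\<bar>a k - a i\<bar> \<le> (\<Sum>j\<in>{1..int N}. \<bar>a (j + 1) - a j\<bar>)" if "i \<le> k" "i \<in> {1..int N}" "k \<in> {1..int N}" for i k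
    by (rule order_trans[OF *[OF that(1)]]) (use that in \<open>auto intro!: sum_mono2\<close>)
  show ?thesis using **[of i k] **[of k i] assms by (cases "i \<le> k") (auto simp: abs_minus_commute)
qed

text \<open>
  A discrete Poincare inequality on the cycle.
\<close>
lemma abs_diff_mean_le_variation:
  fixes a :: "int \<Rightarrow> real"
  assumes "periodic N a" and N: "N \<ge> 1"
  shows "\<bar>a i - (\<Sum>k\<in>{1..int N}. a k) / real N\<bar> \<le> (\<Sum>j\<in>{1..int N}. \<bar>a (j + 1) - a j\<bar>)"
proof -
  obtain r where r: "r \<in> {1..int N}" and rm: "r mod int N = i mod int N"
    by (rule period_representative[OF N, of i]) blast
  have ar: "a i = a r" using periodic_mod[OF assms(1), of r] periodic_mod[OF assms(1), of i] rm by simp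
  let ?V = "\<Sum>j\<in>{1..int N}. \<bar>a (j + 1) - a j\<bar>"
  have "real N * a r - (\<Sum>k\<in>{1..int N}. a k) = (\<Sum>k\<in>{1..int N}. a r - a k)"
    by (simp add: sum_subtractf)
  also have "\<bar>\<dots>\<bar> \<le> (\<Sum>k\<in>{1..int N}. \<bar>a r - a k\<bar>)" by (rule sum_abs)
  also have "\<dots> \<le> (\<Sum>k\<in>{1..int N}. ?V)" by (intro sum_mono abs_diff_le_variation r)
  also have "\<dots> = real N * ?V" by simp
  finally have "\<bar>real N * a r - (\<Sum>k\<in>{1..int N}. a k)\<bar> / real N \<le> ?V"
    using N by (simp add: field_simps)
  moreover have "\<bar>real N * a r - (\<Sum>k\<in>{1..int N}. a k)\<bar> / real N = \<bar>a r - (\<Sum>k\<in>{1..int N}. a k) / real N\<bar>"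
  proof -
    have "a r - (\<Sum>k\<in>{1..int N}. a k) / real N = (real N * a r - (\<Sum>k\<in>{1..int N}. a k)) / real N"
      using N by (simp add: diff_divide_distrib)
    then show ?thesis by (simp add: abs_divide)
  qed
  ultimately show ?thesis using ar by simp
qed

lemma profiles_periodic: "h \<in> profiles N \<longleftrightarrow> periodic N h"
  by (simp add: profiles_def)

lemma slope_periodic: "periodic N h \<Longrightarrow> periodic N (slope h)"
  unfolding periodic_fun_simple_def slope_def by (metis add.assoc add.commute)

lemma third_diff_periodic: "periodic N h \<Longrightarrow> periodic N (third_diff h)"
  using slope_periodic[of h N] unfolding periodic_fun_simple_def third_diff_def
  by (metis add.assoc add.commute add_diff_eq diff_add_eq)

lemma of_int_periodic: "periodic N a \<Longrightarrow> periodic N (\<lambda>i. real_of_int (a i))"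
  by (simp add: periodic_fun_simple_def)

lemma sum_slope: "periodic N h \<Longrightarrow> (\<Sum>i\<in>{1..int N}. slope h i) = 0"
  using sum_period_shift[of h N] by (simp add: slope_def sum_subtractf)

lemma sum_third_diff: "periodic N h \<Longrightarrow> (\<Sum>i\<in>{1..int N}. third_diff h i) = 0"
proof -
  assume h: "periodic N h"
  have "(\<Sum>i\<in>{1..int N}. slope h (i - 1)) = 0" "(\<Sum>i\<in>{1..int N}. slope h (i + 1)) = 0"
    using sum_period_shift_neg[OF slope_periodic[OF h], of 1] sum_period_shift[OF slope_periodic[OF h]] sum_slope[OF h] by simp_all
  then show ?thesis using sum_slope[OF h]
    by (simp add: third_diff_def sum.distrib sum_subtractf flip: sum_distrib_left)
qed

text \<open>
  Differences of a periodic sequence have mean zero over a period, so the Poincare inequality bounds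
  them by their own variation. Three applications lead from the third differences to the heights.
\<close>
lemma curvature_bound:
  assumes h: "periodic N h" and N: "N \<ge> 1"
  shows "\<bar>real_of_int (slope h (i + 1) - slope h i)\<bar> \<le> (\<Sum>j\<in>{1..int N}. \<bar>curv h j\<bar>)"
proof -
  let ?a = "\<lambda>i. real_of_int (slope h (i + 1) - slope h i)"
  let ?w = "\<lambda>i. \<bar>curv h i\<bar>"
  have p: "periodic N (slope h)" by (rule slope_periodic[OF h])
  have pa: "periodic N ?a"
    using p periodic_shift[OF p, of 1] by (simp add: periodic_fun_simple_def)
  have sum0: "(\<Sum>k\<in>{1..int N}. ?a k) = 0"
    using sum_period_shift[OF p] by (simp add: sum_subtractf flip: of_int_sum)
  have "\<bar>?a i\<bar> \<le> (\<Sum>j\<in>{1..int N}. \<bar>?a (j + 1) - ?a j\<bar>)"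
    using abs_diff_mean_le_variation[OF pa N, of i] sum0 by simp
  also have "\<dots> = (\<Sum>j\<in>{1..int N}. ?w (j + 1))"
    by (intro sum.cong refl arg_cong[where f = abs]) (simp add: third_diff_def algebra_simps)
  also have "\<dots> = (\<Sum>j\<in>{1..int N}. ?w j)"
    by (rule sum_period_shift) (use third_diff_periodic[OF h] in \<open>simp add: periodic_fun_simple_def\<close>)
  finally show ?thesis .
qed

lemma slope_bound:
  assumes h: "periodic N h" and N: "N \<ge> 1"
  shows "\<bar>real_of_int (slope h i)\<bar> \<le> real N * (\<Sum>j\<in>{1..int N}. \<bar>curv h j\<bar>)"
proof -
  have p: "periodic N (\<lambda>i. real_of_int (slope h i))" by (rule of_int_periodic[OF slope_periodic[OF h]])
  have "\<bar>real_of_int (slope h i)\<bar> \<le> (\<Sum>j\<in>{1..int N}. \<bar>real_of_int (slope h (j + 1)) - real_of_int (slope h j)\<bar>)"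
    using abs_diff_mean_le_variation[OF p N, of i] sum_slope[OF h] by (simp flip: of_int_sum)
  also have "\<dots> \<le> (\<Sum>j\<in>{1..int N}. (\<Sum>j\<in>{1..int N}. \<bar>curv h j\<bar>))"
    using curvature_bound[OF h N] by (intro sum_mono) simp
  finally show ?thesis by simp
qed

lemma height_bound:
  assumes h: "periodic N h" and N: "N \<ge> 1"
  shows "\<bar>real_of_int (h i) - (\<Sum>k\<in>{1..int N}. real_of_int (h k)) / real N\<bar> \<le> real N ^ 2 * (\<Sum>j\<in>{1..int N}. \<bar>curv h j\<bar>)"
proof -
  have "\<bar>real_of_int (h i) - (\<Sum>k\<in>{1..int N}. real_of_int (h k)) / real N\<bar> \<le> (\<Sum>j\<in>{1..int N}. \<bar>real_of_int (h (j + 1)) - real_of_int (h j)\<bar>)"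
    by (rule abs_diff_mean_le_variation[OF of_int_periodic[OF h] N])
  also have "\<dots> \<le> (\<Sum>j\<in>{1..int N}. real N * (\<Sum>j\<in>{1..int N}. \<bar>curv h j\<bar>))"
    using slope_bound[OF h N] by (intro sum_mono) (simp add: slope_def)
  finally show ?thesis by (simp add: power2_eq_square)
qed

lemma hop_height_sum:
  assumes \<psi>: "periodic N \<psi>" and N: "N \<ge> 1"
  shows "(\<Sum>k\<in>{1..int N}. \<psi> k * real_of_int (hop N i j h k)) = (\<Sum>k\<in>{1..int N}. \<psi> k * real_of_int (h k)) + (\<psi> j - \<psi> i)"
proof -
  have "(\<Sum>k\<in>{1..int N}. \<psi> k * real_of_int (hop N i j h k)) = (\<Sum>k\<in>{1..int N}. \<psi> k * real_of_int (h k)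
      + (\<psi> k * of_bool (k mod int N = j mod int N) - \<psi> k * of_bool (k mod int N = i mod int N)))"
    by (intro sum.cong) (auto simp: hop_def algebra_simps)
  also have "\<dots> = (\<Sum>k\<in>{1..int N}. \<psi> k * real_of_int (h k)) + (\<psi> j - \<psi> i)"
    by (simp add: sum.distrib sum_subtractf sum_residue[OF \<psi> N] del: of_bool_eq_iff)
  finally show ?thesis .
qed

text \<open>
  Up to a bounded term, a hop changes this quantity by a multiple of the third difference at the hop,
  and the rate of the hop decreases exponentially in this change.
\<close>
definition energy :: "nat \<Rightarrow> (int \<Rightarrow> int) \<Rightarrow> real" where
  "energy N h = (\<Sum>i\<in>{1..int N}. (real_of_int (slope h i))\<^sup>2)"

text \<open>
  A hop adds the difference of two unit masses. The linear part of the change is found by summation by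
  parts; each of the \<open>N\<close> terms of the quadratic part is the square of a number between -2 and 2. The
  estimate holds also when \<open>i\<close> and \<open>j\<close> agree modulo \<open>N\<close>, as neighbouring sites do for \<open>N = 1\<close>.
\<close>
lemma energy_hop:
  assumes h: "periodic N h" and N: "N \<ge> 1"
  shows "\<exists>c. 0 \<le> c \<and> c \<le> 4 * real N \<and>
     energy N (hop N i j h) - energy N h = 2 * real_of_int ((slope h (j - 1) - slope h j) - (slope h (i - 1) - slope h i)) + c"
proof -
  let ?d = "\<lambda>k. of_bool (k mod int N = j mod int N) - of_bool (k mod int N = i mod int N) :: real"
  let ?z = "\<lambda>k. real_of_int (slope h k)"
  have pz: "periodic N ?z" by (rule of_int_periodic[OF slope_periodic[OF h]])
  have pd: "periodic N ?d" by (simp add: periodic_fun_simple_def)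
  have sl: "real_of_int (slope (hop N i j h) k) = ?z k + (?d (k + 1) - ?d k)" for k
    by (simp add: slope_def hop_def)
  define c where "c = (\<Sum>k\<in>{1..int N}. (?d (k + 1) - ?d k)\<^sup>2)"
  have "0 \<le> c" unfolding c_def by (intro sum_nonneg) simp
  moreover have "c \<le> 4 * real N"
  proof -
    have "(?d (k + 1) - ?d k)\<^sup>2 \<le> 4" for k by (cases "k mod int N = j mod int N"; cases "(k + 1) mod int N = j mod int N";
        cases "k mod int N = i mod int N"; cases "(k + 1) mod int N = i mod int N") simp_all
    then have "c \<le> (\<Sum>k\<in>{1..int N}. 4)" unfolding c_def by (intro sum_mono)
    then show ?thesis by simp
  qed
  moreover have "energy N (hop N i j h) - energy N h = 2 * (\<Sum>k\<in>{1..int N}. ?z k * (?d (k + 1) - ?d k)) + c"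
    unfolding energy_def sl c_def by (simp add: power2_sum sum.distrib sum_distrib_left mult.assoc)
  moreover have "(\<Sum>k\<in>{1..int N}. ?z k * (?d (k + 1) - ?d k)) = (\<Sum>k\<in>{1..int N}. (?z (k - 1) - ?z k) * ?d k)"
  proof -
    have "periodic N (\<lambda>k. ?z (k - 1) * ?d k)"
      using periodic_shift[OF pz, of "-1"] pd by (simp add: periodic_fun_simple_def)
    from sum_period_shift[OF this] show ?thesis
      by (simp add: right_diff_distrib left_diff_distrib sum_subtractf)
  qed
  moreover have "\<dots> = (?z (j - 1) - ?z j) - (?z (i - 1) - ?z i)"
  proof -
    have p: "periodic N (\<lambda>k. ?z (k - 1) - ?z k)"
      using periodic_shift[OF pz, of "-1"] pz by (simp add: periodic_fun_simple_def)
    show ?thesis unfolding right_diff_distrib sum_subtractf by (simp only: sum_residue[OF p N])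
  qed
  ultimately show ?thesis by (intro exI[of _ c]) simp
qed

lemma slope_le_energy:
  assumes h: "periodic N h" and N: "N \<ge> 1"
  shows "(real_of_int (slope h i))\<^sup>2 \<le> energy N h"
proof -
  obtain r where r: "r \<in> {1..int N}" and rm: "r mod int N = i mod int N"
    by (rule period_representative[OF N, of i]) blast
  have "slope h i = slope h r"
    using periodic_mod[OF slope_periodic[OF h], of r] periodic_mod[OF slope_periodic[OF h], of i] rm by simp
  then show ?thesis unfolding energy_def using r by (auto intro!: member_le_sum)
qed

section \<open>Energy and the Lyapunov inequality\<close>

lemma metropolis_rate_nonneg: "0 \<le> metropolis_rate K N h g"
  unfolding metropolis_rate_def by (intro sum_nonneg) simp

definition rate_right :: "real \<Rightarrow> nat \<Rightarrow> (int \<Rightarrow> int) \<Rightarrow> int \<Rightarrow> real" where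
  "rate_right K N h i = real N ^ 4 * exp (- 3 * K + K * curv h i)"

definition rate_left :: "real \<Rightarrow> nat \<Rightarrow> (int \<Rightarrow> int) \<Rightarrow> int \<Rightarrow> real" where
  "rate_left K N h i = real N ^ 4 * exp (- 3 * K - K * curv h i)"

definition hops :: "nat \<Rightarrow> (int \<Rightarrow> int) \<Rightarrow> (int \<Rightarrow> int) set" where
  "hops N h = (\<lambda>i. hop N i (i + 1) h) ` {1..int N} \<union> (\<lambda>i. hop N (i + 1) i h) ` {1..int N}"

lemma metropolis_rate_eq_0: "g \<notin> hops N h \<Longrightarrow> metropolis_rate K N h g = 0"
  unfolding metropolis_rate_def hops_def by (intro sum.neutral ballI) auto

lemma metropolis_rate_neq_0: "metropolis_rate K N h g \<noteq> 0 \<Longrightarrow> g \<in> hops N h"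
  using metropolis_rate_eq_0 by blast

lemma finite_hops: "finite (hops N h)" by (simp add: hops_def)

lemma hops_profiles: "h \<in> profiles N \<Longrightarrow> hops N h \<subseteq> profiles N"
  unfolding hops_def using hop_in_profiles by blast

text \<open>
  Distinct hops may lead to the same profile, and rates then add up. Sums over target profiles can
  still be regrouped as sums over hops.
\<close>
lemma metropolis_rate_sum:
  fixes F :: "(int \<Rightarrow> int) \<Rightarrow> real"
  shows "(\<Sum>g\<in>hops N h. metropolis_rate K N h g * F g)
    = (\<Sum>i\<in>{1..int N}. rate_right K N h i * F (hop N i (i + 1) h) + rate_left K N h i * F (hop N (i + 1) i h))"
proof -
  have "(\<Sum>g\<in>hops N h. metropolis_rate K N h g * F g) = (\<Sum>g\<in>hops N h. \<Sum>i\<in>{1..int N}.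
      (if g = hop N i (i + 1) h then rate_right K N h i * F g else 0) + (if g = hop N (i + 1) i h then rate_left K N h i * F g else 0))"
    unfolding metropolis_rate_def sum_distrib_right by (intro sum.cong) (auto simp: rate_right_def rate_left_def distrib_right)
  also have "\<dots> = (\<Sum>i\<in>{1..int N}. \<Sum>g\<in>hops N h.
      (if g = hop N i (i + 1) h then rate_right K N h i * F g else 0) + (if g = hop N (i + 1) i h then rate_left K N h i * F g else 0))"
    by (rule sum.swap)
  also have "\<dots> = (\<Sum>i\<in>{1..int N}. rate_right K N h i * F (hop N i (i + 1) h) + rate_left K N h i * F (hop N (i + 1) i h))"
  proof (rule sum.cong[OF refl])
    fix i assume "i \<in> {1..int N}"
    then have "hop N i (i + 1) h \<in> hops N h" "hop N (i + 1) i h \<in> hops N h" by (auto simp: hops_def)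
    then show "(\<Sum>g\<in>hops N h. (if g = hop N i (i + 1) h then rate_right K N h i * F g else 0) + (if g = hop N (i + 1) i h then rate_left K N h i * F g else 0)) = rate_right K N h i * F (hop N i (i + 1) h) + rate_left K N h i * F (hop N (i + 1) i h)"
      by (simp add: sum.distrib finite_hops)
  qed
  finally show ?thesis .
qed

lemma metropolis_total_rate:
  assumes "h \<in> profiles N"
  shows "total_rate (profiles N) (metropolis_rate K N) h = (\<Sum>i\<in>{1..int N}. rate_right K N h i + rate_left K N h i)"
proof -
  have "total_rate (profiles N) (metropolis_rate K N) h = infsum (metropolis_rate K N h) (hops N h)"
    unfolding total_rate_def by (rule infsum_cong_neutral) (use hops_profiles[OF assms] metropolis_rate_eq_0 in auto)
  then show ?thesis using metropolis_rate_sum[where K = K and N = N and h = h and F = "\<lambda>_. 1"] finite_hops by simp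
qed

lemma jump_chain_metropolis:
  assumes N: "N \<ge> 1" and proc: "metropolis_process K N M H"
  obtains Y \<sigma> where "jump_chain M (profiles N) (metropolis_rate K N) H Y \<sigma>"
proof -
  from proc obtain Y \<sigma> where
    ps: "prob_space M" and cS: "countable (profiles N)" and Xm: "\<forall>t\<ge>0. H t \<in> M \<rightarrow>\<^sub>M count_space (profiles N)"
    and Ym: "\<forall>n. Y n \<in> M \<rightarrow>\<^sub>M count_space (profiles N)" and \<sigma>m: "\<forall>n. \<sigma> n \<in> borel_measurable M"
    and ch: "\<forall>n y. (\<forall>k\<le>n. y k \<in> profiles N) \<longrightarrow>
           measure M {\<omega> \<in> space M. \<forall>k\<le>n. Y k \<omega> = y k} =
           measure M {\<omega> \<in> space M. Y 0 \<omega> = y 0} *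
             (\<Prod>k<n. metropolis_rate K N (y k) (y (Suc k)) / total_rate (profiles N) (metropolis_rate K N) (y k))"
    and ho: "\<forall>n y s. (\<forall>k\<le>n. y k \<in> profiles N \<and> 0 \<le> s k) \<longrightarrow>
           measure M {\<omega> \<in> space M. \<forall>k\<le>n. Y k \<omega> = y k \<and> s k < \<sigma> k \<omega>} =
           measure M {\<omega> \<in> space M. \<forall>k\<le>n. Y k \<omega> = y k} *
             (\<Prod>k\<le>n. exp (- (total_rate (profiles N) (metropolis_rate K N) (y k) * s k)))"
    and pa: "AE \<omega> in M.
           filterlim (\<lambda>n. \<Sum>k<n. \<sigma> k \<omega>) at_top sequentially \<and>
           (\<forall>n t. (\<Sum>k<n. \<sigma> k \<omega>) \<le> t \<and> t < (\<Sum>k<Suc n. \<sigma> k \<omega>) \<longrightarrow> H t \<omega> = Y n \<omega>)"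
    unfolding metropolis_process_def markov_jump_process_def by blast
  interpret prob_space M by (rule ps)
  have "jump_chain M (profiles N) (metropolis_rate K N) H Y \<sigma>"
  proof (unfold_locales)
    show "countable (profiles N)" by (rule cS)
    show "AE \<omega> in M.
           filterlim (\<lambda>n. \<Sum>k<n. \<sigma> k \<omega>) at_top sequentially \<and>
           (\<forall>n t. (\<Sum>k<n. \<sigma> k \<omega>) \<le> t \<and> t < (\<Sum>k<Suc n. \<sigma> k \<omega>) \<longrightarrow> H t \<omega> = Y n \<omega>)" by (rule pa)
    show "0 \<le> metropolis_rate K N x y" for x y by (rule metropolis_rate_nonneg)
    show "finite {y \<in> profiles N. metropolis_rate K N x y \<noteq> 0}" for x
      by (rule finite_subset[OF _ finite_hops[of N x]]) (auto dest: metropolis_rate_neq_0)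
    show "0 < total_rate (profiles N) (metropolis_rate K N) x" if "x \<in> profiles N" for x
      unfolding metropolis_total_rate[OF that]
    proof (rule sum_pos)
      show "{1..int N} \<noteq> {}" using N by simp
      show "0 < rate_right K N x i + rate_left K N x i" for i
        unfolding rate_right_def rate_left_def using N by (intro add_pos_pos mult_pos_pos) auto
    qed simp
  qed (use Xm Ym \<sigma>m ch ho in blast)+
  then show thesis by (rule that)
qed

lemma metropolis_generator:
  assumes "jump_chain M (profiles N) (metropolis_rate K N) H Y \<sigma>" and h: "h \<in> profiles N"
  shows "jump_chain.generator (profiles N) (metropolis_rate K N) f h
    = (\<Sum>i\<in>{1..int N}. rate_right K N h i * (f (hop N i (i + 1) h) - f h) + rate_left K N h i * (f (hop N (i + 1) i h) - f h))"
proof -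
  interpret jump_chain M "profiles N" "metropolis_rate K N" H Y \<sigma> by fact
  have "generator f h = (\<Sum>g\<in>hops N h. metropolis_rate K N h g * (f g - f h))"
    unfolding generator_def by (rule sum.mono_neutral_left) (use hops_profiles[OF h] finite_hops in \<open>auto simp: succs_def dest: metropolis_rate_neq_0\<close>)
  then show ?thesis by (simp add: metropolis_rate_sum)
qed

lemma metropolis_succs:
  assumes "jump_chain M (profiles N) (metropolis_rate K N) H Y \<sigma>"
    and "g \<in> jump_chain.succs (profiles N) (metropolis_rate K N) h"
  obtains i where "i \<in> {1..int N}" "g = hop N i (i + 1) h \<or> g = hop N (i + 1) i h"
proof -
  interpret jump_chain M "profiles N" "metropolis_rate K N" H Y \<sigma> by fact
  have "g \<in> hops N h" using assms(2) metropolis_rate_neq_0 by (auto simp: succs_def)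
  then show thesis using that unfolding hops_def by blast
qed

text \<open>
  The square root makes this function grow linearly in the third differences: it is integrable as soon
  as they are, and its increments are bounded.
\<close>
definition rms :: "nat \<Rightarrow> (int \<Rightarrow> int) \<Rightarrow> real" where
  "rms N h = sqrt (1 + energy N h)"

lemma energy_nonneg: "0 \<le> energy N h"
  unfolding energy_def by (intro sum_nonneg) simp

lemma rms_ge_1: "1 \<le> rms N h"
  unfolding rms_def using energy_nonneg[of N h] by simp

lemma rms_sq: "(rms N h)\<^sup>2 = 1 + energy N h"
  unfolding rms_def using energy_nonneg[of N h] by simp

lemma rms_upper:
  assumes h: "periodic N h" and N: "N \<ge> 1"
  shows "rms N h \<le> 1 + real N ^ 2 * (\<Sum>j\<in>{1..int N}. \<bar>curv h j\<bar>)"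
proof -
  let ?z = "\<lambda>i. real_of_int (slope h i)"
  have "rms N h \<le> sqrt 1 + sqrt (energy N h)"
    unfolding rms_def using energy_nonneg[of N h] by (intro sqrt_add_le_add_sqrt) auto
  also have "sqrt (energy N h) \<le> (\<Sum>i\<in>{1..int N}. \<bar>?z i\<bar>)"
    using L2_set_le_sum_abs[of ?z "{1..int N}"] by (simp add: L2_set_def energy_def)
  also have "\<dots> \<le> (\<Sum>i\<in>{1..int N}. real N * (\<Sum>j\<in>{1..int N}. \<bar>curv h j\<bar>))"
    by (intro sum_mono slope_bound[OF h N])
  finally show ?thesis by (simp add: power2_eq_square)
qed

lemma third_diff_le_rms:
  assumes h: "periodic N h" and N: "N \<ge> 1"
  shows "\<bar>curv h i\<bar> \<le> 4 * rms N h"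
proof -
  have z: "\<bar>real_of_int (slope h j)\<bar> \<le> rms N h" for j
    by (rule abs_le_square_iff[THEN iffD2, of _ "rms N h", simplified abs_of_nonneg[OF order_trans[OF zero_le_one rms_ge_1]]])
       (use slope_le_energy[OF h N, of j] in \<open>simp add: rms_sq\<close>)
  have "\<bar>curv h i\<bar> \<le> \<bar>real_of_int (slope h (i - 1))\<bar> + 2 * \<bar>real_of_int (slope h i)\<bar> + \<bar>real_of_int (slope h (i + 1))\<bar>"
    by (simp add: third_diff_def)
  then show ?thesis using z[of "i - 1"] z[of i] z[of "i + 1"] by linarith
qed

text \<open>
  Concavity of the square root.
\<close>
lemma rms_increment:
  "rms N g - rms N h \<le> (energy N g - energy N h) / (2 * rms N h)"
proof -
  have "2 * rms N h * rms N g \<le> (rms N h)\<^sup>2 + (rms N g)\<^sup>2" using sum_squares_bound[of "rms N h" "rms N g"] by simp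
  then have "2 * rms N h * (rms N g - rms N h) \<le> energy N g - energy N h"
    using rms_sq[of N g] rms_sq[of N h] by (simp add: algebra_simps power2_eq_square)
  then show ?thesis using rms_ge_1[of N h] by (simp add: field_simps)
qed

lemma energy_hop_up:
  assumes h: "periodic N h" and N: "N \<ge> 1"
  shows "energy N (hop N i (i + 1) h) - energy N h \<le> 4 * real N - 2 * curv h i"
    and "energy N (hop N (i + 1) i h) - energy N h \<le> 4 * real N + 2 * curv h i"
    and "\<bar>energy N (hop N i (i + 1) h) - energy N h\<bar> \<le> 4 * real N + 8 * rms N h"
    and "\<bar>energy N (hop N (i + 1) i h) - energy N h\<bar> \<le> 4 * real N + 8 * rms N h"
  using energy_hop[OF h N, of i "i + 1"] energy_hop[OF h N, of "i + 1" i] third_diff_le_rms[OF h N, of i]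
  by (auto simp: third_diff_def)

lemma rms_hop_bound:
  assumes h: "periodic N h" and N: "N \<ge> 1"
    and e: "\<bar>energy N g - energy N h\<bar> \<le> 4 * real N + 8 * rms N h"
  shows "\<bar>rms N g - rms N h\<bar> \<le> 4 * real N + 8"
proof -
  have r: "1 \<le> rms N h" "1 \<le> rms N g" by (rule rms_ge_1)+
  have "(rms N g - rms N h) * (rms N g + rms N h) = energy N g - energy N h"
    using rms_sq[of N g] rms_sq[of N h] by (simp add: algebra_simps power2_eq_square)
  then have "\<bar>rms N g - rms N h\<bar> * (rms N g + rms N h) = \<bar>energy N g - energy N h\<bar>"
    using r by (metis abs_mult abs_of_nonneg add_nonneg_nonneg order_trans zero_le_one)
  moreover have "\<bar>rms N g - rms N h\<bar> * rms N h \<le> \<bar>rms N g - rms N h\<bar> * (rms N g + rms N h)"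
    using r by (intro mult_left_mono) auto
  moreover have "4 * real N + 8 * rms N h \<le> (4 * real N + 8) * rms N h"
    using r mult_left_mono[OF r(1), of "4 * real N"] by (simp add: algebra_simps)
  ultimately have "\<bar>rms N g - rms N h\<bar> * rms N h \<le> (4 * real N + 8) * rms N h" using e by linarith
  then show ?thesis using r by simp
qed

lemma sinh_ge_half_cosh: "(1::real) \<le> x \<Longrightarrow> cosh x / 2 \<le> sinh x"
proof -
  assume x: "1 \<le> x"
  have "3 * exp (- x) \<le> exp x"
  proof -
    have "exp (- x) \<le> exp (-1)" using x by simp
    moreover have "exp 1 \<le> exp x" using x by simp
    moreover have "2 \<le> exp (1::real)" using exp_ge_add_one_self[of 1] by simp
    moreover have "exp (-1::real) = 1 / exp 1" by (simp add: exp_minus inverse_eq_divide)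
    moreover have "3 * (1 / exp 1) \<le> exp (1::real)"
    proof -
      have "3 \<le> exp (1::real) * exp 1" using mult_mono[of 2 "exp (1::real)" 2 "exp 1"] \<open>2 \<le> exp (1::real)\<close> by simp
      then show ?thesis by (simp add: field_simps)
    qed
    ultimately show ?thesis by linarith
  qed
  then show ?thesis by (simp add: sinh_def cosh_def)
qed

text \<open>
  Up to a common factor, the left-hand side bounds the drift of the Lyapunov function \<open>V\<close>, and the sum
  on the right is the total rate. The site with the largest \<open>\<bar>w\<bar> = W\<close> decides. Its term \<open>- 4 W sinh (K W)\<close>
  outweighs all \<open>cosh\<close> terms together once \<open>W\<close> is large, and since \<open>V\<close> grows at most linearly in \<open>W\<close>, a multiple of \<open>- cosh (K W)\<close>
  survives the division by \<open>V\<close>. For bounded \<open>W\<close> everything is bounded.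
\<close>
lemma lyapunov_inequality:
  fixes K :: real and N :: nat
  assumes K: "K > 0" and N: "N \<ge> 1"
  obtains a b where "0 \<le> a" "0 < b"
    "\<And>(w :: int \<Rightarrow> real) V. 1 \<le> V \<Longrightarrow> V \<le> 1 + real N ^ 2 * (\<Sum>j\<in>{1..int N}. \<bar>w j\<bar>) \<Longrightarrow>
      (\<Sum>i\<in>{1..int N}. 8 * real N * cosh (K * w i) - 4 * w i * sinh (K * w i)) / (2 * V)
        \<le> a - b * (\<Sum>i\<in>{1..int N}. 2 * cosh (K * w i))"
proof -
  \<comment> \<open>From \<open>1 / K\<close> on, \<open>sinh (K W)\<close> is at least half of \<open>cosh (K W)\<close>; from \<open>8 N\<^sup>2\<close> on, half of the negative
    term absorbs the positive ones.\<close>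
  define R0 where "R0 = max (1 / K) (8 * real N ^ 2)"
  define r where "r = R0 / (2 * (1 + real N ^ 3 * R0))"
  define b where "b = r / (2 * real N)"
  define a where "a = (4 * real N ^ 2 + 2 * b * real N) * cosh (K * R0)"
  have R0: "0 < R0" "1 \<le> K * R0" "8 * real N ^ 2 \<le> R0"
    using K N by (auto simp: R0_def max_def field_simps)
  have r: "0 < r" unfolding r_def using R0 N by (intro divide_pos_pos mult_pos_pos add_pos_pos) auto
  have b: "0 < b" unfolding b_def using r N by simp
  have a: "0 \<le> a" unfolding a_def using b by (intro mult_nonneg_nonneg add_nonneg_nonneg) auto
  have main: "(\<Sum>i\<in>{1..int N}. 8 * real N * cosh (K * w i) - 4 * w i * sinh (K * w i)) / (2 * V) \<le> a - b * (\<Sum>i\<in>{1..int N}. 2 * cosh (K * w i))"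
    if V: "1 \<le> V" "V \<le> 1 + real N ^ 2 * (\<Sum>j\<in>{1..int N}. \<bar>w j\<bar>)" for w :: "int \<Rightarrow> real" and V
  proof -
    let ?I = "{1..int N}"
    obtain m where m: "m \<in> ?I" "\<And>i. i \<in> ?I \<Longrightarrow> \<bar>w i\<bar> \<le> \<bar>w m\<bar>"
    proof -
      have "finite ((\<lambda>i. \<bar>w i\<bar>) ` ?I)" "(\<lambda>i. \<bar>w i\<bar>) ` ?I \<noteq> {}" using N by auto
      from Max_in[OF this] obtain m where "m \<in> ?I" "Max ((\<lambda>i. \<bar>w i\<bar>) ` ?I) = \<bar>w m\<bar>" by auto
      then show thesis using that[of m] Max_ge[OF \<open>finite ((\<lambda>i. \<bar>w i\<bar>) ` ?I)\<close>] by force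
    qed
    define W where "W = \<bar>w m\<bar>"
    define C where "C = cosh (K * W)"
    define S where "S = (\<Sum>i\<in>?I. 8 * real N * cosh (K * w i) - 4 * w i * sinh (K * w i))"
    have W0: "0 \<le> W" by (simp add: W_def)
    have C1: "1 \<le> C" by (simp add: C_def cosh_real_ge_1)
    have cosh_abs: "cosh (K * x) = cosh (K * \<bar>x\<bar>)" for x by (cases "0 \<le> x") auto
    have sinh_abs: "x * sinh (K * x) = \<bar>x\<bar> * sinh (K * \<bar>x\<bar>)" for x by (cases "0 \<le> x") auto
    have cosh_le: "cosh (K * w i) \<le> C" if "i \<in> ?I" for i
    proof -
      have "K * \<bar>w i\<bar> \<le> K * W" using m(2)[OF that] K by (simp add: W_def)
      then show ?thesis unfolding C_def cosh_abs[of "w i"] using K by (intro cosh_real_nonneg_le_iff[THEN iffD2]) (auto simp: W_def)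
    qed
    have sinh_nonneg: "0 \<le> w i * sinh (K * w i)" for i
      unfolding sinh_abs[of "w i"] using K by (intro mult_nonneg_nonneg) auto
    have cosh_sum: "(\<Sum>i\<in>?I. cosh (K * w i)) \<le> real N * C"
      using sum_mono[of ?I "\<lambda>i. cosh (K * w i)" "\<lambda>_. C"] cosh_le by simp
    have sinh_sum: "W * sinh (K * W) \<le> (\<Sum>i\<in>?I. w i * sinh (K * w i))"
      using member_le_sum[of m ?I "\<lambda>i. w i * sinh (K * w i)"] m(1) sinh_nonneg sinh_abs[of "w m"] by (simp add: W_def)
    have S_eq: "S = 8 * real N * (\<Sum>i\<in>?I. cosh (K * w i)) - 4 * (\<Sum>i\<in>?I. w i * sinh (K * w i))"
      by (simp add: S_def sum_subtractf sum_distrib_left mult.assoc)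
    have "8 * real N * (\<Sum>i\<in>?I. cosh (K * w i)) \<le> 8 * real N * (real N * C)"
      using cosh_sum by (intro mult_left_mono) auto
    then have S_le: "S \<le> 8 * real N ^ 2 * C - 4 * (W * sinh (K * W))"
      using sinh_sum unfolding S_eq by (simp add: power2_eq_square)
    have Vle: "V \<le> 1 + real N ^ 3 * W"
    proof -
      have "(\<Sum>j\<in>?I. \<bar>w j\<bar>) \<le> real N * W"
        using sum_mono[of ?I "\<lambda>i. \<bar>w i\<bar>" "\<lambda>_. W"] m(2) by (simp add: W_def)
      then have "real N ^ 2 * (\<Sum>j\<in>?I. \<bar>w j\<bar>) \<le> real N ^ 2 * (real N * W)" by (intro mult_left_mono) auto
      then show ?thesis using V(2) by (simp add: power2_eq_square power3_eq_cube mult.assoc)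
    qed
    have two: "b * (\<Sum>i\<in>?I. 2 * cosh (K * w i)) \<le> 2 * b * real N * C"
      using mult_left_mono[OF cosh_sum, of "2 * b"] b by (simp add: sum_distrib_left mult_ac)
    have "S / (2 * V) \<le> a - 2 * b * real N * C"
    proof (cases "W \<ge> R0")
      case True
      have "1 \<le> K * W" using R0 True K by (smt (verit) mult_left_mono)
      then have "C / 2 \<le> sinh (K * W)" unfolding C_def by (rule sinh_ge_half_cosh)
      then have "W * (C / 2) \<le> W * sinh (K * W)" using W0 by (rule mult_left_mono)
      moreover have "8 * real N ^ 2 * C \<le> W * C" using R0 True C1 by (intro mult_right_mono) auto
      ultimately have "S \<le> - (W * C)" using S_le by linarith
      then have "S / (2 * V) \<le> - (W * C) / (2 * V)" using V by (intro divide_right_mono) auto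
      also have "- (W * C) / (2 * V) \<le> - (r * C)"
      proof -
        have "r \<le> W / (2 * V)"
        proof -
          have "r \<le> W / (2 * (1 + real N ^ 3 * W))"
          proof -
            have "R0 * (2 * (1 + real N ^ 3 * W)) \<le> W * (2 * (1 + real N ^ 3 * R0))"
              using True by (simp add: algebra_simps)
            moreover have "0 < 2 * (1 + real N ^ 3 * W)" "0 < 2 * (1 + real N ^ 3 * R0)"
              using W0 R0(1) by (auto intro!: add_pos_nonneg)
            moreover have "x / P \<le> y / Q" if "x * Q \<le> y * P" "0 < Q" "0 < P" for x y P Q :: real
              using that by (simp add: field_simps)
            ultimately show ?thesis unfolding r_def by blast
          qed
          also have "\<dots> \<le> W / (2 * V)" using Vle V W0 by (intro divide_left_mono) (auto intro!: mult_pos_pos add_pos_nonneg)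
          finally show ?thesis .
        qed
        then have "r * C \<le> W / (2 * V) * C" using C1 by (intro mult_right_mono) auto
        then show ?thesis by simp
      qed
      also have "r * C = 2 * b * real N * C" using N by (simp add: b_def)
      finally show ?thesis using a by linarith
    next
      case False
      have "0 \<le> W * sinh (K * W)" using W0 K by simp
      then have "S \<le> 8 * real N ^ 2 * C" using S_le by linarith
      then have "S / (2 * V) \<le> 8 * real N ^ 2 * C / (2 * V)" using V by (intro divide_right_mono) auto
      also have "\<dots> \<le> 8 * real N ^ 2 * C / 2" using V C1 by (intro divide_left_mono) auto
      finally have 1: "S / (2 * V) \<le> 4 * real N ^ 2 * C" by (simp add: mult_ac)
      have "K * W \<le> K * R0" using False K by simp
      then have "C \<le> cosh (K * R0)" unfolding C_def using W0 K by (intro cosh_real_nonneg_le_iff[THEN iffD2]) auto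
      then have "(4 * real N ^ 2 + 2 * b * real N) * C \<le> a" unfolding a_def using b by (intro mult_left_mono) auto
      then show ?thesis using 1 by (simp add: algebra_simps)
    qed
    then show ?thesis using two unfolding S_def by linarith
  qed
  show thesis by (rule that[OF a b main])
qed

section \<open>Dynkin's formula for the Metropolis height process\<close>

lemma rate_right_left_eq:
  "rate_right K N h i = real N ^ 4 * exp (- 3 * K) * exp (K * curv h i)"
  "rate_left K N h i = real N ^ 4 * exp (- 3 * K) * exp (- (K * curv h i))"
  by (simp_all add: rate_right_def rate_left_def exp_add exp_diff exp_minus divide_inverse)

lemma cosh_sinh_exp: "exp x = cosh x + sinh (x::real)" "exp (- x) = cosh x - sinh (x::real)"
  by (simp_all add: cosh_plus_sinh cosh_minus_sinh)

lemma rms_drift: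
  assumes K: "K > 0" and N: "N \<ge> 1"
  obtains a b where "0 \<le> a" "0 < b"
    "\<And>h. h \<in> profiles N \<Longrightarrow>
      (\<Sum>i\<in>{1..int N}. rate_right K N h i * (rms N (hop N i (i + 1) h) - rms N h) + rate_left K N h i * (rms N (hop N (i + 1) i h) - rms N h))
        \<le> a - b * total_rate (profiles N) (metropolis_rate K N) h"
proof -
  obtain a b where a: "0 \<le> a" and b: "0 < b" and
    main: "\<And>(w :: int \<Rightarrow> real) V. 1 \<le> V \<Longrightarrow> V \<le> 1 + real N ^ 2 * (\<Sum>j\<in>{1..int N}. \<bar>w j\<bar>) \<Longrightarrow>
      (\<Sum>i\<in>{1..int N}. 8 * real N * cosh (K * w i) - 4 * w i * sinh (K * w i)) / (2 * V)
        \<le> a - b * (\<Sum>i\<in>{1..int N}. 2 * cosh (K * w i))"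
    using lyapunov_inequality[OF K N] by blast
  define c0 where "c0 = real N ^ 4 * exp (- 3 * K)"
  have c0: "0 \<le> c0" by (simp add: c0_def)
  have "(\<Sum>i\<in>{1..int N}. rate_right K N h i * (rms N (hop N i (i + 1) h) - rms N h) + rate_left K N h i * (rms N (hop N (i + 1) i h) - rms N h))
        \<le> c0 * a - b * total_rate (profiles N) (metropolis_rate K N) h" if h: "h \<in> profiles N" for h
  proof -
    have p: "periodic N h" using h by (simp add: profiles_periodic)
    let ?w = "\<lambda>i. curv h i"
    let ?V = "rms N h"
    have V: "1 \<le> ?V" by (rule rms_ge_1)
    have "(\<Sum>i\<in>{1..int N}. rate_right K N h i * (rms N (hop N i (i + 1) h) - ?V) + rate_left K N h i * (rms N (hop N (i + 1) i h) - ?V))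
      \<le> (\<Sum>i\<in>{1..int N}. c0 * ((8 * real N * cosh (K * ?w i) - 4 * ?w i * sinh (K * ?w i)) / (2 * ?V)))"
    proof (rule sum_mono)
      fix i
      have 1: "rms N (hop N i (i + 1) h) - ?V \<le> (4 * real N - 2 * ?w i) / (2 * ?V)"
        by (rule order_trans[OF rms_increment divide_right_mono[OF energy_hop_up(1)[OF p N]]]) (use V in simp)
      have 2: "rms N (hop N (i + 1) i h) - ?V \<le> (4 * real N + 2 * ?w i) / (2 * ?V)"
        by (rule order_trans[OF rms_increment divide_right_mono[OF energy_hop_up(2)[OF p N]]]) (use V in simp)
      have "rate_right K N h i * (rms N (hop N i (i + 1) h) - ?V) + rate_left K N h i * (rms N (hop N (i + 1) i h) - ?V)
        \<le> c0 * exp (K * ?w i) * ((4 * real N - 2 * ?w i) / (2 * ?V)) + c0 * exp (- (K * ?w i)) * ((4 * real N + 2 * ?w i) / (2 * ?V))"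
        unfolding rate_right_left_eq c0_def[symmetric] by (intro add_mono mult_left_mono 1 2) (use c0 in auto)
      also have "\<dots> = c0 * ((8 * real N * cosh (K * ?w i) - 4 * ?w i * sinh (K * ?w i)) / (2 * ?V))"
        unfolding cosh_sinh_exp by (simp add: add_divide_distrib[symmetric] algebra_simps)
      finally show "rate_right K N h i * (rms N (hop N i (i + 1) h) - ?V) + rate_left K N h i * (rms N (hop N (i + 1) i h) - ?V) \<le> c0 * ((8 * real N * cosh (K * ?w i) - 4 * ?w i * sinh (K * ?w i)) / (2 * ?V))" .
    qed
    also have "\<dots> = c0 * ((\<Sum>i\<in>{1..int N}. 8 * real N * cosh (K * ?w i) - 4 * ?w i * sinh (K * ?w i)) / (2 * ?V))"
      by (simp add: sum_distrib_left sum_divide_distrib)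
    also have "\<dots> \<le> c0 * (a - b * (\<Sum>i\<in>{1..int N}. 2 * cosh (K * ?w i)))"
      by (intro mult_left_mono main V rms_upper[OF p N] c0)
    also have "\<dots> = c0 * a - b * total_rate (profiles N) (metropolis_rate K N) h"
    proof -
      have "total_rate (profiles N) (metropolis_rate K N) h = c0 * (\<Sum>i\<in>{1..int N}. 2 * cosh (K * ?w i))"
        unfolding metropolis_total_rate[OF h] rate_right_left_eq c0_def[symmetric]
        by (simp add: sum_distrib_left cosh_def distrib_left)
      then show ?thesis by (simp add: algebra_simps)
    qed
    finally show ?thesis .
  qed
  then show thesis using that[of "c0 * a" b] a b c0 by auto
qed

text \<open>
  The average of \<open>\<psi>\<close> against the heights minus their spatial mean. Unlike the heights themselves it is
  controlled by the third differences, hence has finite expectation.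
\<close>
definition centred_avg :: "(real \<Rightarrow> real) \<Rightarrow> nat \<Rightarrow> (int \<Rightarrow> int) \<Rightarrow> real" where
  "centred_avg \<psi> N h = height_avg \<psi> N h - (\<Sum>i\<in>{1..int N}. \<psi> (grid N i)) / real N * height_avg (\<lambda>_. 1) N h"

lemma grid_periodic:
  assumes "periodic_fun_simple' \<psi>" "N \<ge> 1"
  shows "periodic N (\<lambda>k. \<psi> (real_of_int k / real N))"
proof -
  have "\<psi> (real_of_int (k + int N) / real N) = \<psi> (real_of_int k / real N)" for k
  proof -
    have "real_of_int (k + int N) / real N = real_of_int k / real N + 1"
      using assms(2) by (simp add: add_divide_distrib)
    then show ?thesis using assms(1) by (simp add: periodic_fun_simple'_def)
  qed
  then show ?thesis by (simp add: periodic_fun_simple_def)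
qed

lemma height_avg_eq:
  "height_avg \<psi> N h = (\<Sum>k\<in>{1..int N}. \<psi> (real_of_int k / real N) * real_of_int (h k)) / real N ^ 4"
  unfolding height_avg_def by (simp add: sum_divide_distrib power_Suc2[symmetric] divide_divide_eq_left eval_nat_numeral mult_ac)

lemma height_avg_hop:
  assumes "periodic_fun_simple' \<psi>" "N \<ge> 1"
  shows "height_avg \<psi> N (hop N i j h) = height_avg \<psi> N h + (\<psi> (real_of_int j / real N) - \<psi> (grid N i)) / real N ^ 4"
  unfolding height_avg_eq hop_height_sum[OF grid_periodic[OF assms] assms(2)] by (simp add: add_divide_distrib)

lemma height_avg_1_hop: "N \<ge> 1 \<Longrightarrow> height_avg (\<lambda>_. 1) N (hop N i j h) = height_avg (\<lambda>_. 1) N h"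
  by (subst height_avg_hop) (auto simp: periodic_fun_simple'_def)

lemma centred_avg_eq:
  assumes N: "N \<ge> 1"
  shows "centred_avg \<psi> N h = (\<Sum>i\<in>{1..int N}. \<psi> (grid N i) * ((real_of_int (h i) - (\<Sum>k\<in>{1..int N}. real_of_int (h k)) / real N) / real N ^ 4))"
proof -
  let ?P = "\<Sum>i\<in>{1..int N}. \<psi> (grid N i)" and ?H = "\<Sum>k\<in>{1..int N}. real_of_int (h k)"
  have "(\<Sum>i\<in>{1..int N}. \<psi> (grid N i) * ((real_of_int (h i) - ?H / real N) / real N ^ 4))
    = (\<Sum>i\<in>{1..int N}. \<psi> (grid N i) * real_of_int (h i) / real N ^ 4 - \<psi> (grid N i) * (?H / real N / real N ^ 4))"
    by (intro sum.cong refl) (simp add: diff_divide_distrib right_diff_distrib)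
  also have "\<dots> = height_avg \<psi> N h - ?P * (?H / real N / real N ^ 4)"
    by (simp add: sum_subtractf height_avg_eq sum_divide_distrib sum_distrib_right)
  also have "?P * (?H / real N / real N ^ 4) = ?P / real N * height_avg (\<lambda>_. 1) N h"
    by (simp add: height_avg_eq)
  finally show ?thesis by (simp add: centred_avg_def)
qed

lemma centred_avg_bound:
  assumes N: "N \<ge> 1" and h: "periodic N h" and B: "\<And>x. \<bar>\<psi> x\<bar> \<le> B"
  shows "\<bar>centred_avg \<psi> N h\<bar> \<le> B * ((\<Sum>j\<in>{1..int N}. \<bar>curv h j\<bar>) / real N)"
proof -
  let ?m = "(\<Sum>k\<in>{1..int N}. real_of_int (h k)) / real N"
  let ?S = "\<Sum>j\<in>{1..int N}. \<bar>curv h j\<bar>"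
  have "\<bar>centred_avg \<psi> N h\<bar> \<le> (\<Sum>i\<in>{1..int N}. \<bar>\<psi> (grid N i) * ((real_of_int (h i) - ?m) / real N ^ 4)\<bar>)"
    unfolding centred_avg_eq[OF N] by (rule sum_abs)
  also have "\<dots> \<le> (\<Sum>i\<in>{1..int N}. B * (real N ^ 2 * ?S / real N ^ 4))"
    unfolding abs_mult abs_divide using height_bound[OF h N] B order_trans[OF abs_ge_zero B]
    by (intro sum_mono mult_mono divide_mono) (auto simp: N)
  also have "\<dots> = B * (?S / real N)"
    using N by (simp add: field_simps power2_eq_square eval_nat_numeral)
  finally show ?thesis .
qed

text \<open>
  A hop from \<open>i\<close> to \<open>j\<close> changes the average by \<open>N\<^sup>-\<^sup>4 (\<psi>(j/N) - \<psi>(i/N))\<close>, and the rates of the two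
  hops between \<open>i\<close> and \<open>i + 1\<close> differ by \<open>N\<^sup>4 J(w\<^sub>i)\<close>; the powers of \<open>N\<close> cancel.
\<close>
theorem metropolis_dynkin:
  assumes K: "K > 0" and N: "N \<ge> 1" and proc: "metropolis_process K N M H"
    and w0: "\<And>i. i \<in> {1..int N} \<Longrightarrow> integrable M (\<lambda>\<omega>. curv (H 0 \<omega>) i)"
    and \<psi>: "periodic_fun_simple' \<psi>" and B: "\<And>x. \<bar>\<psi> x\<bar> \<le> B" and t: "0 \<le> t"
  defines "L \<equiv> \<lambda>h. \<Sum>i\<in>{1..int N}. (\<psi> (grid N (i + 1)) - \<psi> (grid N i)) * J K (curv h i)"
  shows "integrable M (\<lambda>\<omega>. centred_avg \<psi> N (H t \<omega>))"
    and "set_integrable lborel {0..t} (\<lambda>s. \<integral>\<omega>. L (H s \<omega>) \<partial>M)"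
    and "(\<integral>\<omega>. centred_avg \<psi> N (H t \<omega>) \<partial>M) - (\<integral>\<omega>. centred_avg \<psi> N (H 0 \<omega>) \<partial>M) = (LBINT s:{0..t}. (\<integral>\<omega>. L (H s \<omega>) \<partial>M))"
    and "AE \<omega> in M. height_avg (\<lambda>_. 1) N (H t \<omega>) = height_avg (\<lambda>_. 1) N (H 0 \<omega>)"
proof -
  obtain Y \<sigma> where jc: "jump_chain M (profiles N) (metropolis_rate K N) H Y \<sigma>"
    by (rule jump_chain_metropolis[OF N proc])
  interpret jump_chain M "profiles N" "metropolis_rate K N" H Y \<sigma> by (rule jc)
  have Hp: "periodic N (H 0 \<omega>)" if "\<omega> \<in> space M" for \<omega>
    using measurable_space[OF X_measurable that, of 0] by (simp add: profiles_periodic)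
  have int_sum: "integrable M (\<lambda>\<omega>. \<Sum>j\<in>{1..int N}. \<bar>curv (H 0 \<omega>) j\<bar>)"
    by (intro Bochner_Integration.integrable_sum integrable_abs w0)
  obtain a b where a: "0 \<le> a" and b: "0 < b" and drift: "\<And>h. h \<in> profiles N \<Longrightarrow>
      (\<Sum>i\<in>{1..int N}. rate_right K N h i * (rms N (hop N i (i + 1) h) - rms N h) + rate_left K N h i * (rms N (hop N (i + 1) i h) - rms N h))
        \<le> a - b * R h"
    by (rule rms_drift[OF K N]) blast
  have jumps: "summable (\<lambda>k. prob (jumped k t))"
  proof (rule expected_jumps_finite[of "rms N" "4 * real N + 8"])
    show "0 \<le> rms N x" for x using rms_ge_1[of N x] by simp
    show "\<bar>rms N z - rms N x\<bar> \<le> 4 * real N + 8" if x: "x \<in> profiles N" and z: "z \<in> succs x" for x z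
    proof -
      have p: "periodic N x" using x by (simp add: profiles_periodic)
      obtain i where "z = hop N i (i + 1) x \<or> z = hop N (i + 1) i x" by (rule metropolis_succs[OF jc z]) blast
      then show ?thesis using energy_hop_up(3,4)[OF p N, of i] by (intro rms_hop_bound[OF p N]) auto
    qed
    show "integrable M (\<lambda>\<omega>. rms N (H 0 \<omega>))"
    proof (rule Bochner_Integration.integrable_bound)
      show "integrable M (\<lambda>\<omega>. 1 + real N ^ 2 * (\<Sum>j\<in>{1..int N}. \<bar>curv (H 0 \<omega>) j\<bar>))"
        using int_sum by simp
      show "AE \<omega> in M. norm (rms N (H 0 \<omega>)) \<le> norm (1 + real N ^ 2 * (\<Sum>j\<in>{1..int N}. \<bar>curv (H 0 \<omega>) j\<bar>))"
      proof (rule AE_I2)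
        fix \<omega> assume "\<omega> \<in> space M"
        from rms_upper[OF Hp[OF this] N] rms_ge_1[of N "H 0 \<omega>"]
        show "norm (rms N (H 0 \<omega>)) \<le> norm (1 + real N ^ 2 * (\<Sum>j\<in>{1..int N}. \<bar>curv (H 0 \<omega>) j\<bar>))"
          by simp
      qed
    qed (simp add: X_measurable')
    show "generator (rms N) x \<le> a - b * R x" if "x \<in> profiles N" for x
      using drift[OF that] metropolis_generator[OF jc that] by simp
  qed (use a b t in auto)
  have diff: "centred_avg \<psi> N (hop N i j h) - centred_avg \<psi> N h = (\<psi> (real_of_int j / real N) - \<psi> (grid N i)) / real N ^ 4" for i j h
    unfolding centred_avg_def height_avg_1_hop[OF N] height_avg_hop[OF \<psi> N] by simp
  have D: "\<bar>centred_avg \<psi> N z - centred_avg \<psi> N x\<bar> \<le> 2 * B" if x: "x \<in> profiles N" and z: "z \<in> succs x" for x z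
  proof -
    obtain i where "z = hop N i (i + 1) x \<or> z = hop N (i + 1) i x" by (rule metropolis_succs[OF jc z]) blast
    then obtain k l where kl: "z = hop N k l x" by blast
    have B0: "0 \<le> B" using B[of 0] by linarith
    have "\<bar>\<psi> (real_of_int l / real N) - \<psi> (real_of_int k / real N)\<bar> \<le> 2 * B"
      using B[of "real_of_int l / real N"] B[of "real_of_int k / real N"] by linarith
    moreover have "1 \<le> real N ^ 4" using N by simp
    ultimately have "\<bar>\<psi> (real_of_int l / real N) - \<psi> (real_of_int k / real N)\<bar> / real N ^ 4 \<le> 2 * B / 1"
      using B0 by (intro frac_le) auto
    then show ?thesis unfolding kl diff by simp
  qed
  have genL: "generator (centred_avg \<psi> N) h = L h" if "h \<in> profiles N" for h
  proof -
    have "generator (centred_avg \<psi> N) h = (\<Sum>i\<in>{1..int N}. (rate_right K N h i - rate_left K N h i) * ((\<psi> (grid N (i + 1)) - \<psi> (grid N i)) / real N ^ 4))"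
      unfolding metropolis_generator[OF jc that] diff by (intro sum.cong refl) (simp add: algebra_simps diff_divide_distrib)
    also have "\<dots> = L h"
      unfolding L_def rate_right_left_eq cosh_sinh_exp J_def using N by (intro sum.cong refl) (simp add: field_simps)
    finally show ?thesis .
  qed
  have int0: "integrable M (\<lambda>\<omega>. centred_avg \<psi> N (H 0 \<omega>))"
  proof (rule Bochner_Integration.integrable_bound)
    show "integrable M (\<lambda>\<omega>. B * ((\<Sum>j\<in>{1..int N}. \<bar>curv (H 0 \<omega>) j\<bar>) / real N))"
      using int_sum by simp
    show "AE \<omega> in M. norm (centred_avg \<psi> N (H 0 \<omega>)) \<le> norm (B * ((\<Sum>j\<in>{1..int N}. \<bar>curv (H 0 \<omega>) j\<bar>) / real N))"
    proof (rule AE_I2)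
      fix \<omega> assume "\<omega> \<in> space M"
      then have "\<bar>centred_avg \<psi> N (H 0 \<omega>)\<bar> \<le> B * ((\<Sum>j\<in>{1..int N}. \<bar>curv (H 0 \<omega>) j\<bar>) / real N)"
        by (intro centred_avg_bound[OF N Hp] B)
      from this abs_ge_self[of "B * ((\<Sum>j\<in>{1..int N}. \<bar>curv (H 0 \<omega>) j\<bar>) / real N)"]
      show "norm (centred_avg \<psi> N (H 0 \<omega>)) \<le> norm (B * ((\<Sum>j\<in>{1..int N}. \<bar>curv (H 0 \<omega>) j\<bar>) / real N))"
        unfolding real_norm_def by (rule order_trans)
    qed
  qed (simp add: X_measurable')
  note d = dynkin[of "centred_avg \<psi> N" "2 * B" t, OF D int0 t jumps]
  have E: "(\<integral>\<omega>. generator (centred_avg \<psi> N) (H s \<omega>) \<partial>M) = (\<integral>\<omega>. L (H s \<omega>) \<partial>M)" if "s \<in> {0..t}" for s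
  proof (rule Bochner_Integration.integral_cong[OF refl])
    fix \<omega> assume "\<omega> \<in> space M"
    then have "H s \<omega> \<in> profiles N" using measurable_space[OF X_measurable, of s \<omega>] that by simp
    then show "generator (centred_avg \<psi> N) (H s \<omega>) = L (H s \<omega>)" by (rule genL)
  qed
  show "integrable M (\<lambda>\<omega>. centred_avg \<psi> N (H t \<omega>))" by (rule d(1))
  show "set_integrable lborel {0..t} (\<lambda>s. \<integral>\<omega>. L (H s \<omega>) \<partial>M)"
  proof -
    have "set_integrable lborel {0..t} (\<lambda>s. \<integral>\<omega>. generator (centred_avg \<psi> N) (H s \<omega>) \<partial>M) = set_integrable lborel {0..t} (\<lambda>s. \<integral>\<omega>. L (H s \<omega>) \<partial>M)"
      by (rule set_integrable_cong[OF refl refl]) (rule E)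
    moreover have "set_integrable lborel {0..t} (\<lambda>s. \<integral>\<omega>. generator (centred_avg \<psi> N) (H s \<omega>) \<partial>M)" by (rule d(2))
    ultimately show ?thesis by simp
  qed
  show "(\<integral>\<omega>. centred_avg \<psi> N (H t \<omega>) \<partial>M) - (\<integral>\<omega>. centred_avg \<psi> N (H 0 \<omega>) \<partial>M) = (LBINT s:{0..t}. (\<integral>\<omega>. L (H s \<omega>) \<partial>M))"
  proof -
    have "(LBINT s:{0..t}. (\<integral>\<omega>. generator (centred_avg \<psi> N) (H s \<omega>) \<partial>M)) = (LBINT s:{0..t}. (\<integral>\<omega>. L (H s \<omega>) \<partial>M))"
      by (rule set_lebesgue_integral_cong) (auto simp: E)
    moreover have "(\<integral>\<omega>. centred_avg \<psi> N (H t \<omega>) \<partial>M) - (\<integral>\<omega>. centred_avg \<psi> N (H 0 \<omega>) \<partial>M) = (LBINT s:{0..t}. (\<integral>\<omega>. generator (centred_avg \<psi> N) (H s \<omega>) \<partial>M))"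
      by (rule d(3))
    ultimately show ?thesis by simp
  qed
  show "AE \<omega> in M. height_avg (\<lambda>_. 1) N (H t \<omega>) = height_avg (\<lambda>_. 1) N (H 0 \<omega>)"
  proof (rule invariant_conserved[OF _ t])
    fix x z assume "z \<in> succs x"
    then obtain i where "z = hop N i (i + 1) x \<or> z = hop N (i + 1) i x" by (rule metropolis_succs[OF jc]) blast
    then show "height_avg (\<lambda>_. 1) N z = height_avg (\<lambda>_. 1) N x" using height_avg_1_hop[OF N] by auto
  qed
qed

section \<open>Periodic functions and windows on the torus\<close>

lemma periodic_shift_int:
  fixes f :: "real \<Rightarrow> 'b"
  assumes "periodic_fun_simple' f"
  shows "f (x + of_int k) = f x"
proof -
  interpret periodic_fun_simple' f by fact
  show ?thesis by (rule plus_of_int)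
qed

lemma periodic_continuous_bounded:
  fixes f :: "real \<Rightarrow> real"
  assumes p: "periodic_fun_simple' f" and c: "continuous_on UNIV f"
  obtains B where "0 \<le> B" "\<And>x. \<bar>f x\<bar> \<le> B"
proof -
  have "compact (f ` {0..1})" using c by (intro compact_continuous_image) (auto intro: continuous_on_subset)
  then have "bounded (f ` {0..1})" by (rule compact_imp_bounded)
  then obtain B where B: "\<forall>y\<in>f ` {0..1}. norm y \<le> B" unfolding bounded_iff by blast
  have "\<bar>f x\<bar> \<le> B" for x
  proof -
    have "f (frac x + of_int \<lfloor>x\<rfloor>) = f (frac x)" by (rule periodic_shift_int[OF p])
    moreover have "frac x + of_int \<lfloor>x\<rfloor> = x" by (simp add: frac_def)
    moreover have "f (frac x) \<in> f ` {0..1}" by (intro imageI) (simp add: frac_ge_0 less_imp_le[OF frac_lt_1])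
    ultimately show ?thesis using B by force
  qed
  moreover from this[of 0] have "0 \<le> B" by linarith
  ultimately show thesis using that by blast
qed

lemma periodic_uniformly_continuous:
  fixes f :: "real \<Rightarrow> real"
  assumes p: "periodic_fun_simple' f" and c: "continuous_on UNIV f" and e: "0 < e"
  obtains d where "0 < d" "\<And>x y. \<bar>x - y\<bar> \<le> d \<Longrightarrow> \<bar>f x - f y\<bar> \<le> e"
proof -
  have "uniformly_continuous_on {-1..2} f"
    using c by (intro compact_uniformly_continuous) (auto intro: continuous_on_subset)
  then obtain d where d: "0 < d" "\<And>x y. x \<in> {-1..2} \<Longrightarrow> y \<in> {-1..2} \<Longrightarrow> dist y x < d \<Longrightarrow> dist (f y) (f x) < e"
    unfolding uniformly_continuous_on_def using e by meson
  define d' where "d' = min (d / 2) 1"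
  have "\<bar>f x - f y\<bar> \<le> e" if xy: "\<bar>x - y\<bar> \<le> d'" for x y
  proof -
    let ?n = "of_int (- \<lfloor>x\<rfloor>) :: real"
    have "x + ?n = frac x" by (simp add: frac_def)
    then have x: "x + ?n \<in> {-1..2}" unfolding atLeastAtMost_iff using frac_ge_0[of x] frac_lt_1[of x] by linarith
    moreover have "y + ?n \<in> {-1..2}" 
      unfolding atLeastAtMost_iff using frac_ge_0[of x] frac_lt_1[of x] \<open>x + ?n = frac x\<close> xy unfolding d'_def by linarith
    moreover have "dist (y + ?n) (x + ?n) < d" using xy d(1) by (simp add: d'_def dist_real_def abs_minus_commute)
    ultimately have "dist (f (y + ?n)) (f (x + ?n)) < e" by (rule d(2))
    then show ?thesis using periodic_shift_int[OF p, of x "- \<lfloor>x\<rfloor>"] periodic_shift_int[OF p, of y "- \<lfloor>x\<rfloor>"]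
      by (simp add: dist_real_def)
  qed
  moreover have "0 < d'" using d by (simp add: d'_def)
  ultimately show thesis using that by blast
qed

text \<open>
  Limits in the extended nonnegative reals are reduced to estimates with real \<open>\<delta>\<close>.
\<close>
lemma ennreal_tendsto_0I:
  fixes f :: "'a \<Rightarrow> ennreal"
  assumes "\<And>\<delta>. 0 < \<delta> \<Longrightarrow> eventually (\<lambda>x. f x \<le> ennreal \<delta>) F"
  shows "(f \<longlongrightarrow> 0) F"
proof (rule order_tendstoI)
  fix a :: ennreal assume a: "0 < a"
  obtain \<delta> where \<delta>: "0 < \<delta>" "ennreal \<delta> < a"
  proof (cases a)
    case (real r)
    then have "0 < r" using a by (auto simp: less_le)
    then show thesis using that[of "r / 2"] real by (simp add: ennreal_less_iff)
  next
    case top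
    then show thesis using that[of 1] by simp
  qed
  show "eventually (\<lambda>x. f x < a) F"
    using assms[OF \<delta>(1)] by eventually_elim (rule le_less_trans[OF _ \<delta>(2)])
qed simp

lemma ennreal_tendsto_0D:
  fixes f :: "'a \<Rightarrow> ennreal"
  assumes "(f \<longlongrightarrow> 0) F" "0 < \<delta>"
  shows "eventually (\<lambda>x. f x < ennreal \<delta>) F"
  using order_tendstoD(2)[OF assms(1), of "ennreal \<delta>"] assms(2) by simp

lemma infdist_Ints_le_iff:
  "infdist (u :: real) \<int> \<le> \<epsilon> \<longleftrightarrow> (\<exists>k::int. \<bar>u - of_int k\<bar> \<le> \<epsilon>)"
proof
  have "closed (\<int> :: real set)" by (rule closed_Ints)
  then obtain x where "x \<in> (\<int> :: real set)" "infdist u \<int> = dist u x"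
    using infdist_attains_inf[of "\<int> :: real set" u] Ints_0 by (metis empty_iff)
  moreover assume "infdist u \<int> \<le> \<epsilon>"
  ultimately show "\<exists>k::int. \<bar>u - of_int k\<bar> \<le> \<epsilon>" by (auto elim!: Ints_cases simp: dist_real_def)
next
  assume "\<exists>k::int. \<bar>u - of_int k\<bar> \<le> \<epsilon>"
  then obtain k :: int where "\<bar>u - of_int k\<bar> \<le> \<epsilon>" by blast
  then show "infdist u \<int> \<le> \<epsilon>" by (intro infdist_le2[of "of_int k"]) (auto simp: dist_real_def)
qed

lemma infdist_Ints_near:
  assumes "\<bar>u\<bar> \<le> 1" "\<epsilon> < 1 / 2"
  shows "infdist (u :: real) \<int> \<le> \<epsilon> \<longleftrightarrow> \<bar>u\<bar> \<le> \<epsilon> \<or> \<bar>u - 1\<bar> \<le> \<epsilon> \<or> \<bar>u + 1\<bar> \<le> \<epsilon>"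
proof
  assume "infdist u \<int> \<le> \<epsilon>"
  then obtain k :: int where k: "\<bar>u - of_int k\<bar> \<le> \<epsilon>" by (auto simp: infdist_Ints_le_iff)
  then have "\<bar>of_int k :: real\<bar> < 2" using assms by linarith
  then have "k = 0 \<or> k = 1 \<or> k = - 1" by linarith
  then show "\<bar>u\<bar> \<le> \<epsilon> \<or> \<bar>u - 1\<bar> \<le> \<epsilon> \<or> \<bar>u + 1\<bar> \<le> \<epsilon>" using k by auto
next
  assume "\<bar>u\<bar> \<le> \<epsilon> \<or> \<bar>u - 1\<bar> \<le> \<epsilon> \<or> \<bar>u + 1\<bar> \<le> \<epsilon>"
  then show "infdist u \<int> \<le> \<epsilon>" unfolding infdist_Ints_le_iff
    by (elim disjE) (auto intro: exI[of _ 0] exI[of _ 1] exI[of _ "-1"])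
qed

text \<open>
  The window condition read as a condition on the centre \<open>x\<close>, for a fixed site \<open>y = i / N\<close>. Integrating a
  window average over \<open>x\<close> distributes the weight of each site over its near set.
\<close>
definition near_set :: "real \<Rightarrow> real \<Rightarrow> real set" where
  "near_set y \<epsilon> = {x \<in> {0..1}. infdist (y - x) \<int> \<le> \<epsilon>}"

lemma window_near_set: "i \<in> {1..int N} \<Longrightarrow> x \<in> {0..1} \<Longrightarrow> i \<in> window N x \<epsilon> \<longleftrightarrow> x \<in> near_set (grid N i) \<epsilon>"
  by (simp add: window_def near_set_def)

lemma near_set_sets[measurable]: "near_set y \<epsilon> \<in> sets borel"
proof -
  have "near_set y \<epsilon> = {0..1} \<inter> (\<Union>k::int. {y - of_int k - \<epsilon>..y - of_int k + \<epsilon>})"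
    unfolding near_set_def infdist_Ints_le_iff by (auto simp: abs_le_iff algebra_simps)
  then show ?thesis by simp
qed

text \<open>
  The near set consists of the parts in \<open>[0, 1]\<close> of the intervals of radius \<open>\<epsilon>\<close> around \<open>y - 1\<close>, \<open>y\<close> and
  \<open>y + 1\<close>. They are disjoint as \<open>\<epsilon> < 1/2\<close>, and what the middle one loses at an end of \<open>[0, 1]\<close> another
  one supplies.
\<close>
lemma near_set_measure:
  assumes y: "0 \<le> y" "y \<le> 1" and \<epsilon>: "0 < \<epsilon>" "\<epsilon> < 1 / 2"
  shows "emeasure lborel (near_set y \<epsilon>) = ennreal (2 * \<epsilon>)"
proof -
  let ?I = "\<lambda>c. {max 0 (c - \<epsilon>)..min 1 (c + \<epsilon>)}"
  have eq: "near_set y \<epsilon> = ?I (y - 1) \<union> (?I y \<union> ?I (y + 1))"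
    using y \<epsilon> unfolding near_set_def by (auto simp: infdist_Ints_near abs_le_iff)
  have I: "emeasure lborel (?I c) = ennreal (min 1 (c + \<epsilon>) - max 0 (c - \<epsilon>))" if "max 0 (c - \<epsilon>) \<le> min 1 (c + \<epsilon>)" for c
    using that by (rule emeasure_lborel_Icc)
  have d1: "?I (y - 1) \<inter> (?I y \<union> ?I (y + 1)) = {}" and d2: "?I y \<inter> ?I (y + 1) = {}"
    using \<epsilon> by auto
  have "emeasure lborel (near_set y \<epsilon>) = emeasure lborel (?I (y - 1)) + (emeasure lborel (?I y) + emeasure lborel (?I (y + 1)))"
    unfolding eq by (subst plus_emeasure[symmetric, OF _ _ d1], simp, simp, subst plus_emeasure[symmetric, OF _ _ d2]) auto
  also have "emeasure lborel (?I (y - 1)) = ennreal (max 0 (y - 1 + \<epsilon>))"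
    by (cases "0 \<le> y - 1 + \<epsilon>") (use y \<epsilon> in \<open>auto simp: max_def min_def\<close>)
  also have "emeasure lborel (?I (y + 1)) = ennreal (max 0 (\<epsilon> - y))"
    by (cases "y \<le> \<epsilon>") (use y \<epsilon> in \<open>auto simp: max_def min_def\<close>)
  also have "emeasure lborel (?I y) = ennreal (min 1 (y + \<epsilon>) - max 0 (y - \<epsilon>))"
    using y \<epsilon> by (intro I) auto
  also have "ennreal (max 0 (y - 1 + \<epsilon>)) + (ennreal (min 1 (y + \<epsilon>) - max 0 (y - \<epsilon>)) + ennreal (max 0 (\<epsilon> - y)))
     = ennreal (max 0 (y - 1 + \<epsilon>) + (min 1 (y + \<epsilon>) - max 0 (y - \<epsilon>) + max 0 (\<epsilon> - y)))"
  proof -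
    have "ennreal a + (ennreal b + ennreal c) = ennreal (a + (b + c))" if "0 \<le> a" "0 \<le> b" "0 \<le> c" for a b c :: real
      using that by simp
    then show ?thesis by (rule) (use y \<epsilon> in auto)
  qed
  also have "max 0 (y - 1 + \<epsilon>) + (min 1 (y + \<epsilon>) - max 0 (y - \<epsilon>) + max 0 (\<epsilon> - y)) = 2 * \<epsilon>"
    using y \<epsilon> by (auto simp: max_def min_def)
  finally show ?thesis .
qed

lemma continuous_bounded_integrable:
  fixes f :: "real \<Rightarrow> real"
  assumes [measurable]: "f \<in> borel_measurable borel" and B: "\<And>x. \<bar>f x\<bar> \<le> (B :: real)" and [measurable]: "A \<in> sets borel" and A: "A \<subseteq> {0..1}"
  shows "integrable lborel (\<lambda>x. indicator A x * f x)"
proof (rule Bochner_Integration.integrable_bound)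
  show "integrable lborel (\<lambda>x. B * indicator {0..1::real} x :: real)" by simp
  have "0 \<le> B" using order_trans[OF abs_ge_zero B] .
  then show "AE x in lborel. norm (indicator A x * f x) \<le> norm (B * indicator {0..1} x)"
    using A B by (intro AE_I2) (auto split: split_indicator)
qed measurable

lemma near_set_average:
  fixes \<phi> :: "real \<Rightarrow> real"
  assumes y: "0 \<le> y" "y \<le> 1" and \<epsilon>: "0 < \<epsilon>" "\<epsilon> < 1 / 2"
    and p: "periodic_fun_simple' \<phi>" and c: "continuous_on UNIV \<phi>"
    and \<eta>: "\<And>u v. \<bar>u - v\<bar> \<le> \<epsilon> \<Longrightarrow> \<bar>\<phi> u - \<phi> v\<bar> \<le> \<eta>"
  shows "\<bar>(\<integral>x. indicator (near_set y \<epsilon>) x * \<phi> x \<partial>lborel) / (2 * \<epsilon>) - \<phi> y\<bar> \<le> \<eta>"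
proof -
  obtain B where B: "\<And>x. \<bar>\<phi> x\<bar> \<le> B" using periodic_continuous_bounded[OF p c] by blast
  have [measurable]: "\<phi> \<in> borel_measurable borel" using c by (rule borel_measurable_continuous_onI)
  have m: "measure lborel (near_set y \<epsilon>) = 2 * \<epsilon>" using near_set_measure[OF y \<epsilon>] \<epsilon> by (simp add: measure_def)
  have sub: "near_set y \<epsilon> \<subseteq> {0..1}" by (auto simp: near_set_def)
  have i1: "integrable lborel (\<lambda>x. indicator (near_set y \<epsilon>) x * \<phi> x)"
    by (rule continuous_bounded_integrable[OF _ B _ sub]) auto
  have i2: "integrable lborel (\<lambda>x. indicator (near_set y \<epsilon>) x * c)" for c :: real
    by (rule continuous_bounded_integrable[of _ "\<bar>c\<bar>", OF _ _ _ sub]) auto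
  have "(\<integral>x. indicator (near_set y \<epsilon>) x * \<phi> x \<partial>lborel) - 2 * \<epsilon> * \<phi> y = (\<integral>x. indicator (near_set y \<epsilon>) x * \<phi> x - indicator (near_set y \<epsilon>) x * \<phi> y \<partial>lborel)"
    using i1 i2 m by (subst Bochner_Integration.integral_diff) auto
  also have "\<bar>\<dots>\<bar> \<le> (\<integral>x. indicator (near_set y \<epsilon>) x * \<eta> \<partial>lborel)"
    unfolding real_norm_def[symmetric]
  proof (rule Bochner_Integration.integral_norm_bound_integral)
    fix x
    show "norm (indicator (near_set y \<epsilon>) x * \<phi> x - indicator (near_set y \<epsilon>) x * \<phi> y) \<le> indicator (near_set y \<epsilon>) x * \<eta>"
    proof (cases "x \<in> near_set y \<epsilon>")
      case True
      then obtain k :: int where "\<bar>y - x - of_int k\<bar> \<le> \<epsilon>" by (auto simp: near_set_def infdist_Ints_le_iff)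
      then have "\<bar>\<phi> (x + of_int k) - \<phi> y\<bar> \<le> \<eta>" by (intro \<eta>) (simp add: abs_le_iff algebra_simps)
      then show ?thesis using True periodic_shift_int[OF p, of x k] by simp
    qed simp
  qed (use i1 i2 in auto)
  also have "\<dots> = 2 * \<epsilon> * \<eta>" using m by simp
  finally have "\<bar>(\<integral>x. indicator (near_set y \<epsilon>) x * \<phi> x \<partial>lborel) - 2 * \<epsilon> * \<phi> y\<bar> / (2 * \<epsilon>) \<le> \<eta>"
    using \<epsilon> by (simp add: field_simps)
  moreover have "(\<integral>x. indicator (near_set y \<epsilon>) x * \<phi> x \<partial>lborel) / (2 * \<epsilon>) - \<phi> y = ((\<integral>x. indicator (near_set y \<epsilon>) x * \<phi> x \<partial>lborel) - 2 * \<epsilon> * \<phi> y) / (2 * \<epsilon>)"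
    using \<epsilon> by (simp add: field_simps)
  ultimately show ?thesis using \<epsilon> by (simp add: abs_divide)
qed

lemma card_int_interval: "finite {i::int. l \<le> real_of_int i \<and> real_of_int i \<le> u}"
  "l \<le> u \<Longrightarrow> real (card {i::int. l \<le> real_of_int i \<and> real_of_int i \<le> u}) \<le> u - l + 1"
proof -
  have eq: "{i::int. l \<le> real_of_int i \<and> real_of_int i \<le> u} = {\<lceil>l\<rceil>..\<lfloor>u\<rfloor>}" by (auto simp: ceiling_le_iff le_floor_iff)
  show "finite {i::int. l \<le> real_of_int i \<and> real_of_int i \<le> u}" unfolding eq by simp
  show "real (card {i::int. l \<le> real_of_int i \<and> real_of_int i \<le> u}) \<le> u - l + 1" if "l \<le> u"
  proof -
    have "real (card {\<lceil>l\<rceil>..\<lfloor>u\<rfloor>}) = real_of_int (max 0 (\<lfloor>u\<rfloor> - \<lceil>l\<rceil> + 1))" by simp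
    also have "\<dots> \<le> u - l + 1" using that by (auto simp: max_def) linarith
    finally show ?thesis unfolding eq .
  qed
qed

text \<open>
  The factor 3 counts the integer translates that can meet the window; only the order of magnitude
  matters.
\<close>
lemma card_window:
  assumes x: "x \<in> {0..1}" and \<epsilon>: "0 < \<epsilon>" "\<epsilon> < 1 / 2" and N: "N \<ge> 1"
  shows "real (card (window N x \<epsilon>)) \<le> 3 * (2 * real N * \<epsilon> + 1)"
proof -
  let ?A = "\<lambda>k::real. {i::int. real N * (x + k - \<epsilon>) \<le> real_of_int i \<and> real_of_int i \<le> real N * (x + k + \<epsilon>)}"
  have A: "real (card (?A k)) \<le> 2 * real N * \<epsilon> + 1" for k
    using card_int_interval(2)[of "real N * (x + k - \<epsilon>)" "real N * (x + k + \<epsilon>)"] \<epsilon> N by (simp add: algebra_simps)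
  have "window N x \<epsilon> \<subseteq> ?A 0 \<union> (?A 1 \<union> ?A (-1))"
  proof
    fix i assume i: "i \<in> window N x \<epsilon>"
    then have iN: "1 \<le> i" "i \<le> int N" by (auto simp: window_def)
    have "0 \<le> grid N i" "grid N i \<le> 1"
      using iN N by (auto simp: field_simps)
    then have "\<bar>grid N i - x\<bar> \<le> 1" using x by auto
    then have "\<bar>grid N i - x\<bar> \<le> \<epsilon> \<or> \<bar>grid N i - x - 1\<bar> \<le> \<epsilon> \<or> \<bar>grid N i - x + 1\<bar> \<le> \<epsilon>"
      using i infdist_Ints_near[of "grid N i - x" \<epsilon>] \<epsilon> by (simp add: window_def)
    then have "\<exists>k\<in>{0,1,-1}. \<bar>grid N i - (x + k)\<bar> \<le> \<epsilon>" by (auto simp: algebra_simps)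
    then obtain k where k: "k \<in> {0,1,-1::real}" "\<bar>grid N i - (x + k)\<bar> \<le> \<epsilon>" by blast
    from k(2) have "x + k - \<epsilon> \<le> grid N i" "grid N i \<le> x + k + \<epsilon>" by linarith+
    then have "i \<in> ?A k" using N by (simp add: field_simps)
    then show "i \<in> ?A 0 \<union> (?A 1 \<union> ?A (-1))" using k(1) by blast
  qed
  then have "card (window N x \<epsilon>) \<le> card (?A 0 \<union> (?A 1 \<union> ?A (-1)))"
    by (intro card_mono finite_UnI card_int_interval)
  also have "\<dots> \<le> card (?A 0) + (card (?A 1) + card (?A (-1)))"
    by (intro order_trans[OF card_Un_le] add_left_mono card_Un_le)
  finally have "real (card (window N x \<epsilon>)) \<le> real (card (?A 0)) + (real (card (?A 1)) + real (card (?A (-1))))"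
    by (simp only: of_nat_add[symmetric] of_nat_le_iff)
  also have "\<dots> \<le> (2 * real N * \<epsilon> + 1) + ((2 * real N * \<epsilon> + 1) + (2 * real N * \<epsilon> + 1))"
    by (intro add_mono A)
  finally show ?thesis by (simp add: algebra_simps)
qed

section \<open>From window averages to weak limits\<close>

text \<open>
  Window averages of an arbitrary array, so that third differences and mean currents are treated
  alike.
\<close>
definition wavg :: "(int \<Rightarrow> real) \<Rightarrow> nat \<Rightarrow> real \<Rightarrow> real \<Rightarrow> real" where
  "wavg a N x \<epsilon> = 1 / (2 * real N * \<epsilon>) * (\<Sum>i\<in>window N x \<epsilon>. a i)"

lemma window_avg_eq: "window_avg f N x \<epsilon> h = wavg (\<lambda>i. f (curv h i)) N x \<epsilon>"
  by (simp add: window_avg_def wavg_def)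

lemma window_subset: "window N x \<epsilon> \<subseteq> {1..int N}"
  by (auto simp: window_def)

lemma wavg_near_set:
  assumes "x \<in> {0..1}"
  shows "wavg a N x \<epsilon> = 1 / (2 * real N * \<epsilon>) * (\<Sum>i\<in>{1..int N}. a i * indicator (near_set (grid N i) \<epsilon>) x)"
proof -
  have "(\<Sum>i\<in>window N x \<epsilon>. a i) = (\<Sum>i\<in>{1..int N}. a i * indicator (near_set (grid N i) \<epsilon>) x)"
  proof (rule sum.mono_neutral_cong_left)
    show "\<forall>i\<in>{1..int N} - window N x \<epsilon>. a i * indicator (near_set (grid N i) \<epsilon>) x = 0"
      using window_near_set[OF _ assms] by auto
    show "a i = a i * indicator (near_set (grid N i) \<epsilon>) x" if "i \<in> window N x \<epsilon>" for i
    proof -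
      have "i \<in> {1..int N}" using that window_subset by blast
      then show ?thesis using window_near_set[OF _ assms, of i N \<epsilon>] that by simp
    qed
  qed (auto intro: window_subset[THEN subsetD])
  then show ?thesis by (simp add: wavg_def)
qed

text \<open>
  The first term is the cost of replacing \<open>\<phi>(i/N)\<close> by the mean of \<open>\<phi>\<close> over the near set of \<open>i/N\<close>. After this
  replacement the sum is exactly the integral of \<open>\<phi>\<close> against the window averages.
\<close>
lemma smoothed_sum_bound:
  fixes a :: "int \<Rightarrow> real"
  assumes N: "N \<ge> 1" and \<epsilon>: "0 < \<epsilon>" "\<epsilon> < 1 / 2"
    and \<phi>: "periodic_fun_simple' \<phi>" "continuous_on UNIV \<phi>" and B: "\<And>x. \<bar>\<phi> x\<bar> \<le> B"
    and g: "periodic_fun_simple' g" "continuous_on UNIV g"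
    and \<eta>: "\<And>u v. \<bar>u - v\<bar> \<le> \<epsilon> \<Longrightarrow> \<bar>\<phi> u - \<phi> v\<bar> \<le> \<eta>"
  shows "ennreal \<bar>1 / real N * (\<Sum>i\<in>{1..int N}. \<phi> (grid N i) * a i) - (LBINT x:{0..1}. \<phi> x * g x)\<bar>
    \<le> ennreal \<eta> * (ennreal (1 / real N) * (\<Sum>i\<in>{1..int N}. ennreal \<bar>a i\<bar>))
      + ennreal B * (\<integral>\<^sup>+x. indicator {0..1} x * ennreal \<bar>wavg a N x \<epsilon> - g x\<bar> \<partial>lborel)"
proof -
  let ?y = "\<lambda>i. grid N i"
  let ?S = "1 / real N * (\<Sum>i\<in>{1..int N}. \<phi> (?y i) * a i)"
  let ?c = "\<lambda>i. (\<integral>x. indicator (near_set (?y i) \<epsilon>) x * \<phi> x \<partial>lborel) / (2 * \<epsilon>)"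
  have [measurable]: "\<phi> \<in> borel_measurable borel" "g \<in> borel_measurable borel"
    using \<phi>(2) g(2) by (auto intro: borel_measurable_continuous_onI)
  obtain G where G: "\<And>x. \<bar>g x\<bar> \<le> G" using periodic_continuous_bounded[OF g] by blast
  have B0: "0 \<le> B" by (rule order_trans[OF abs_ge_zero B[of 0]])
  have \<eta>0: "0 \<le> \<eta>" using \<eta>[of 0 0] \<epsilon> by simp
  have int_i: "integrable lborel (\<lambda>x. indicator (near_set (?y i) \<epsilon>) x * \<phi> x)" for i
  proof (rule continuous_bounded_integrable[OF _ B])
    show "near_set (?y i) \<epsilon> \<subseteq> {0..1}" by (auto simp: near_set_def)
  qed auto
  define A where "A = (\<lambda>x. 1 / (2 * real N * \<epsilon>) * (\<Sum>i\<in>{1..int N}. a i * indicator (near_set (?y i) \<epsilon>) x))"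
  have [measurable]: "A \<in> borel_measurable borel" unfolding A_def by measurable
  have \<phi>A: "indicator {0..1} x * (\<phi> x * A x) = (\<Sum>i\<in>{1..int N}. a i / (2 * real N * \<epsilon>) * (indicator (near_set (?y i) \<epsilon>) x * \<phi> x))" for x
  proof -
    have "x \<notin> near_set (?y i) \<epsilon>" if "x \<notin> {0..1}" for i
      using that by (auto simp: near_set_def)
    then have "indicator {0..1} x * A x = A x"
      by (cases "x \<in> {0..1}") (simp_all add: A_def)
    then have "indicator {0..1} x * (\<phi> x * A x) = \<phi> x * A x" by (simp add: mult.left_commute)
    also have "\<phi> x * A x = (\<Sum>i\<in>{1..int N}. a i / (2 * real N * \<epsilon>) * (indicator (near_set (?y i) \<epsilon>) x * \<phi> x))"
      unfolding A_def sum_distrib_left by (intro sum.cong refl) (simp add: mult_ac)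
    finally show ?thesis .
  qed
  have int_A: "integrable lborel (\<lambda>x. indicator {0..1} x * (\<phi> x * A x))"
    unfolding \<phi>A using int_i by (intro Bochner_Integration.integrable_sum integrable_mult_right)
  have int_g: "integrable lborel (\<lambda>x. indicator {0..1} x * (\<phi> x * g x))"
  proof (rule continuous_bounded_integrable)
    show "\<bar>\<phi> x * g x\<bar> \<le> B * G" for x unfolding abs_mult using B G B0 by (intro mult_mono) auto
  qed auto
  have LA: "(\<integral>x. indicator {0..1} x * (\<phi> x * A x) \<partial>lborel) = 1 / real N * (\<Sum>i\<in>{1..int N}. ?c i * a i)"
  proof -
    have "(\<integral>x. indicator {0..1} x * (\<phi> x * A x) \<partial>lborel) = (\<Sum>i\<in>{1..int N}. \<integral>x. a i / (2 * real N * \<epsilon>) * (indicator (near_set (?y i) \<epsilon>) x * \<phi> x) \<partial>lborel)"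
      unfolding \<phi>A by (intro Bochner_Integration.integral_sum integrable_mult_right int_i)
    also have "\<dots> = (\<Sum>i\<in>{1..int N}. 1 / real N * (?c i * a i))"
    proof (rule sum.cong[OF refl])
      fix i
      have "x / (2 * n * e) * I = 1 / n * (I / (2 * e) * x)" for x n e I :: real by (simp add: mult_ac)
      then show "(\<integral>x. a i / (2 * real N * \<epsilon>) * (indicator (near_set (?y i) \<epsilon>) x * \<phi> x) \<partial>lborel) = 1 / real N * (?c i * a i)"
        unfolding integral_mult_right_zero .
    qed
    finally show ?thesis by (simp only: sum_distrib_left)
  qed
  have Lg: "(LBINT x:{0..1}. \<phi> x * g x) = (\<integral>x. indicator {0..1} x * (\<phi> x * g x) \<partial>lborel)"
    by (simp add: set_lebesgue_integral_def)
  have 1: "\<bar>?S - 1 / real N * (\<Sum>i\<in>{1..int N}. ?c i * a i)\<bar> \<le> \<eta> * (1 / real N * (\<Sum>i\<in>{1..int N}. \<bar>a i\<bar>))"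
  proof -
    define c where "c = ?c"
    have "?S - 1 / real N * (\<Sum>i\<in>{1..int N}. c i * a i) = 1 / real N * (\<Sum>i\<in>{1..int N}. (\<phi> (?y i) - c i) * a i)"
      by (simp add: sum_subtractf left_diff_distrib right_diff_distrib)
    then have "\<bar>?S - 1 / real N * (\<Sum>i\<in>{1..int N}. c i * a i)\<bar> = 1 / real N * \<bar>\<Sum>i\<in>{1..int N}. (\<phi> (?y i) - c i) * a i\<bar>"
      by (simp add: abs_mult)
    also have "\<dots> \<le> 1 / real N * (\<Sum>i\<in>{1..int N}. \<eta> * \<bar>a i\<bar>)"
    proof (rule mult_left_mono[OF order_trans[OF sum_abs sum_mono]])
      fix i assume i: "i \<in> {1..int N}"
      have "\<bar>c i - \<phi> (?y i)\<bar> \<le> \<eta>"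
        unfolding c_def by (rule near_set_average[OF _ _ \<epsilon> \<phi> \<eta>]) (use i N in \<open>auto simp: field_simps\<close>)
      then show "\<bar>(\<phi> (?y i) - c i) * a i\<bar> \<le> \<eta> * \<bar>a i\<bar>"
        unfolding abs_mult by (intro mult_right_mono) (auto simp: abs_minus_commute)
    qed simp
    finally show ?thesis unfolding c_def by (simp add: sum_distrib_left mult_ac)
  qed
  have 2: "ennreal \<bar>1 / real N * (\<Sum>i\<in>{1..int N}. ?c i * a i) - (LBINT x:{0..1}. \<phi> x * g x)\<bar>
     \<le> ennreal B * (\<integral>\<^sup>+x. indicator {0..1} x * ennreal \<bar>wavg a N x \<epsilon> - g x\<bar> \<partial>lborel)"
  proof -
    have "ennreal \<bar>1 / real N * (\<Sum>i\<in>{1..int N}. ?c i * a i) - (LBINT x:{0..1}. \<phi> x * g x)\<bar>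
       = ennreal (norm (\<integral>x. indicator {0..1} x * (\<phi> x * A x) - indicator {0..1} x * (\<phi> x * g x) \<partial>lborel))"
      using int_A int_g LA Lg by (simp add: Bochner_Integration.integral_diff)
    also have "\<dots> \<le> (\<integral>\<^sup>+x. ennreal (norm (indicator {0..1} x * (\<phi> x * A x) - indicator {0..1} x * (\<phi> x * g x))) \<partial>lborel)"
      by (rule integral_norm_bound_ennreal) (use int_A int_g in auto)
    also have "\<dots> \<le> (\<integral>\<^sup>+x. ennreal B * (indicator {0..1} x * ennreal \<bar>A x - g x\<bar>) \<partial>lborel)"
    proof (rule nn_integral_mono)
      fix x :: real
      have "\<bar>\<phi> x * A x - \<phi> x * g x\<bar> = \<bar>\<phi> x\<bar> * \<bar>A x - g x\<bar>" by (simp add: right_diff_distrib[symmetric] abs_mult)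
      also have "\<dots> \<le> B * \<bar>A x - g x\<bar>" using B by (intro mult_right_mono) auto
      finally show "ennreal (norm (indicator {0..1} x * (\<phi> x * A x) - indicator {0..1} x * (\<phi> x * g x))) \<le> ennreal B * (indicator {0..1} x * ennreal \<bar>A x - g x\<bar>)"
        using B0 by (auto simp: ennreal_mult[symmetric] split: split_indicator)
    qed
    also have "\<dots> = ennreal B * (\<integral>\<^sup>+x. indicator {0..1} x * ennreal \<bar>A x - g x\<bar> \<partial>lborel)"
      by (rule nn_integral_cmult) measurable
    also have "(\<integral>\<^sup>+x. indicator {0..1} x * ennreal \<bar>A x - g x\<bar> \<partial>lborel) = (\<integral>\<^sup>+x. indicator {0..1} x * ennreal \<bar>wavg a N x \<epsilon> - g x\<bar> \<partial>lborel)"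
      by (rule nn_integral_cong) (auto simp: A_def wavg_near_set split: split_indicator)
    finally show ?thesis .
  qed
  have "ennreal \<bar>?S - (LBINT x:{0..1}. \<phi> x * g x)\<bar> \<le> ennreal (\<bar>?S - 1 / real N * (\<Sum>i\<in>{1..int N}. ?c i * a i)\<bar> + \<bar>1 / real N * (\<Sum>i\<in>{1..int N}. ?c i * a i) - (LBINT x:{0..1}. \<phi> x * g x)\<bar>)"
    by (rule ennreal_leI) linarith
  also have "\<dots> = ennreal \<bar>?S - 1 / real N * (\<Sum>i\<in>{1..int N}. ?c i * a i)\<bar> + ennreal \<bar>1 / real N * (\<Sum>i\<in>{1..int N}. ?c i * a i) - (LBINT x:{0..1}. \<phi> x * g x)\<bar>"
    by (rule ennreal_plus) auto
  also have "\<dots> \<le> ennreal (\<eta> * (1 / real N * (\<Sum>i\<in>{1..int N}. \<bar>a i\<bar>))) + ennreal B * (\<integral>\<^sup>+x. indicator {0..1} x * ennreal \<bar>wavg a N x \<epsilon> - g x\<bar> \<partial>lborel)"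
    by (intro add_mono ennreal_leI 1 2)
  also have "ennreal (\<eta> * (1 / real N * (\<Sum>i\<in>{1..int N}. \<bar>a i\<bar>))) = ennreal \<eta> * (ennreal (1 / real N) * (\<Sum>i\<in>{1..int N}. ennreal \<bar>a i\<bar>))"
    using \<eta>0 by (simp add: ennreal_mult[symmetric] sum_nonneg)
  finally show ?thesis .
qed

text \<open>
  Fix \<open>\<epsilon>\<close> and let \<open>N\<close> grow: by Tonelli's theorem and the reverse Fatou lemma the mean of the second
  error term of the preceding lemma is asymptotically at most the integral over \<open>x\<close> of the mesoscopic
  errors. A window contains at most a multiple of \<open>2 N \<epsilon>\<close> sites for large \<open>N\<close>, so these errors are bounded
  independently of \<open>\<epsilon>\<close>, and dominated convergence applies as \<open>\<epsilon>\<close> tends to zero.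
\<close>
theorem mesoscopic_average:
  fixes a :: "nat \<Rightarrow> 'a \<Rightarrow> int \<Rightarrow> real"
  assumes ps: "\<And>N. N \<ge> 1 \<Longrightarrow> prob_space (M N)"
    and meas: "\<And>N i. N \<ge> 1 \<Longrightarrow> i \<in> {1..int N} \<Longrightarrow> (\<lambda>\<omega>. a N \<omega> i) \<in> borel_measurable (M N)"
    and bound: "\<And>N i. N \<ge> 1 \<Longrightarrow> i \<in> {1..int N} \<Longrightarrow> (\<integral>\<^sup>+\<omega>. ennreal \<bar>a N \<omega> i\<bar> \<partial>M N) \<le> ennreal C" and C: "0 \<le> C"
    and g: "periodic_fun_simple' g" "continuous_on UNIV g"
    and \<phi>: "periodic_fun_simple' \<phi>" "continuous_on UNIV \<phi>"
    and meso: "\<And>x. ((\<lambda>\<epsilon>. limsup (\<lambda>N. \<integral>\<^sup>+\<omega>. ennreal \<bar>wavg (a N \<omega>) N x \<epsilon> - g x\<bar> \<partial>M N)) \<longlongrightarrow> 0) (at_right 0)"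
  shows "(\<lambda>N. \<integral>\<^sup>+\<omega>. ennreal \<bar>1 / real N * (\<Sum>i\<in>{1..int N}. \<phi> (grid N i) * a N \<omega> i) - (LBINT x:{0..1}. \<phi> x * g x)\<bar> \<partial>M N) \<longlonglongrightarrow> 0"
proof (rule ennreal_tendsto_0I)
  fix \<delta> :: real assume \<delta>: "0 < \<delta>"
  obtain B where B: "0 \<le> B" "\<And>x. \<bar>\<phi> x\<bar> \<le> B" using periodic_continuous_bounded[OF \<phi>] by blast
  obtain G where G: "0 \<le> G" "\<And>x. \<bar>g x\<bar> \<le> G" using periodic_continuous_bounded[OF g] by blast
  have [measurable]: "g \<in> borel_measurable borel" using g(2) by (rule borel_measurable_continuous_onI)
  \<comment> \<open>Nothing is known about \<open>M 0\<close>; the value 0 keeps \<open>u\<close> measurable and bounded for every \<open>N\<close>.\<close>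
  define u where "u \<epsilon> N x = (if N = 0 then 0 else indicator {0..1} x * (\<integral>\<^sup>+\<omega>. ennreal \<bar>wavg (a N \<omega>) N x \<epsilon> - g x\<bar> \<partial>M N))" for \<epsilon> N and x :: real
  define E where "E N = (\<integral>\<^sup>+\<omega>. ennreal \<bar>1 / real N * (\<Sum>i\<in>{1..int N}. \<phi> (grid N i) * a N \<omega> i) - (LBINT x:{0..1}. \<phi> x * g x)\<bar> \<partial>M N)" for N
  have joint: "(\<lambda>z. indicator {0..1} (fst z) * ennreal \<bar>wavg (a N (snd z)) N (fst z) \<epsilon> - g (fst z)\<bar>) \<in> borel_measurable (lborel \<Otimes>\<^sub>M M N)" if N: "N \<ge> 1" for N \<epsilon>
  proof -
    have [measurable]: "(\<lambda>z. a N (snd z) i) \<in> borel_measurable (lborel \<Otimes>\<^sub>M M N)" if "i \<in> {1..int N}" for i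
      using measurable_compose[OF measurable_snd meas[OF N that]] .
    have "(\<lambda>z. indicator {0..1} (fst z) * ennreal \<bar>1 / (2 * real N * \<epsilon>) * (\<Sum>i\<in>{1..int N}. a N (snd z) i * indicator (near_set (grid N i) \<epsilon>) (fst z)) - g (fst z)\<bar>) \<in> borel_measurable (lborel \<Otimes>\<^sub>M M N)"
      by measurable
    also have "(\<lambda>z. indicator {0..1} (fst z) * ennreal \<bar>1 / (2 * real N * \<epsilon>) * (\<Sum>i\<in>{1..int N}. a N (snd z) i * indicator (near_set (grid N i) \<epsilon>) (fst z)) - g (fst z)\<bar>)
       = (\<lambda>z. indicator {0..1} (fst z) * ennreal \<bar>wavg (a N (snd z)) N (fst z) \<epsilon> - g (fst z)\<bar>)"
      by (auto simp: wavg_near_set fun_eq_iff split: split_indicator)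
    finally show ?thesis .
  qed
  have wavg_meas: "(\<lambda>\<omega>. wavg (a N \<omega>) N x \<epsilon>) \<in> borel_measurable (M N)" if "N \<ge> 1" for N x \<epsilon>
    unfolding wavg_def using meas[OF that] window_subset
    by (intro borel_measurable_times borel_measurable_const borel_measurable_sum) blast
  have u_meas[measurable]: "u \<epsilon> N \<in> borel_measurable lborel" for \<epsilon> N
  proof (cases "N = 0")
    case False
    then interpret prob_space "M N" by (intro ps) simp
    have "(\<lambda>x. \<integral>\<^sup>+\<omega>. indicator {0..1} x * ennreal \<bar>wavg (a N \<omega>) N x \<epsilon> - g x\<bar> \<partial>M N) \<in> borel_measurable lborel"
      using joint[of N \<epsilon>] False by (intro borel_measurable_nn_integral) (simp add: case_prod_beta')
    also have "(\<lambda>x. \<integral>\<^sup>+\<omega>. indicator {0..1} x * ennreal \<bar>wavg (a N \<omega>) N x \<epsilon> - g x\<bar> \<partial>M N) = u \<epsilon> N"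
      using False by (auto simp: u_def fun_eq_iff split: split_indicator)
    finally show ?thesis .
  qed (simp add: u_def[abs_def])
  have E_le: "E N \<le> ennreal (\<eta> * C) + ennreal B * (\<integral>\<^sup>+x. u \<epsilon> N x \<partial>lborel)"
    if N: "N \<ge> 1" and \<epsilon>: "0 < \<epsilon>" "\<epsilon> < 1 / 2" and \<eta>: "\<And>u v. \<bar>u - v\<bar> \<le> \<epsilon> \<Longrightarrow> \<bar>\<phi> u - \<phi> v\<bar> \<le> \<eta>" for N \<epsilon> \<eta>
  proof -
    interpret prob_space "M N" by (rule ps[OF N])
    interpret P: pair_sigma_finite lborel "M N" ..
    have \<eta>0: "0 \<le> \<eta>" using \<eta>[of 0 0] \<epsilon> by simp
    note [measurable] = meas[OF N]
    let ?W = "\<lambda>\<omega>. \<integral>\<^sup>+x. indicator {0..1} x * ennreal \<bar>wavg (a N \<omega>) N x \<epsilon> - g x\<bar> \<partial>lborel"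
    have W_meas[measurable]: "?W \<in> borel_measurable (M N)"
      using joint[OF N, of \<epsilon>] by (intro sigma_finite_measure.borel_measurable_nn_integral[OF sigma_finite_lborel])
        (subst measurable_pair_swap_iff, simp add: case_prod_beta')
    have "E N \<le> (\<integral>\<^sup>+\<omega>. ennreal \<eta> * (ennreal (1 / real N) * (\<Sum>i\<in>{1..int N}. ennreal \<bar>a N \<omega> i\<bar>)) + ennreal B * ?W \<omega> \<partial>M N)"
      unfolding E_def by (intro nn_integral_mono smoothed_sum_bound[OF N \<epsilon> \<phi> B(2) g \<eta>])
    also have "\<dots> = ennreal \<eta> * (ennreal (1 / real N) * (\<Sum>i\<in>{1..int N}. \<integral>\<^sup>+\<omega>. ennreal \<bar>a N \<omega> i\<bar> \<partial>M N)) + ennreal B * (\<integral>\<^sup>+\<omega>. ?W \<omega> \<partial>M N)"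
      by (simp add: nn_integral_add nn_integral_cmult nn_integral_sum del: sum_ennreal)
    also have "\<dots> \<le> ennreal \<eta> * (ennreal (1 / real N) * (\<Sum>i\<in>{1..int N}. ennreal C)) + ennreal B * (\<integral>\<^sup>+\<omega>. ?W \<omega> \<partial>M N)"
      by (intro add_mono mult_left_mono sum_mono bound[OF N] order_refl) auto
    also have "ennreal \<eta> * (ennreal (1 / real N) * (\<Sum>i\<in>{1..int N}. ennreal C)) = ennreal (\<eta> * C)"
    proof -
      have "(\<Sum>i\<in>{1..int N}. ennreal C) = ennreal (\<Sum>i\<in>{1..int N}. C)" using C by (subst sum_ennreal) auto
      then show ?thesis using \<eta>0 C N by (simp add: ennreal_mult[symmetric])
    qed
    also have "(\<integral>\<^sup>+\<omega>. ?W \<omega> \<partial>M N) = (\<integral>\<^sup>+x. (\<integral>\<^sup>+\<omega>. indicator {0..1} x * ennreal \<bar>wavg (a N \<omega>) N x \<epsilon> - g x\<bar> \<partial>M N) \<partial>lborel)"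
      using joint[OF N, of \<epsilon>] by (intro P.Fubini') (simp add: case_prod_beta')
    also have "\<dots> = (\<integral>\<^sup>+x. u \<epsilon> N x \<partial>lborel)"
      by (rule nn_integral_cong) (use N in \<open>auto simp: u_def split: split_indicator\<close>)
    finally show ?thesis .
  qed
  have u_le: "u \<epsilon> N x \<le> ennreal (real (card (window N x \<epsilon>)) / (2 * real N * \<epsilon>) * C + G) * indicator {0..1} x" if \<epsilon>: "0 < \<epsilon>" for \<epsilon> N x
  proof (cases "N = 0")
    case False
    then have N: "N \<ge> 1" by simp
    interpret prob_space "M N" by (rule ps[OF N])
    note [measurable] = meas[OF N]
    have iw: "i \<in> {1..int N}" if "i \<in> window N x \<epsilon>" for i using that window_subset by blast
    have am: "(\<lambda>\<omega>. ennreal \<bar>a N \<omega> i\<bar>) \<in> borel_measurable (M N)" if "i \<in> window N x \<epsilon>" for i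
      using meas[OF N iw[OF that]] by measurable
    have "(\<integral>\<^sup>+\<omega>. ennreal \<bar>wavg (a N \<omega>) N x \<epsilon> - g x\<bar> \<partial>M N) \<le> (\<integral>\<^sup>+\<omega>. ennreal (1 / (2 * real N * \<epsilon>)) * (\<Sum>i\<in>window N x \<epsilon>. ennreal \<bar>a N \<omega> i\<bar>) + ennreal G \<partial>M N)"
    proof (rule nn_integral_mono)
      fix \<omega>
      have "\<bar>wavg (a N \<omega>) N x \<epsilon> - g x\<bar> \<le> \<bar>wavg (a N \<omega>) N x \<epsilon>\<bar> + G" using G(2)[of x] by linarith
      also have "\<bar>wavg (a N \<omega>) N x \<epsilon>\<bar> \<le> 1 / (2 * real N * \<epsilon>) * (\<Sum>i\<in>window N x \<epsilon>. \<bar>a N \<omega> i\<bar>)"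
        unfolding wavg_def abs_mult using \<epsilon> by (intro mult_mono sum_abs) auto
      finally have "ennreal \<bar>wavg (a N \<omega>) N x \<epsilon> - g x\<bar> \<le> ennreal (1 / (2 * real N * \<epsilon>) * (\<Sum>i\<in>window N x \<epsilon>. \<bar>a N \<omega> i\<bar>) + G)"
        by (intro ennreal_leI) simp
      also have "\<dots> = ennreal (1 / (2 * real N * \<epsilon>)) * (\<Sum>i\<in>window N x \<epsilon>. ennreal \<bar>a N \<omega> i\<bar>) + ennreal G"
        using \<epsilon> G(1) by (subst ennreal_plus) (auto simp: ennreal_mult[symmetric] sum_nonneg simp del: ennreal_plus)
      finally show "ennreal \<bar>wavg (a N \<omega>) N x \<epsilon> - g x\<bar> \<le> ennreal (1 / (2 * real N * \<epsilon>)) * (\<Sum>i\<in>window N x \<epsilon>. ennreal \<bar>a N \<omega> i\<bar>) + ennreal G" .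
    qed
    also have "\<dots> = ennreal (1 / (2 * real N * \<epsilon>)) * (\<Sum>i\<in>window N x \<epsilon>. \<integral>\<^sup>+\<omega>. ennreal \<bar>a N \<omega> i\<bar> \<partial>M N) + ennreal G"
      using am by (simp add: nn_integral_add nn_integral_cmult nn_integral_sum emeasure_space_1 del: sum_ennreal)
    also have "\<dots> \<le> ennreal (1 / (2 * real N * \<epsilon>)) * (\<Sum>i\<in>window N x \<epsilon>. ennreal C) + ennreal G"
      by (intro add_mono mult_left_mono sum_mono bound[OF N] iw order_refl) auto
    also have "(\<Sum>i\<in>window N x \<epsilon>. ennreal C) = ennreal (\<Sum>i\<in>window N x \<epsilon>. C)" using C by (subst sum_ennreal) auto
    also have "ennreal (1 / (2 * real N * \<epsilon>)) * ennreal (\<Sum>i\<in>window N x \<epsilon>. C) + ennreal G = ennreal (1 / (2 * real N * \<epsilon>) * (\<Sum>i\<in>window N x \<epsilon>. C) + G)"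
      using \<epsilon> C G(1) by (subst ennreal_plus) (auto simp: ennreal_mult[symmetric] sum_nonneg ennreal_of_nat_eq_real_of_nat simp del: ennreal_plus)
    also have "1 / (2 * real N * \<epsilon>) * (\<Sum>i\<in>window N x \<epsilon>. C) + G = real (card (window N x \<epsilon>)) / (2 * real N * \<epsilon>) * C + G" by simp
    finally show ?thesis using False by (auto simp: u_def split: split_indicator)
  qed (simp add: u_def)
  let ?L = "\<lambda>\<epsilon> x. limsup (\<lambda>N. u \<epsilon> N x)"
  have fatou: "limsup (\<lambda>N. \<integral>\<^sup>+x. u \<epsilon> N x \<partial>lborel) \<le> (\<integral>\<^sup>+x. ?L \<epsilon> x \<partial>lborel)" if \<epsilon>: "0 < \<epsilon>" for \<epsilon>
  proof (rule nn_integral_limsup)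
    let ?w = "\<lambda>x. ennreal (1 / (2 * \<epsilon>) * C + G) * indicator {0..1::real} x"
    show "(\<integral>\<^sup>+x. ?w x \<partial>lborel) < \<infinity>" by (simp add: nn_integral_cmult_indicator ennreal_mult_less_top)
    show "AE x in lborel. u \<epsilon> N x \<le> ?w x" for N
    proof (rule AE_I2)
      fix x
      have "card (window N x \<epsilon>) \<le> N" using card_mono[OF _ window_subset[of N x \<epsilon>]] by simp
      then have "real (card (window N x \<epsilon>)) / (2 * real N * \<epsilon>) \<le> 1 / (2 * \<epsilon>)"
        using \<epsilon> by (cases "N = 0") (auto simp: field_simps)
      then have "real (card (window N x \<epsilon>)) / (2 * real N * \<epsilon>) * C \<le> 1 / (2 * \<epsilon>) * C"
        using C by (rule mult_right_mono)
      then have "ennreal (real (card (window N x \<epsilon>)) / (2 * real N * \<epsilon>) * C + G) \<le> ennreal (1 / (2 * \<epsilon>) * C + G)"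
        by (intro ennreal_leI) simp
      then show "u \<epsilon> N x \<le> ?w x" by (intro order_trans[OF u_le[OF \<epsilon>, of N x]] mult_right_mono) auto
    qed
  qed auto
  have L_le: "?L \<epsilon> x \<le> ennreal (5 * C + G) * indicator {0..1} x" if \<epsilon>: "0 < \<epsilon>" "\<epsilon> < 1 / 2" for \<epsilon> x
  proof (rule Limsup_bounded)
    obtain n :: nat where n: "1 / \<epsilon> \<le> real n" using real_arch_simple by blast
    show "eventually (\<lambda>N. u \<epsilon> N x \<le> ennreal (5 * C + G) * indicator {0..1} x) sequentially"
      using eventually_ge_at_top[of "max 1 n"]
    proof eventually_elim
      case (elim N)
      then have N: "N \<ge> 1" and nN: "1 / \<epsilon> \<le> real N" using n by auto
      show ?case
      proof (cases "x \<in> {0..1}")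
        case True
        have "1 \<le> real N * \<epsilon>" using nN \<epsilon> by (simp add: field_simps)
        moreover have "c \<le> 5 * (2 * p)" if "1 \<le> p" "c \<le> 3 * (2 * p + 1)" for c p :: real
          using that by (simp add: algebra_simps)
        ultimately have "real (card (window N x \<epsilon>)) \<le> 5 * (2 * real N * \<epsilon>)"
          using card_window[OF True \<epsilon> N] unfolding mult.assoc by blast
        then have "real (card (window N x \<epsilon>)) / (2 * real N * \<epsilon>) \<le> 5" using N \<epsilon> by (simp add: divide_le_eq)
        then have "real (card (window N x \<epsilon>)) / (2 * real N * \<epsilon>) * C \<le> 5 * C" using C by (rule mult_right_mono)
        then have "ennreal (real (card (window N x \<epsilon>)) / (2 * real N * \<epsilon>) * C + G) \<le> ennreal (5 * C + G)" by (intro ennreal_leI) simp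
        then show ?thesis by (intro order_trans[OF u_le[OF \<epsilon>(1), of N x]] mult_right_mono) auto
      qed (simp add: u_def)
    qed
  qed
  \<comment> \<open>A sequence of window radii; the offset keeps them below \<open>1/2\<close>.\<close>
  define e where "e k = 1 / real (k + 3)" for k :: nat
  have e: "0 < e k" "e k < 1 / 2" for k by (auto simp: e_def field_simps)
  have e_lim: "filterlim e (at_right 0) sequentially"
  proof (rule tendsto_imp_filterlim_at_right)
    have "(\<lambda>k. 1 / real (k + 3)) \<longlonglongrightarrow> 0" using LIMSEQ_ignore_initial_segment[OF lim_1_over_n, of 3] .
    then show "e \<longlonglongrightarrow> 0" by (simp add: e_def[abs_def])
  qed (use e in simp)
  have L_lim: "(\<lambda>k. \<integral>\<^sup>+x. ?L (e k) x \<partial>lborel) \<longlonglongrightarrow> (\<integral>\<^sup>+x. 0 \<partial>(lborel :: real measure))"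
  proof (rule nn_integral_dominated_convergence)
    let ?w = "\<lambda>x. ennreal (5 * C + G) * indicator {0..1::real} x"
    show "(\<integral>\<^sup>+x. ?w x \<partial>lborel) < \<infinity>" by (simp add: nn_integral_cmult_indicator ennreal_mult_less_top)
    show "AE x in lborel. ?L (e k) x \<le> ?w x" for k using L_le[OF e] by auto
    show "AE x in lborel. (\<lambda>k. ?L (e k) x) \<longlonglongrightarrow> 0"
    proof (rule AE_I2)
      fix x :: real
      show "(\<lambda>k. ?L (e k) x) \<longlonglongrightarrow> 0"
      proof (cases "x \<in> {0..1}")
        case True
        have "?L \<epsilon> x = limsup (\<lambda>N. \<integral>\<^sup>+\<omega>. ennreal \<bar>wavg (a N \<omega>) N x \<epsilon> - g x\<bar> \<partial>M N)" for \<epsilon>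
          by (rule Limsup_eq, rule eventually_mono[OF eventually_ge_at_top[of 1]]) (use True in \<open>simp add: u_def\<close>)
        then show ?thesis using filterlim_compose[OF meso[of x] e_lim] by simp
      next
        case False
        then have "u \<epsilon> N x = 0" for \<epsilon> N by (simp add: u_def)
        then show ?thesis by (simp add: Limsup_const)
      qed
    qed
  qed auto
  \<comment> \<open>Half of \<open>\<delta>\<close> is allotted to the error from the modulus of continuity, half to the remaining one.\<close>
  define \<eta> where "\<eta> = \<delta> / (2 * (C + 1))"
  have \<eta>0: "0 < \<eta>" using \<delta> C by (simp add: \<eta>_def)
  obtain d where d: "0 < d" "\<And>x y. \<bar>x - y\<bar> \<le> d \<Longrightarrow> \<bar>\<phi> x - \<phi> y\<bar> \<le> \<eta>"
    using periodic_uniformly_continuous[OF \<phi> \<eta>0] by blast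
  define c where "c = \<delta> / (2 * (B + 1))"
  have c0: "0 < c" using \<delta> B(1) by (simp add: c_def)
  have "eventually (\<lambda>k. e k < d) sequentially"
    using e_lim d(1) by (auto simp: filterlim_at dest: order_tendstoD(2))
  moreover have "eventually (\<lambda>k. (\<integral>\<^sup>+x. ?L (e k) x \<partial>lborel) < ennreal c) sequentially"
    using L_lim c0 by (intro ennreal_tendsto_0D) simp_all
  ultimately have "eventually (\<lambda>k. e k < d \<and> (\<integral>\<^sup>+x. ?L (e k) x \<partial>lborel) < ennreal c) sequentially"
    by eventually_elim simp
  then obtain k where k: "e k < d" "(\<integral>\<^sup>+x. ?L (e k) x \<partial>lborel) < ennreal c"
    by (auto simp: eventually_sequentially)
  have "limsup (\<lambda>N. \<integral>\<^sup>+x. u (e k) N x \<partial>lborel) < ennreal c"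
    using fatou[OF e(1)] k(2) by (rule le_less_trans)
  from Limsup_lessD[OF this] show "eventually (\<lambda>N. E N \<le> ennreal \<delta>) sequentially"
    using eventually_ge_at_top[of 1]
  proof eventually_elim
    case (elim N)
    have "E N \<le> ennreal (\<eta> * C) + ennreal B * (\<integral>\<^sup>+x. u (e k) N x \<partial>lborel)"
      by (rule E_le[OF elim(2) e]) (use d(2) k(1) in auto)
    also have "\<dots> \<le> ennreal (\<eta> * C) + ennreal B * ennreal c"
      using elim(1) by (intro add_mono mult_left_mono) auto
    also have "\<dots> = ennreal (\<eta> * C + B * c)" using \<eta>0 C B(1) c0 by (simp add: ennreal_mult)
    also have "\<dots> \<le> ennreal \<delta>"
    proof (rule ennreal_leI)
      have "\<eta> * C \<le> \<delta> / 2" using C \<delta> by (simp add: \<eta>_def field_simps)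
      moreover have "B * c \<le> \<delta> / 2" using B(1) \<delta> by (simp add: c_def field_simps)
      ultimately show "\<eta> * C + B * c \<le> \<delta>" by simp
    qed
    finally show ?case .
  qed
qed

section \<open>Periodic antiderivatives and third differences\<close>

text \<open>
  The integral of \<open>f\<close> from 0 to \<open>x\<close>, rescaled to the unit interval. This form is correct for negative \<open>x\<close>
  as well, and it makes joint continuity in \<open>x\<close> and a parameter immediate.
\<close>
definition primitive :: "(real \<Rightarrow> real) \<Rightarrow> real \<Rightarrow> real" where
  "primitive f x = x * integral {0..1} (\<lambda>u. f (x * u))"

text \<open>
  The normalisation to mean zero keeps the antiderivative of a periodic function of mean zero in the
  same class, so that the operation can be iterated.
\<close>
definition antideriv :: "(real \<Rightarrow> real) \<Rightarrow> real \<Rightarrow> real" where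
  "antideriv f x = primitive f x - integral {0..1} (primitive f)"

lemma continuous_integrable_unit:
  fixes f :: "real \<Rightarrow> real"
  assumes "continuous_on UNIV f"
  shows "f integrable_on {0..1}"
  by (intro integrable_continuous_real continuous_on_subset[OF assms]) simp

lemma differentiable_continuous_UNIV:
  assumes "\<And>x. (f has_real_derivative f' x) (at x)"
  shows "continuous_on UNIV f"
  by (rule continuous_at_imp_continuous_on) (use DERIV_isCont[OF assms] in blast)

lemma primitive_has_derivative:
  assumes f: "continuous_on UNIV f"
  shows "(primitive f has_real_derivative f x) (at x)"
proof -
  have "\<exists>F. \<forall>x :: real. - \<infinity> < ereal x \<longrightarrow> ereal x < \<infinity> \<longrightarrow> (F has_vector_derivative f x) (at x)"
    using f by (intro einterval_antiderivative) (auto simp: continuous_on_eq_continuous_at)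
  then obtain F where F: "\<And>x. (F has_real_derivative f x) (at x)"
    by (auto simp: has_real_derivative_iff_has_vector_derivative)
  have "primitive f x = F x - F 0" for x
  proof -
    have "((\<lambda>u. x * f (x * u)) has_integral F (x * 1) - F (x * 0)) {0..1}"
    proof (rule fundamental_theorem_of_calculus)
      fix u :: real
      have "((\<lambda>u. F (x * u)) has_real_derivative f (x * u) * x) (at u)"
        by (rule DERIV_chain2[OF F]) (auto intro!: derivative_eq_intros)
      then show "((\<lambda>u. F (x * u)) has_vector_derivative x * f (x * u)) (at u within {0..1})"
        by (simp add: has_real_derivative_iff_has_vector_derivative has_vector_derivative_at_within mult.commute)
    qed simp
    from integral_unique[OF this] show ?thesis by (simp add: primitive_def)
  qed
  then have "primitive f = (\<lambda>x. F x - F 0)" by auto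
  moreover have "((\<lambda>x. F x - F 0) has_real_derivative f x - 0) (at x)" by (intro DERIV_diff F DERIV_const)
  ultimately show ?thesis by simp
qed

lemma antideriv_has_derivative:
  assumes "continuous_on UNIV f"
  shows "(antideriv f has_real_derivative f x) (at x)"
proof -
  have "((\<lambda>x. primitive f x - integral {0..1} (primitive f)) has_real_derivative f x - 0) (at x)"
    by (intro DERIV_diff primitive_has_derivative assms DERIV_const)
  then show ?thesis by (simp add: antideriv_def[abs_def])
qed

lemma antideriv_continuous: "continuous_on UNIV f \<Longrightarrow> continuous_on UNIV (antideriv f)"
  by (rule differentiable_continuous_UNIV[OF antideriv_has_derivative])

lemma primitive_continuous: "continuous_on UNIV f \<Longrightarrow> continuous_on UNIV (primitive f)"
  by (rule differentiable_continuous_UNIV[OF primitive_has_derivative])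

lemma antideriv_mean: "continuous_on UNIV f \<Longrightarrow> integral {0..1} (antideriv f) = 0"
proof -
  assume f: "continuous_on UNIV f"
  have "primitive f integrable_on {0..1}"
    by (intro continuous_integrable_unit primitive_continuous f)
  then have "integral {0..1} (\<lambda>x. primitive f x - integral {0..1} (primitive f)) = integral {0..1} (primitive f) - integral {0..1} (primitive f)"
    by (subst integral_diff) auto
  then show ?thesis by (simp add: antideriv_def[abs_def])
qed

text \<open>
  The increment of the primitive over a unit interval has derivative zero, hence equals the integral of
  \<open>f\<close> over one period.
\<close>
lemma antideriv_periodic:
  assumes f: "continuous_on UNIV f" and p: "periodic_fun_simple' f" and m: "integral {0..1} f = 0"
  shows "periodic_fun_simple' (antideriv f)"
proof -
  have "((\<lambda>x. primitive f (x + 1) - primitive f x) has_real_derivative 0) (at x)" for x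
  proof -
    have "((\<lambda>x. primitive f (x + 1)) has_real_derivative f (x + 1) * 1) (at x)"
      by (rule DERIV_chain2[OF primitive_has_derivative[OF f]]) (auto intro!: derivative_eq_intros)
    from DERIV_diff[OF this primitive_has_derivative[OF f]] show ?thesis
      using p by (simp add: periodic_fun_simple'_def)
  qed
  then have "primitive f (x + 1) - primitive f x = primitive f (0 + 1) - primitive f 0" for x
    using DERIV_isconst_all[of "\<lambda>x. primitive f (x + 1) - primitive f x" x 0] by blast
  moreover have "primitive f 1 = 0" "primitive f 0 = 0" using m by (simp_all add: primitive_def)
  ultimately show ?thesis by (simp add: periodic_fun_simple'_def antideriv_def)
qed

lemma integral_by_parts_periodic:
  fixes f g :: "real \<Rightarrow> real"
  assumes f: "periodic_fun_simple' f" "\<And>x. (f has_real_derivative f' x) (at x)" "continuous_on UNIV f'"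
    and g: "periodic_fun_simple' g" "\<And>x. (g has_real_derivative g' x) (at x)" "continuous_on UNIV g'"
  shows "integral {0..1} (\<lambda>x. f' x * g x) = - integral {0..1} (\<lambda>x. f x * g' x)"
proof -
  have fc: "continuous_on UNIV f" "continuous_on UNIV g"
    by (rule differentiable_continuous_UNIV[OF f(2)], rule differentiable_continuous_UNIV[OF g(2)])
  have "((\<lambda>x. f' x * g x + f x * g' x) has_integral f 1 * g 1 - f 0 * g 0) {0..1}"
  proof (rule fundamental_theorem_of_calculus)
    fix x :: real
    have "((\<lambda>x. f x * g x) has_real_derivative f' x * g x + g' x * f x) (at x)" by (rule DERIV_mult[OF f(2) g(2)])
    then show "((\<lambda>x. f x * g x) has_vector_derivative f' x * g x + f x * g' x) (at x within {0..1})"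
      by (simp add: has_real_derivative_iff_has_vector_derivative has_vector_derivative_at_within mult.commute)
  qed simp
  moreover have "f 1 = f 0" "g 1 = g 0" using f(1) g(1) unfolding periodic_fun_simple'_def by (metis add_0)+
  ultimately have "integral {0..1} (\<lambda>x. f' x * g x + f x * g' x) = 0" by (simp add: integral_unique)
  moreover have "(\<lambda>x. f' x * g x) integrable_on {0..1}" "(\<lambda>x. f x * g' x) integrable_on {0..1}"
    by (intro continuous_integrable_unit continuous_on_mult f(3) g(3) fc)+
  ultimately show ?thesis by (simp add: integral_add)
qed

lemma LBINT_eq_integral:
  fixes f :: "real \<Rightarrow> real"
  assumes "continuous_on UNIV f"
  shows "(LBINT x:{0..1}. f x) = integral {0..1} f"
  using assms by (intro set_borel_integral_eq_integral borel_integrable_atLeastAtMost') (auto intro: continuous_on_subset)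

lemma third_antideriv:
  assumes c: "continuous_on UNIV f" and p: "periodic_fun_simple' f" and m: "integral {0..1} f = 0"
  defines "F \<equiv> antideriv (antideriv (antideriv f))"
  shows "periodic_fun_simple' (antideriv f)" "periodic_fun_simple' (antideriv (antideriv f))" "periodic_fun_simple' F"
    and "continuous_on UNIV (antideriv f)" "continuous_on UNIV (antideriv (antideriv f))" "continuous_on UNIV F"
  unfolding F_def by (intro antideriv_periodic antideriv_continuous antideriv_mean c p m)+

text \<open>
  Integration is antisymmetric with respect to the pairing of periodic functions of mean zero, and it is
  moved across three times.
\<close>
lemma third_antideriv_swap:
  assumes f: "continuous_on UNIV f" "periodic_fun_simple' f" "integral {0..1} f = 0"
    and g: "continuous_on UNIV g" "periodic_fun_simple' g" "integral {0..1} g = 0"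
  shows "integral {0..1} (\<lambda>x. f x * antideriv (antideriv (antideriv g)) x) = - integral {0..1} (\<lambda>x. antideriv (antideriv (antideriv f)) x * g x)"
proof -
  note F = third_antideriv[OF f] and G = third_antideriv[OF g]
  note d = antideriv_has_derivative
  have "integral {0..1} (\<lambda>x. f x * antideriv (antideriv (antideriv g)) x) = - integral {0..1} (\<lambda>x. antideriv f x * antideriv (antideriv g) x)"
    by (intro integral_by_parts_periodic F G d f g)
  also have "integral {0..1} (\<lambda>x. antideriv f x * antideriv (antideriv g) x) = - integral {0..1} (\<lambda>x. antideriv (antideriv f) x * antideriv g x)"
    by (intro integral_by_parts_periodic F G d f g)
  also have "integral {0..1} (\<lambda>x. antideriv (antideriv f) x * antideriv g x) = - integral {0..1} (\<lambda>x. antideriv (antideriv (antideriv f)) x * g x)"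
    by (intro integral_by_parts_periodic F G d f g)
  finally show ?thesis by simp
qed

text \<open>
  The mean value theorem, applied to successive differences.
\<close>
lemma third_difference_mean_value:
  fixes F :: "real \<Rightarrow> real"
  assumes F: "\<And>x. (F has_real_derivative F1 x) (at x)" "\<And>x. (F1 has_real_derivative F2 x) (at x)" "\<And>x. (F2 has_real_derivative F3 x) (at x)"
    and d: "0 < d"
  shows "\<exists>z. x < z \<and> z < x + 3 * d \<and> F (x + 3 * d) - 3 * F (x + 2 * d) + 3 * F (x + d) - F x = d ^ 3 * F3 z"
proof -
  have shift: "((\<lambda>x. G (x + c)) has_real_derivative G' (x + c)) (at x)" if "\<And>x. (G has_real_derivative G' x) (at x)" for G G' :: "real \<Rightarrow> real" and c x
  proof -
    have "((\<lambda>x. x + c) has_real_derivative 1) (at x)" by (auto intro!: derivative_eq_intros)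
    from DERIV_chain2[where f = G and g = "\<lambda>x. x + c", OF that this] show ?thesis by simp
  qed
  have 1: "((\<lambda>y. F (y + 2 * d) - 2 * F (y + d) + F y) has_real_derivative F1 (y + 2 * d) - 2 * F1 (y + d) + F1 y) (at y)" for y
    by (intro DERIV_add DERIV_diff DERIV_cmult shift F)
  have 2: "((\<lambda>y. F1 (y + d) - F1 y) has_real_derivative F2 (y + d) - F2 y) (at y)" for y
    by (intro DERIV_diff shift F)
  obtain a where a: "x < a" "a < x + d" and
    A: "(F ((x + d) + 2 * d) - 2 * F ((x + d) + d) + F (x + d)) - (F (x + 2 * d) - 2 * F (x + d) + F x) = ((x + d) - x) * (F1 (a + 2 * d) - 2 * F1 (a + d) + F1 a)"
    using MVT2[of x "x + d" "\<lambda>y. F (y + 2 * d) - 2 * F (y + d) + F y" "\<lambda>y. F1 (y + 2 * d) - 2 * F1 (y + d) + F1 y"] 1 d by auto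
  obtain b where b: "a < b" "b < a + d" and
    B: "(F1 ((a + d) + d) - F1 (a + d)) - (F1 (a + d) - F1 a) = ((a + d) - a) * (F2 (b + d) - F2 b)"
    using MVT2[of a "a + d" "\<lambda>y. F1 (y + d) - F1 y" "\<lambda>y. F2 (y + d) - F2 y"] 2 d by auto
  obtain c where c: "b < c" "c < b + d" and C: "F2 (b + d) - F2 b = ((b + d) - b) * F3 c"
    using MVT2[of b "b + d" F2 F3] F d by auto
  have e: "(x + d) + 2 * d = x + 3 * d" "(x + d) + d = x + 2 * d" "(a + d) + d = a + 2 * d" by simp_all
  have "F (x + 3 * d) - 3 * F (x + 2 * d) + 3 * F (x + d) - F x = d * (F1 (a + 2 * d) - 2 * F1 (a + d) + F1 a)"
    using A unfolding e by simp
  also have "F1 (a + 2 * d) - 2 * F1 (a + d) + F1 a = d * (d * F3 c)"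
    using B C unfolding e by simp
  finally have "F (x + 3 * d) - 3 * F (x + 2 * d) + 3 * F (x + d) - F x = d ^ 3 * F3 c"
    by (simp add: power3_eq_cube mult.assoc)
  then show ?thesis using a b c by (intro exI[of _ c]) auto
qed

lemma third_diff_by_parts:
  fixes \<Phi> :: "int \<Rightarrow> real"
  assumes h: "periodic N h" and p: "periodic N \<Phi>"
  shows "(\<Sum>i\<in>{1..int N}. \<Phi> i * curv h i)
    = - (\<Sum>i\<in>{1..int N}. (\<Phi> (i + 1) - 3 * \<Phi> i + 3 * \<Phi> (i - 1) - \<Phi> (i - 2)) * real_of_int (h i))"
proof -
  let ?h = "\<lambda>i. real_of_int (h i)"
  have per: "periodic N (\<lambda>i. \<Phi> (i + a) * ?h i)" for a
    using periodicD[OF periodic_shift[OF p, of a]] periodicD[OF h] by (simp add: periodic_fun_simple_def)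
  have s: "(\<Sum>i\<in>{1..int N}. \<Phi> i * ?h (i + 2)) = (\<Sum>i\<in>{1..int N}. \<Phi> (i - 2) * ?h i)"
    "(\<Sum>i\<in>{1..int N}. \<Phi> i * ?h (i + 1)) = (\<Sum>i\<in>{1..int N}. \<Phi> (i - 1) * ?h i)"
    "(\<Sum>i\<in>{1..int N}. \<Phi> i * ?h (i - 1)) = (\<Sum>i\<in>{1..int N}. \<Phi> (i + 1) * ?h i)"
    using sum_period_shift'[OF per[of "-2"], of 2] sum_period_shift'[OF per[of "-1"], of 1] sum_period_shift_neg[OF per[of 1], of 1]
    by simp_all
  have "(\<Sum>i\<in>{1..int N}. \<Phi> i * curv h i) = (\<Sum>i\<in>{1..int N}. \<Phi> i * ?h (i + 2)) - 3 * (\<Sum>i\<in>{1..int N}. \<Phi> i * ?h (i + 1))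
     + 3 * (\<Sum>i\<in>{1..int N}. \<Phi> i * ?h i) - (\<Sum>i\<in>{1..int N}. \<Phi> i * ?h (i - 1))"
    by (simp add: third_diff_expand sum_distrib_left sum.distrib[symmetric] sum_subtractf[symmetric] algebra_simps)
  also have "\<dots> = - (\<Sum>i\<in>{1..int N}. (\<Phi> (i + 1) - 3 * \<Phi> i + 3 * \<Phi> (i - 1) - \<Phi> (i - 2)) * ?h i)"
    unfolding s by (simp add: sum_negf[symmetric] sum_distrib_left sum.distrib[symmetric] sum_subtractf[symmetric] algebra_simps)
  finally show ?thesis .
qed

text \<open>
  The four points involved lie within \<open>2 / N\<close> of \<open>i / N\<close>, which is the scale on which \<open>\<phi>\<close> has to be
  uniformly continuous.
\<close>
lemma grid_third_difference:
  fixes \<phi> :: "real \<Rightarrow> real"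
  assumes c: "continuous_on UNIV \<phi>" and p: "periodic_fun_simple' \<phi>" and N: "N \<ge> 1"
    and \<eta>: "\<And>u v. \<bar>u - v\<bar> \<le> 2 / real N \<Longrightarrow> \<bar>\<phi> u - \<phi> v\<bar> \<le> \<eta>"
  defines "m \<equiv> integral {0..1} \<phi>"
  defines "\<Phi> \<equiv> antideriv (antideriv (antideriv (\<lambda>x. \<phi> x - m)))"
  defines "D \<equiv> \<lambda>i. \<Phi> (grid N (i + 1)) - 3 * \<Phi> (grid N i) + 3 * \<Phi> (grid N (i - 1)) - \<Phi> (grid N (i - 2))"
  shows "\<bar>\<phi> (grid N i) - m - real N ^ 3 * D i\<bar> \<le> \<eta>"
proof -
  let ?\<phi> = "\<lambda>x. \<phi> x - m" and ?x = "grid N (i - 2)" and ?d = "1 / real N"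
  have c0: "continuous_on UNIV ?\<phi>" by (intro continuous_on_diff c continuous_on_const)
  have d: "0 < ?d" using N by simp
  have F: "(\<Phi> has_real_derivative antideriv (antideriv ?\<phi>) x) (at x)"
     "(antideriv (antideriv ?\<phi>) has_real_derivative antideriv ?\<phi> x) (at x)" "(antideriv ?\<phi> has_real_derivative ?\<phi> x) (at x)" for x
    unfolding \<Phi>_def by (intro antideriv_has_derivative antideriv_continuous c0)+
  obtain z where z: "?x < z" "z < ?x + 3 * ?d" and
    e: "\<Phi> (?x + 3 * ?d) - 3 * \<Phi> (?x + 2 * ?d) + 3 * \<Phi> (?x + ?d) - \<Phi> ?x = ?d ^ 3 * ?\<phi> z"
    using third_difference_mean_value[OF F d, of ?x] by blast
  have g: "?x + 3 * ?d = grid N (i + 1)" "?x + 2 * ?d = grid N i" "?x + ?d = grid N (i - 1)"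
    using N by (simp_all add: field_simps)
  have "D i = ?d ^ 3 * ?\<phi> z" using e unfolding g D_def .
  then have "real N ^ 3 * D i = ?\<phi> z" using N by (simp add: power_one_over)
  moreover have "\<bar>\<phi> (grid N i) - \<phi> z\<bar> \<le> \<eta>"
  proof (rule \<eta>)
    have "grid N i = ?x + 2 / real N" using g(2) by simp
    moreover have "3 * ?d = 3 / real N" by simp
    moreover have "0 < 1 / real N" "2 / real N = 2 * (1 / real N)" "3 / real N = 3 * (1 / real N)" using N by simp_all
    ultimately show "\<bar>grid N i - z\<bar> \<le> 2 / real N" using z by linarith
  qed
  ultimately show ?thesis by simp
qed

lemma grid_difference_sum:
  assumes p: "periodic N (\<Phi> :: int \<Rightarrow> real)"
  shows "(\<Sum>i\<in>{1..int N}. \<Phi> (i + 1) - 3 * \<Phi> i + 3 * \<Phi> (i - 1) - \<Phi> (i - 2)) = 0"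
  using sum_period_shift[OF p] sum_period_shift_neg[OF p, of 1] sum_period_shift_neg[OF p, of 2]
  by (simp add: sum.distrib sum_subtractf flip: sum_distrib_left)

text \<open>
  Replace \<open>\<phi>(i/N)\<close> minus its mean by \<open>N\<^sup>3\<close> times the third difference of \<open>\<Phi>\<close>. The main term becomes a
  sum against third differences of the heights by summation by parts; the error is controlled because
  the heights minus their mean are. As third differences of \<open>\<Phi>\<close> sum to zero, the same replacement
  yields the rate of convergence of Riemann sums.
\<close>
lemma centred_avg_third_diff:
  fixes \<phi> :: "real \<Rightarrow> real"
  assumes c: "continuous_on UNIV \<phi>" and p: "periodic_fun_simple' \<phi>" and N: "N \<ge> 1" and h: "periodic N h"
    and \<eta>: "\<And>u v. \<bar>u - v\<bar> \<le> 2 / real N \<Longrightarrow> \<bar>\<phi> u - \<phi> v\<bar> \<le> \<eta>"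
  defines "m \<equiv> integral {0..1} \<phi>"
  defines "\<Phi> \<equiv> antideriv (antideriv (antideriv (\<lambda>x. \<phi> x - m)))"
  shows "\<bar>centred_avg \<phi> N h + 1 / real N * (\<Sum>i\<in>{1..int N}. \<Phi> (grid N i) * curv h i)\<bar>
      \<le> \<eta> * (1 / real N * (\<Sum>i\<in>{1..int N}. \<bar>curv h i\<bar>))"
    and "\<bar>(\<Sum>i\<in>{1..int N}. \<phi> (grid N i)) / real N - m\<bar> \<le> \<eta>"
proof -
  let ?\<phi> = "\<lambda>x. \<phi> x - m" and ?\<Psi> = "\<lambda>i. \<Phi> (grid N i)"
  let ?I = "{1..int N}" and ?S = "\<Sum>i\<in>{1..int N}. \<bar>curv h i\<bar>"
  define D where "D i = ?\<Psi> (i + 1) - 3 * ?\<Psi> i + 3 * ?\<Psi> (i - 1) - ?\<Psi> (i - 2)" for i :: int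
  define r where "r i = \<phi> (grid N i) - m - real N ^ 3 * D i" for i :: int
  define v where "v i = (real_of_int (h i) - (\<Sum>k\<in>?I. real_of_int (h k)) / real N) / real N ^ 4" for i
  have \<eta>0: "0 \<le> \<eta>" using \<eta>[of 0 0] by simp
  have r: "\<bar>r i\<bar> \<le> \<eta>" for i
    unfolding r_def D_def m_def \<Phi>_def by (rule grid_third_difference[OF c p N \<eta>])
  have c0: "continuous_on UNIV ?\<phi>" by (intro continuous_on_diff c continuous_on_const)
  have p0: "periodic_fun_simple' ?\<phi>" using p by (simp add: periodic_fun_simple'_def)
  have m0: "integral {0..1} ?\<phi> = 0"
    using continuous_integrable_unit[OF c] by (subst integral_diff) (auto simp: m_def)
  have "periodic_fun_simple' \<Phi>" unfolding \<Phi>_def by (rule third_antideriv(3)[OF c0 p0 m0])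
  then have per: "periodic N ?\<Psi>" using N by (rule grid_periodic)
  have D0: "(\<Sum>i\<in>?I. D i) = 0" unfolding D_def by (rule grid_difference_sum[OF per])
  have v0: "(\<Sum>i\<in>?I. v i) = 0"
    unfolding v_def using N by (simp add: sum_divide_distrib[symmetric] sum_subtractf)
  have v_le: "\<bar>v i\<bar> \<le> ?S / real N ^ 2" for i
  proof -
    have "\<bar>v i\<bar> \<le> (real N ^ 2 * ?S) / real N ^ 4"
      unfolding v_def abs_divide using height_bound[OF h N, of i] by (simp add: divide_right_mono)
    also have "\<dots> = ?S / real N ^ 2" using N by (simp add: field_simps power_numeral_reduce power2_eq_square)
    finally show ?thesis .
  qed
  have "centred_avg \<phi> N h = (\<Sum>i\<in>?I. (m + real N ^ 3 * D i + r i) * v i)"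
    unfolding centred_avg_eq[OF N] v_def[symmetric] by (intro sum.cong refl) (simp add: r_def)
  also have "\<dots> = real N ^ 3 * (\<Sum>i\<in>?I. D i * v i) + (\<Sum>i\<in>?I. r i * v i)"
    using v0 by (simp add: distrib_right sum.distrib sum_distrib_left[symmetric] mult.assoc)
  also have "(\<Sum>i\<in>?I. D i * v i) = (\<Sum>i\<in>?I. D i * real_of_int (h i)) / real N ^ 4"
  proof -
    have "(\<Sum>i\<in>?I. D i * v i) = (\<Sum>i\<in>?I. D i * real_of_int (h i) / real N ^ 4 - D i * ((\<Sum>k\<in>?I. real_of_int (h k)) / real N / real N ^ 4))"
      unfolding v_def by (intro sum.cong refl) (simp add: diff_divide_distrib right_diff_distrib)
    also have "\<dots> = (\<Sum>i\<in>?I. D i * real_of_int (h i)) / real N ^ 4 - (\<Sum>i\<in>?I. D i) * ((\<Sum>k\<in>?I. real_of_int (h k)) / real N / real N ^ 4)"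
      by (simp add: sum_subtractf sum_divide_distrib sum_distrib_right)
    finally show ?thesis using D0 by simp
  qed
  also have "(\<Sum>i\<in>?I. D i * real_of_int (h i)) = - (\<Sum>i\<in>?I. ?\<Psi> i * curv h i)"
    unfolding D_def third_diff_by_parts[OF h per] by simp
  finally have eq: "centred_avg \<phi> N h + 1 / real N * (\<Sum>i\<in>?I. ?\<Psi> i * curv h i) = (\<Sum>i\<in>?I. r i * v i)"
    using N by (simp add: field_simps power_numeral_reduce)
  have "\<bar>\<Sum>i\<in>?I. r i * v i\<bar> \<le> (\<Sum>i\<in>?I. \<eta> * (?S / real N ^ 2))"
  proof (rule order_trans[OF sum_abs sum_mono])
    show "\<bar>r i * v i\<bar> \<le> \<eta> * (?S / real N ^ 2)" for i
      unfolding abs_mult by (intro mult_mono r v_le \<eta>0) simp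
  qed
  also have "\<dots> = \<eta> * (1 / real N * ?S)" using N by (simp add: field_simps power2_eq_square)
  finally show "\<bar>centred_avg \<phi> N h + 1 / real N * (\<Sum>i\<in>?I. ?\<Psi> i * curv h i)\<bar> \<le> \<eta> * (1 / real N * ?S)"
    unfolding eq .
  have "(\<Sum>i\<in>?I. \<phi> (grid N i)) - real N * m = (\<Sum>i\<in>?I. r i)"
    unfolding r_def using D0 by (simp add: sum_subtractf sum_distrib_left[symmetric])
  moreover have "\<bar>\<Sum>i\<in>?I. r i\<bar> \<le> real N * \<eta>"
    using order_trans[OF sum_abs sum_mono[of ?I "\<lambda>i. \<bar>r i\<bar>" "\<lambda>_. \<eta>"]] r by simp
  ultimately have "\<bar>(\<Sum>i\<in>?I. \<phi> (grid N i)) - real N * m\<bar> / real N \<le> \<eta>"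
    using N by (simp add: field_simps)
  moreover have "(\<Sum>i\<in>?I. \<phi> (grid N i)) / real N - m = ((\<Sum>i\<in>?I. \<phi> (grid N i)) - real N * m) / real N"
    using N by (simp add: diff_divide_distrib)
  ultimately show "\<bar>(\<Sum>i\<in>?I. \<phi> (grid N i)) / real N - m\<bar> \<le> \<eta>"
    by (simp add: abs_divide)
qed

lemma primitive_jointly_continuous:
  assumes "continuous_on ({0..} \<times> UNIV) (\<lambda>(t, x). f t x)"
  shows "continuous_on ({0::real..} \<times> UNIV) (\<lambda>(t, x). primitive (f t) x)"
proof -
  let ?U = "{0::real..} \<times> (UNIV :: real set)"
  have "continuous_on (?U \<times> cbox 0 1) ((\<lambda>(t, x). f t x) \<circ> (\<lambda>z. (fst (fst z), snd (fst z) * snd z)))"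
    by (rule continuous_on_compose, intro continuous_intros, rule continuous_on_subset[OF assms]) auto
  then have "continuous_on (?U \<times> cbox 0 1) (\<lambda>(p, u). f (fst p) (snd p * u))"
    by (simp add: o_def case_prod_beta')
  from integral_continuous_on_param[OF this]
  have "continuous_on ?U (\<lambda>p. integral {0..1} (\<lambda>u. f (fst p) (snd p * u)))" by simp
  then have "continuous_on ?U (\<lambda>p. snd p * integral {0..1} (\<lambda>u. f (fst p) (snd p * u)))"
    by (intro continuous_on_mult continuous_on_snd continuous_on_id)
  then show ?thesis by (simp add: primitive_def case_prod_beta')
qed

lemma antideriv_jointly_continuous:
  assumes "continuous_on ({0..} \<times> UNIV) (\<lambda>(t, x). f t x)"
  shows "continuous_on ({0::real..} \<times> UNIV) (\<lambda>(t, x). antideriv (f t) x)"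
proof -
  note c = primitive_jointly_continuous[OF assms]
  have "continuous_on ({0::real..} \<times> cbox 0 1) (\<lambda>(t, x). primitive (f t) x)"
    by (rule continuous_on_subset[OF c]) auto
  from integral_continuous_on_param[OF this]
  have "continuous_on {0..} (\<lambda>t. integral {0..1} (primitive (f t)))" by simp
  then have "continuous_on ({0..} \<times> UNIV) (\<lambda>p::real \<times> real. integral {0..1} (primitive (f (fst p))))"
    by (rule continuous_on_compose2) (auto intro!: continuous_intros)
  with c have "continuous_on ({0..} \<times> UNIV) (\<lambda>p. primitive (f (fst p)) (snd p) - integral {0..1} (primitive (f (fst p))))"
    unfolding case_prod_beta' by (intro continuous_on_diff)
  then show ?thesis by (simp add: antideriv_def case_prod_beta')
qed

lemma slice_continuous:
  assumes "continuous_on ({0..} \<times> UNIV) (\<lambda>(t, x). f t x)" "0 \<le> (t :: real)"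
  shows "continuous_on UNIV (f t)"
proof -
  have "continuous_on UNIV ((\<lambda>(t, x). f t x) \<circ> (\<lambda>x. (t, x)))"
    by (rule continuous_on_compose, intro continuous_intros, rule continuous_on_subset[OF assms(1)]) (use assms(2) in auto)
  then show ?thesis by (simp add: o_def)
qed

section \<open>Probabilistic limits\<close>

text \<open>
  Use \<open>\<bar>z\<bar> \<le> \<delta>/2 + (2/\<delta>) z\<^sup>2\<close>.
\<close>
lemma limsup_abs_of_square:
  fixes Z :: "real \<Rightarrow> nat \<Rightarrow> 'a \<Rightarrow> real"
  assumes ps: "\<And>N. N \<ge> 1 \<Longrightarrow> prob_space (M N)"
    and meas: "\<And>\<epsilon> N. N \<ge> 1 \<Longrightarrow> Z \<epsilon> N \<in> borel_measurable (M N)"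
    and sq: "((\<lambda>\<epsilon>. limsup (\<lambda>N. \<integral>\<^sup>+\<omega>. ennreal (\<bar>Z \<epsilon> N \<omega>\<bar>\<^sup>2) \<partial>M N)) \<longlongrightarrow> 0) F"
  shows "((\<lambda>\<epsilon>. limsup (\<lambda>N. \<integral>\<^sup>+\<omega>. ennreal \<bar>Z \<epsilon> N \<omega>\<bar> \<partial>M N)) \<longlongrightarrow> 0) F"
proof (rule ennreal_tendsto_0I)
  fix \<delta> :: real assume \<delta>: "0 < \<delta>"
  then have "0 < \<delta>\<^sup>2 / 4" by simp
  from ennreal_tendsto_0D[OF sq this]
  show "eventually (\<lambda>\<epsilon>. limsup (\<lambda>N. \<integral>\<^sup>+\<omega>. ennreal \<bar>Z \<epsilon> N \<omega>\<bar> \<partial>M N) \<le> ennreal \<delta>) F"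
  proof eventually_elim
    case (elim \<epsilon>)
    from Limsup_lessD[OF elim] have "eventually (\<lambda>N. (\<integral>\<^sup>+\<omega>. ennreal \<bar>Z \<epsilon> N \<omega>\<bar> \<partial>M N) \<le> ennreal \<delta>) sequentially"
      using eventually_ge_at_top[of 1]
    proof eventually_elim
      case (elim N)
      interpret prob_space "M N" by (rule ps[OF elim(2)])
      note [measurable] = meas[OF elim(2), of \<epsilon>]
      have "\<bar>z\<bar> \<le> \<delta> / 2 + 2 / \<delta> * \<bar>z\<bar>\<^sup>2" for z :: real
      proof -
        have "\<bar>z\<bar> * \<delta> \<le> \<delta>\<^sup>2 / 2 + 2 * \<bar>z\<bar>\<^sup>2"
        proof -
          have "\<bar>z\<bar> * \<delta> \<le> \<bar>z\<bar>\<^sup>2 + \<delta>\<^sup>2 / 4"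
            using sum_squares_bound[of "\<bar>z\<bar>" "\<delta> / 2"] by (simp add: power_divide)
          moreover have "0 \<le> \<bar>z\<bar>\<^sup>2" "0 \<le> \<delta>\<^sup>2" by simp_all
          ultimately show ?thesis by linarith
        qed
        then show ?thesis using \<delta> by (simp add: field_simps power2_eq_square)
      qed
      then have "(\<integral>\<^sup>+\<omega>. ennreal \<bar>Z \<epsilon> N \<omega>\<bar> \<partial>M N) \<le> (\<integral>\<^sup>+\<omega>. ennreal (\<delta> / 2) + ennreal (2 / \<delta>) * ennreal (\<bar>Z \<epsilon> N \<omega>\<bar>\<^sup>2) \<partial>M N)"
        using \<delta> by (intro nn_integral_mono) (simp add: ennreal_mult[symmetric] ennreal_plus[symmetric] ennreal_leI del: ennreal_plus)
      also have "\<dots> = ennreal (\<delta> / 2) + ennreal (2 / \<delta>) * (\<integral>\<^sup>+\<omega>. ennreal (\<bar>Z \<epsilon> N \<omega>\<bar>\<^sup>2) \<partial>M N)"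
        by (simp add: nn_integral_add nn_integral_cmult emeasure_space_1)
      also have "\<dots> \<le> ennreal (\<delta> / 2) + ennreal (2 / \<delta>) * ennreal (\<delta>\<^sup>2 / 4)"
        using elim(1) by (intro add_mono mult_left_mono) auto
      also have "\<dots> = ennreal (\<delta> / 2 + 2 / \<delta> * (\<delta>\<^sup>2 / 4))" using \<delta> by (simp add: ennreal_mult[symmetric] ennreal_plus[symmetric] del: ennreal_plus)
      also have "\<delta> / 2 + 2 / \<delta> * (\<delta>\<^sup>2 / 4) = \<delta>" using \<delta> by (simp add: power2_eq_square)
      finally show ?case .
    qed
    then show ?case by (rule Limsup_bounded)
  qed
qed

text \<open>
  The form in which heights are recovered: \<open>X\<close> is their average without spatial mean, \<open>A\<close> the spatial
  mean and \<open>b\<close> a Riemann sum of the test function.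
\<close>
lemma tends_in_prob_combine:
  fixes X A :: "nat \<Rightarrow> 'a \<Rightarrow> real"
  assumes ps: "\<And>N. N \<ge> 1 \<Longrightarrow> prob_space (M N)"
    and X: "\<And>N. N \<ge> 1 \<Longrightarrow> X N \<in> borel_measurable (M N)" and A: "\<And>N. N \<ge> 1 \<Longrightarrow> A N \<in> borel_measurable (M N)"
    and L1: "(\<lambda>N. \<integral>\<^sup>+\<omega>. ennreal \<bar>X N \<omega> - I\<bar> \<partial>M N) \<longlonglongrightarrow> 0"
    and Am: "tends_in_prob M A m" and b: "b \<longlonglongrightarrow> (b0 :: real)"
  shows "tends_in_prob M (\<lambda>N \<omega>. X N \<omega> + b N * A N \<omega>) (I + b0 * m)"
  unfolding tends_in_prob_def
proof (intro allI impI)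
  fix \<delta> :: real assume \<delta>: "0 < \<delta>"
  obtain B where B: "0 < B" "\<And>N. \<bar>b N\<bar> \<le> B"
    using convergent_imp_Bseq[OF convergentI[OF b]] by (auto simp: Bseq_def)
  define p where "p N = measure (M N) {\<omega> \<in> space (M N). \<bar>X N \<omega> - I\<bar> > \<delta> / 3}" for N
  define r where "r N = measure (M N) {\<omega> \<in> space (M N). \<bar>A N \<omega> - m\<bar> > \<delta> / (3 * B)}" for N
  have r0: "r \<longlonglongrightarrow> 0"
    using Am \<delta> B(1) unfolding tends_in_prob_def r_def[abs_def] by simp
  have p0: "p \<longlonglongrightarrow> 0"
  proof -
    have "(\<lambda>N. emeasure (M N) {\<omega> \<in> space (M N). \<bar>X N \<omega> - I\<bar> > \<delta> / 3}) \<longlonglongrightarrow> 0"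
    proof (rule ennreal_tendsto_0I)
      fix e :: real assume e: "0 < e"
      then have "0 < e * \<delta> / 3" using \<delta> by simp
      from ennreal_tendsto_0D[OF L1 this] eventually_ge_at_top[of 1]
      show "eventually (\<lambda>N. emeasure (M N) {\<omega> \<in> space (M N). \<bar>X N \<omega> - I\<bar> > \<delta> / 3} \<le> ennreal e) sequentially"
      proof eventually_elim
        case (elim N)
        note [measurable] = X[OF elim(2)]
        have "emeasure (M N) {\<omega> \<in> space (M N). \<bar>X N \<omega> - I\<bar> > \<delta> / 3}
            \<le> emeasure (M N) {\<omega> \<in> space (M N). 1 \<le> ennreal (3 / \<delta>) * ennreal \<bar>X N \<omega> - I\<bar>}"
          using \<delta> by (intro emeasure_mono) (auto simp: ennreal_mult[symmetric] field_simps simp flip: ennreal_1)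
        also have "\<dots> \<le> ennreal (3 / \<delta>) * (\<integral>\<^sup>+\<omega>. ennreal \<bar>X N \<omega> - I\<bar> * indicator (space (M N)) \<omega> \<partial>M N)"
          by (rule nn_integral_Markov_inequality) auto
        also have "(\<integral>\<^sup>+\<omega>. ennreal \<bar>X N \<omega> - I\<bar> * indicator (space (M N)) \<omega> \<partial>M N) = (\<integral>\<^sup>+\<omega>. ennreal \<bar>X N \<omega> - I\<bar> \<partial>M N)"
          by (rule nn_integral_cong) simp
        also have "ennreal (3 / \<delta>) * \<dots> \<le> ennreal (3 / \<delta>) * ennreal (e * \<delta> / 3)"
          using elim(1) by (intro mult_left_mono) auto
        also have "\<dots> = ennreal e" using \<delta> e by (simp add: ennreal_mult[symmetric])
        finally show ?case .
      qed
    qed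
    then have "(\<lambda>N. enn2real (emeasure (M N) {\<omega> \<in> space (M N). \<bar>X N \<omega> - I\<bar> > \<delta> / 3})) \<longlonglongrightarrow> 0"
      by (intro tendsto_enn2real) auto
    then show ?thesis by (simp add: p_def[abs_def] measure_def)
  qed
  have "(\<lambda>N. (b N - b0) * m) \<longlonglongrightarrow> (b0 - b0) * m" by (intro tendsto_intros b)
  then have "eventually (\<lambda>N. \<bar>(b N - b0) * m\<bar> < \<delta> / 3) sequentially"
    using \<delta> tendsto_rabs_zero[of "\<lambda>N. (b N - b0) * m" sequentially] by (intro order_tendstoD(2)) auto
  then have "eventually (\<lambda>N. measure (M N) {\<omega> \<in> space (M N). \<bar>X N \<omega> + b N * A N \<omega> - (I + b0 * m)\<bar> > \<delta>} \<le> p N + r N) sequentially"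
    using eventually_ge_at_top[of 1]
  proof eventually_elim
    case (elim N)
    interpret prob_space "M N" by (rule ps[OF elim(2)])
    note [measurable] = X[OF elim(2)] A[OF elim(2)]
    have "prob {\<omega> \<in> space (M N). \<bar>X N \<omega> + b N * A N \<omega> - (I + b0 * m)\<bar> > \<delta>}
      \<le> prob ({\<omega> \<in> space (M N). \<bar>X N \<omega> - I\<bar> > \<delta> / 3} \<union> {\<omega> \<in> space (M N). \<bar>A N \<omega> - m\<bar> > \<delta> / (3 * B)})"
    proof (rule finite_measure_mono)
      show "{\<omega> \<in> space (M N). \<bar>X N \<omega> + b N * A N \<omega> - (I + b0 * m)\<bar> > \<delta>}
         \<subseteq> {\<omega> \<in> space (M N). \<bar>X N \<omega> - I\<bar> > \<delta> / 3} \<union> {\<omega> \<in> space (M N). \<bar>A N \<omega> - m\<bar> > \<delta> / (3 * B)}"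
      proof (rule ccontr)
        assume "\<not> ?thesis"
        then obtain \<omega> where \<omega>: "\<bar>X N \<omega> + b N * A N \<omega> - (I + b0 * m)\<bar> > \<delta>" "\<bar>X N \<omega> - I\<bar> \<le> \<delta> / 3" "\<bar>A N \<omega> - m\<bar> \<le> \<delta> / (3 * B)"
          by force
        have "\<bar>b N * (A N \<omega> - m)\<bar> \<le> B * (\<delta> / (3 * B))"
          unfolding abs_mult using \<omega>(3) B by (intro mult_mono) auto
        also have "\<dots> = \<delta> / 3" using B(1) by simp
        finally have "\<bar>b N * (A N \<omega> - m)\<bar> \<le> \<delta> / 3" .
        moreover have "X N \<omega> + b N * A N \<omega> - (I + b0 * m) = (X N \<omega> - I) + b N * (A N \<omega> - m) + (b N - b0) * m"
          by (simp add: algebra_simps)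
        ultimately show False using \<omega>(1,2) elim(1) by linarith
      qed
    qed measurable
    also have "\<dots> \<le> p N + r N"
      unfolding p_def r_def by (rule measure_Un_le) measurable
    finally show ?case .
  qed
  note le = this
  have pr0: "(\<lambda>N. p N + r N) \<longlonglongrightarrow> 0" using tendsto_add[OF p0 r0] by simp
  have ge: "eventually (\<lambda>N. 0 \<le> measure (M N) {\<omega> \<in> space (M N). \<bar>X N \<omega> + b N * A N \<omega> - (I + b0 * m)\<bar> > \<delta>}) sequentially"
    by simp
  show "(\<lambda>N. measure (M N) {\<omega> \<in> space (M N). \<bar>X N \<omega> + b N * A N \<omega> - (I + b0 * m)\<bar> > \<delta>}) \<longlonglongrightarrow> 0"
    by (rule tendsto_sandwich[OF ge le tendsto_const pr0])
qed

lemma expectation_tendsto: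
  fixes X :: "nat \<Rightarrow> 'a \<Rightarrow> real"
  assumes ps: "\<And>N. N \<ge> 1 \<Longrightarrow> prob_space (M N)" and X: "\<And>N. N \<ge> 1 \<Longrightarrow> integrable (M N) (X N)"
    and L1: "(\<lambda>N. \<integral>\<^sup>+\<omega>. ennreal \<bar>X N \<omega> - I\<bar> \<partial>M N) \<longlonglongrightarrow> 0"
  shows "(\<lambda>N. \<integral>\<omega>. X N \<omega> \<partial>M N) \<longlonglongrightarrow> I"
proof (rule LIMSEQ_I)
  fix e :: real assume e: "0 < e"
  from ennreal_tendsto_0D[OF L1 e] eventually_ge_at_top[of 1]
  have "eventually (\<lambda>N. norm ((\<integral>\<omega>. X N \<omega> \<partial>M N) - I) < e) sequentially"
  proof eventually_elim
    case (elim N)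
    interpret prob_space "M N" by (rule ps[OF elim(2)])
    have "ennreal (norm (\<integral>\<omega>. X N \<omega> - I \<partial>M N)) \<le> (\<integral>\<^sup>+\<omega>. ennreal (norm (X N \<omega> - I)) \<partial>M N)"
      by (rule integral_norm_bound_ennreal) (use X[OF elim(2)] in auto)
    also have "\<dots> < ennreal e" using elim(1) by simp
    finally show ?case using X[OF elim(2)] e
      by (simp add: Bochner_Integration.integral_diff prob_space ennreal_less_iff)
  qed
  then show "\<exists>no. \<forall>n\<ge>no. norm ((\<integral>\<omega>. X n \<omega> \<partial>M n) - I) < e" by (simp add: eventually_sequentially)
qed

text \<open>
  The mean value theorem turns differences of \<open>\<psi>\<close> along the lattice into values of its derivative.
\<close>
lemma grid_average_bound:
  fixes a :: "int \<Rightarrow> real"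
  assumes d: "\<And>x. (\<psi> has_real_derivative \<psi>' x) (at x)" and N: "N \<ge> 1"
    and \<eta>: "\<And>u v. \<bar>u - v\<bar> \<le> 1 / real N \<Longrightarrow> \<bar>\<psi>' u - \<psi>' v\<bar> \<le> \<eta>" and C: "\<And>i. i \<in> {1..int N} \<Longrightarrow> \<bar>a i\<bar> \<le> C"
  shows "\<bar>(\<Sum>i\<in>{1..int N}. (\<psi> (grid N (i + 1)) - \<psi> (grid N i)) * a i)
     - 1 / real N * (\<Sum>i\<in>{1..int N}. \<psi>' (grid N i) * a i)\<bar> \<le> \<eta> * C"
proof -
  have \<eta>0: "0 \<le> \<eta>" using \<eta>[of 0 0] by simp
  have step: "\<bar>(\<psi> (grid N (i + 1)) - \<psi> (grid N i)) - 1 / real N * \<psi>' (grid N i)\<bar> \<le> \<eta> / real N" for i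
  proof -
    have lt: "grid N i < grid N (i + 1)" using N by (simp add: divide_strict_right_mono)
    obtain z where z: "grid N i < z" "z < grid N (i + 1)" and
      e: "\<psi> (grid N (i + 1)) - \<psi> (grid N i) = (grid N (i + 1) - grid N i) * \<psi>' z"
      using MVT2[OF lt, of \<psi> \<psi>'] d by blast
    have w: "grid N (i + 1) - grid N i = 1 / real N" by (simp add: diff_divide_distrib[symmetric])
    have "\<bar>z - grid N i\<bar> \<le> 1 / real N" using z w by linarith
    then have "\<bar>\<psi>' z - \<psi>' (grid N i)\<bar> / real N \<le> \<eta> / real N" by (intro divide_right_mono \<eta>) auto
    then show ?thesis unfolding e w by (simp add: right_diff_distrib[symmetric] abs_mult diff_divide_distrib[symmetric])
  qed
  have "\<bar>(\<Sum>i\<in>{1..int N}. (\<psi> (grid N (i + 1)) - \<psi> (grid N i)) * a i)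
     - 1 / real N * (\<Sum>i\<in>{1..int N}. \<psi>' (grid N i) * a i)\<bar>
    = \<bar>\<Sum>i\<in>{1..int N}. ((\<psi> (grid N (i + 1)) - \<psi> (grid N i)) - 1 / real N * \<psi>' (grid N i)) * a i\<bar>"
    by (simp add: sum_distrib_left sum_subtractf[symmetric] left_diff_distrib mult.assoc)
  also have "\<dots> \<le> (\<Sum>i\<in>{1..int N}. \<eta> / real N * C)"
  proof (rule order_trans[OF sum_abs sum_mono])
    fix i assume "i \<in> {1..int N}"
    then show "\<bar>((\<psi> (grid N (i + 1)) - \<psi> (grid N i)) - 1 / real N * \<psi>' (grid N i)) * a i\<bar> \<le> \<eta> / real N * C"
      unfolding abs_mult using \<eta>0 by (intro mult_mono step C) auto
  qed
  also have "\<dots> = \<eta> * C" using N by simp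
  finally show ?thesis .
qed

section \<open>The hydrodynamic limit\<close>

text \<open>
  The assumptions on the third differences and on the initial mean height. They give existence and
  regularity of the hydrodynamic limit; the equation is identified further below.
\<close>
locale mesoscopic_metropolis =
  fixes K m :: real and M :: "nat \<Rightarrow> 'a measure" and H :: "nat \<Rightarrow> real \<Rightarrow> 'a \<Rightarrow> int \<Rightarrow> int"
    and w :: "real \<Rightarrow> real \<Rightarrow> real"
  assumes K_pos: "K > 0"
    and process: "\<And>N. N \<ge> 1 \<Longrightarrow> metropolis_process K N (M N) (H N)"
    and initial_mean: "tends_in_prob M (\<lambda>N \<omega>. height_avg (\<lambda>_. 1) N (H N 0 \<omega>)) m"
    and w_periodic: "\<And>t. t \<ge> 0 \<Longrightarrow> periodic_fun_simple' (w t)"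
    and w_jointly_continuous: "continuous_on ({0..} \<times> UNIV) (\<lambda>(t, x). w t x)"
    and w_limit: "\<And>t x. t \<ge> 0 \<Longrightarrow>
      ((\<lambda>\<epsilon>. limsup (\<lambda>N. \<integral>\<^sup>+ \<omega>.
          ennreal (\<bar>window_avg (\<lambda>u. u) N x \<epsilon> (H N t \<omega>) - w t x\<bar>\<^sup>2) \<partial>M N))
        \<longlongrightarrow> 0) (at_right 0)"
    and w_moment: "\<And>t. t \<ge> 0 \<Longrightarrow>
      (SUP N\<in>{1..}. SUP i\<in>{1..int N}.
         \<integral>\<^sup>+ \<omega>. ennreal \<bar>curv (H N t \<omega>) i\<bar> \<partial>M N) < \<infinity>"
begin

lemma prob_space_M: "N \<ge> 1 \<Longrightarrow> prob_space (M N)"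
  using process[of N] by (simp add: metropolis_process_def markov_jump_process_def)

lemma H_measurable: "N \<ge> 1 \<Longrightarrow> 0 \<le> t \<Longrightarrow> H N t \<in> M N \<rightarrow>\<^sub>M count_space (profiles N)"
  using process[of N] by (simp add: metropolis_process_def markov_jump_process_def)

lemma observable_measurable: "N \<ge> 1 \<Longrightarrow> 0 \<le> t \<Longrightarrow> (\<lambda>\<omega>. f (H N t \<omega>) :: real) \<in> borel_measurable (M N)"
  using measurable_compose[OF H_measurable, of N t f borel] by simp

lemma H_periodic: "N \<ge> 1 \<Longrightarrow> 0 \<le> t \<Longrightarrow> \<omega> \<in> space (M N) \<Longrightarrow> periodic N (H N t \<omega>)"
  using measurable_space[OF H_measurable, of N t \<omega>] by (simp add: profiles_periodic)

lemma w_continuous: "0 \<le> t \<Longrightarrow> continuous_on UNIV (w t)"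
  by (rule slice_continuous[OF w_jointly_continuous])

lemma moment_bound:
  assumes t: "0 \<le> t"
  obtains C where "0 \<le> C"
    "\<And>N i. N \<ge> 1 \<Longrightarrow> i \<in> {1..int N} \<Longrightarrow> (\<integral>\<^sup>+ \<omega>. ennreal \<bar>curv (H N t \<omega>) i\<bar> \<partial>M N) \<le> ennreal C"
proof -
  define S where "S = (SUP N\<in>{1..}. SUP i\<in>{1..int N}. \<integral>\<^sup>+ \<omega>. ennreal \<bar>curv (H N t \<omega>) i\<bar> \<partial>M N)"
  have "(\<integral>\<^sup>+ \<omega>. ennreal \<bar>curv (H N t \<omega>) i\<bar> \<partial>M N) \<le> S" if "N \<ge> 1" "i \<in> {1..int N}" for N i
    unfolding S_def by (rule SUP_upper2[of N], use that in simp, rule SUP_upper, use that in simp)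
  moreover have "S = ennreal (enn2real S)" using w_moment[OF t] unfolding S_def[symmetric] by simp
  ultimately show thesis using that[of "enn2real S"] by simp
qed

lemma third_diff_integrable:
  assumes N: "N \<ge> 1" and t: "0 \<le> t" and i: "i \<in> {1..int N}"
  shows "integrable (M N) (\<lambda>\<omega>. curv (H N t \<omega>) i)"
proof (rule integrableI_bounded)
  obtain C where C: "0 \<le> C"
    "\<And>N i. N \<ge> 1 \<Longrightarrow> i \<in> {1..int N} \<Longrightarrow> (\<integral>\<^sup>+ \<omega>. ennreal \<bar>curv (H N t \<omega>) i\<bar> \<partial>M N) \<le> ennreal C"
    using moment_bound[OF t] by blast
  from C(2)[OF N i] show "(\<integral>\<^sup>+ \<omega>. ennreal (norm (curv (H N t \<omega>) i)) \<partial>M N) < \<infinity>"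
    by (simp add: le_less_trans[OF _ ennreal_less_top])
qed (rule observable_measurable[OF N t])

lemma w_limit_L1:
  assumes t: "0 \<le> t"
  shows "((\<lambda>\<epsilon>. limsup (\<lambda>N. \<integral>\<^sup>+ \<omega>. ennreal \<bar>window_avg (\<lambda>u. u) N x \<epsilon> (H N t \<omega>) - w t x\<bar> \<partial>M N)) \<longlongrightarrow> 0) (at_right 0)"
proof (rule limsup_abs_of_square[OF prob_space_M _ w_limit[OF t]])
  show "(\<lambda>\<omega>. window_avg (\<lambda>u. u) N x \<epsilon> (H N t \<omega>) - w t x) \<in> borel_measurable (M N)" if "N \<ge> 1" for \<epsilon> N
    by (rule observable_measurable[OF that t])
qed

lemma third_diff_weak_limit:
  assumes t: "0 \<le> t" and \<phi>: "periodic_fun_simple' \<phi>" "continuous_on UNIV \<phi>"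
  shows "(\<lambda>N. \<integral>\<^sup>+\<omega>. ennreal \<bar>1 / real N * (\<Sum>i\<in>{1..int N}. \<phi> (grid N i) * curv (H N t \<omega>) i) - (LBINT x:{0..1}. \<phi> x * w t x)\<bar> \<partial>M N) \<longlonglongrightarrow> 0"
proof -
  obtain C where C: "0 \<le> C"
    "\<And>N i. N \<ge> 1 \<Longrightarrow> i \<in> {1..int N} \<Longrightarrow> (\<integral>\<^sup>+ \<omega>. ennreal \<bar>curv (H N t \<omega>) i\<bar> \<partial>M N) \<le> ennreal C"
    using moment_bound[OF t] by blast
  show ?thesis
    by (rule mesoscopic_average[where a = "\<lambda>N \<omega> i. curv (H N t \<omega>) i" and M = M,
        OF prob_space_M observable_measurable[OF _ t] C(2) C(1) w_periodic[OF t] w_continuous[OF t] \<phi> w_limit_L1[OF t, unfolded window_avg_eq]])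
qed

text \<open>
  Test the weak limit with the constant function: third differences sum to zero over a period.
\<close>
lemma w_mean:
  assumes t: "0 \<le> t"
  shows "integral {0..1} (w t) = 0"
proof -
  have lim: "(\<lambda>N. \<integral>\<^sup>+\<omega>. ennreal \<bar>1 / real N * (\<Sum>i\<in>{1..int N}. 1 * curv (H N t \<omega>) i) - (LBINT x:{0..1}. 1 * w t x)\<bar> \<partial>M N) \<longlonglongrightarrow> 0"
    by (rule third_diff_weak_limit[OF t]) (auto simp: periodic_fun_simple'_def)
  have "eventually (\<lambda>N. (\<integral>\<^sup>+\<omega>. ennreal \<bar>1 / real N * (\<Sum>i\<in>{1..int N}. 1 * curv (H N t \<omega>) i) - (LBINT x:{0..1}. 1 * w t x)\<bar> \<partial>M N) = ennreal \<bar>LBINT x:{0..1}. w t x\<bar>) sequentially"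
    using eventually_ge_at_top[of 1]
  proof eventually_elim
    case (elim N)
    interpret prob_space "M N" by (rule prob_space_M[OF elim])
    have "(\<integral>\<^sup>+\<omega>. ennreal \<bar>1 / real N * (\<Sum>i\<in>{1..int N}. 1 * curv (H N t \<omega>) i) - (LBINT x:{0..1}. 1 * w t x)\<bar> \<partial>M N) = (\<integral>\<^sup>+\<omega>. ennreal \<bar>LBINT x:{0..1}. w t x\<bar> \<partial>M N)"
    proof (rule nn_integral_cong)
      fix \<omega> assume "\<omega> \<in> space (M N)"
      from sum_third_diff[OF H_periodic[OF elim t this]]
      have "(\<Sum>i\<in>{1..int N}. curv (H N t \<omega>) i) = 0" by (simp flip: of_int_sum)
      then show "ennreal \<bar>1 / real N * (\<Sum>i\<in>{1..int N}. 1 * curv (H N t \<omega>) i) - (LBINT x:{0..1}. 1 * w t x)\<bar> = ennreal \<bar>LBINT x:{0..1}. w t x\<bar>"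
        by simp
    qed
    then show ?case by (simp add: emeasure_space_1)
  qed
  from Lim_transform_eventually[OF lim this]
  have "(\<lambda>N::nat. ennreal \<bar>LBINT x:{0..1}. w t x\<bar>) \<longlonglongrightarrow> 0" .
  then have "ennreal \<bar>LBINT x:{0..1}. w t x\<bar> = 0" by (simp add: tendsto_const_iff)
  then have "(LBINT x:{0..1}. w t x) = 0" by (simp add: ennreal_eq_0_iff)
  then show ?thesis using LBINT_eq_integral[OF w_continuous[OF t]] by simp
qed

definition profile :: "real \<Rightarrow> real \<Rightarrow> real" where
  "profile t x = m + antideriv (antideriv (antideriv (w t))) x"

lemmas w_antideriv = third_antideriv[OF w_continuous w_periodic w_mean]

lemma profile_periodic: "0 \<le> t \<Longrightarrow> periodic_fun_simple' (profile t)"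
  using w_antideriv(3)[of t] by (simp add: profile_def periodic_fun_simple'_def)

lemma profile_continuous: "0 \<le> t \<Longrightarrow> continuous_on UNIV (profile t)"
  using w_antideriv(6)[of t] unfolding profile_def[abs_def] by (intro continuous_intros)

lemma profile_derivs:
  assumes t: "0 \<le> t"
  shows "dx 0 profile t = profile t" "dx 1 profile t = antideriv (antideriv (w t))"
    "dx 2 profile t = antideriv (w t)" "dx 3 profile t = w t"
proof -
  have "(profile t has_real_derivative 0 + antideriv (antideriv (w t)) x) (at x)" for x
    unfolding profile_def[abs_def] using t by (intro DERIV_add DERIV_const antideriv_has_derivative w_antideriv)
  then have 1: "deriv (profile t) = antideriv (antideriv (w t))" by (auto intro!: DERIV_imp_deriv)
  have 2: "deriv (antideriv (antideriv (w t))) = antideriv (w t)"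
    using t by (intro ext DERIV_imp_deriv antideriv_has_derivative w_antideriv)
  have 3: "deriv (antideriv (w t)) = w t"
    using t by (intro ext DERIV_imp_deriv antideriv_has_derivative w_continuous)
  show "dx 0 profile t = profile t" "dx 1 profile t = antideriv (antideriv (w t))"
    "dx 2 profile t = antideriv (w t)" "dx 3 profile t = w t"
    using 1 2 3 by (simp_all add: numeral_eq_Suc)
qed

lemma profile_C3: "C3_in_x profile"
  unfolding C3_in_x_def
proof (intro conjI allI impI)
  fix k :: nat and t x :: real assume k: "k < 3" and t: "0 \<le> t"
  have d: "f differentiable (at x)" if "(f has_real_derivative D) (at x)" for f D
    using that real_differentiable_def by blast
  from k consider "k = 0" | "k = 1" | "k = 2" by linarith
  then show "dx k profile t differentiable (at x)"
  proof cases
    case 1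
    have "(profile t has_real_derivative 0 + antideriv (antideriv (w t)) x) (at x)"
      unfolding profile_def[abs_def] using t by (intro DERIV_add DERIV_const antideriv_has_derivative w_antideriv)
    then show ?thesis unfolding 1 profile_derivs(1)[OF t] by (rule d)
  next
    case 2
    show ?thesis unfolding 2 profile_derivs(2)[OF t] using t by (intro d[OF antideriv_has_derivative] w_antideriv)
  next
    case 3
    show ?thesis unfolding 3 profile_derivs(3)[OF t] using t by (intro d[OF antideriv_has_derivative] w_continuous)
  qed
next
  fix k :: nat assume "k \<le> 3"
  then consider "k = 0" | "k = 1" | "k = 2" | "k = 3" by linarith
  then show "continuous_on ({0..} \<times> UNIV) (\<lambda>(t, x). dx k profile t x)"
  proof cases
    case 1
    have "continuous_on ({0..} \<times> UNIV) (\<lambda>p. m + (case p of (t, x) \<Rightarrow> antideriv (antideriv (antideriv (w t))) x))"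
      by (intro continuous_on_add continuous_on_const antideriv_jointly_continuous w_jointly_continuous)
    then show ?thesis by (simp add: 1 profile_def case_prod_beta')
  next
    case 2
    have "continuous_on ({0..} \<times> UNIV) (\<lambda>(t, x). antideriv (antideriv (w t)) x)"
      by (intro antideriv_jointly_continuous w_jointly_continuous)
    then show ?thesis unfolding 2
      by (rule continuous_on_cong[THEN iffD1, rotated 2]) (auto simp: profile_derivs(2)[simplified])
  next
    case 3
    have "continuous_on ({0..} \<times> UNIV) (\<lambda>(t, x). antideriv (w t) x)"
      by (intro antideriv_jointly_continuous w_jointly_continuous)
    then show ?thesis unfolding 3
      by (rule continuous_on_cong[THEN iffD1, rotated 2]) (auto simp: profile_derivs(3))
  next
    case 4
    show ?thesis unfolding 4
      by (rule continuous_on_cong[THEN iffD1, rotated 2, OF w_jointly_continuous]) (auto simp: profile_derivs(4))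
  qed
qed

text \<open>
  With \<open>\<Phi>\<close> the threefold antiderivative of \<open>\<phi>\<close> minus its mean, the average is, up to a
  vanishing error, the pairing of \<open>- \<Phi>\<close> with the third differences, and its claimed limit is the pairing
  of \<open>- \<Phi>\<close> with \<open>w t\<close>.
\<close>
lemma centred_avg_limit:
  assumes t: "0 \<le> t" and \<phi>: "periodic_fun_simple' \<phi>" "continuous_on UNIV \<phi>"
  shows "(\<lambda>N. \<integral>\<^sup>+\<omega>. ennreal \<bar>centred_avg \<phi> N (H N t \<omega>) - integral {0..1} (\<lambda>x. \<phi> x * (profile t x - m))\<bar> \<partial>M N) \<longlonglongrightarrow> 0"
proof (rule ennreal_tendsto_0I)
  fix \<delta> :: real assume \<delta>: "0 < \<delta>"
  define \<mu> where "\<mu> = integral {0..1} \<phi>"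
  define \<Phi> where "\<Phi> = antideriv (antideriv (antideriv (\<lambda>x. \<phi> x - \<mu>)))"
  let ?A = "antideriv (antideriv (antideriv (w t)))"
  have c0: "continuous_on UNIV (\<lambda>x. \<phi> x - \<mu>)" by (intro continuous_on_diff \<phi> continuous_on_const)
  have p0: "periodic_fun_simple' (\<lambda>x. \<phi> x - \<mu>)" using \<phi>(1) by (simp add: periodic_fun_simple'_def)
  have m0: "integral {0..1} (\<lambda>x. \<phi> x - \<mu>) = 0"
    using continuous_integrable_unit[OF \<phi>(2)] by (subst integral_diff) (auto simp: \<mu>_def)
  have \<Phi>: "periodic_fun_simple' \<Phi>" "continuous_on UNIV \<Phi>"
    unfolding \<Phi>_def using third_antideriv[OF c0 p0 m0] by blast+
  have I: "integral {0..1} (\<lambda>x. \<phi> x * (profile t x - m)) = - (LBINT x:{0..1}. \<Phi> x * w t x)"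
  proof -
    have "integral {0..1} (\<lambda>x. (\<phi> x - \<mu>) * ?A x) = integral {0..1} (\<lambda>x. \<phi> x * ?A x - \<mu> * ?A x)"
      by (simp add: left_diff_distrib)
    also have "\<dots> = integral {0..1} (\<lambda>x. \<phi> x * ?A x) - integral {0..1} (\<lambda>x. \<mu> * ?A x)"
      using t \<phi>(2) by (intro integral_diff continuous_integrable_unit continuous_on_mult continuous_on_const w_antideriv)
    also have "integral {0..1} (\<lambda>x. \<mu> * ?A x) = 0"
      using t antideriv_mean[OF w_antideriv(5)[of t]] by simp
    finally have "integral {0..1} (\<lambda>x. \<phi> x * ?A x) = integral {0..1} (\<lambda>x. (\<phi> x - \<mu>) * ?A x)" by simp
    also have "\<dots> = - integral {0..1} (\<lambda>x. \<Phi> x * w t x)"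
      unfolding \<Phi>_def by (rule third_antideriv_swap[OF c0 p0 m0 w_continuous[OF t] w_periodic[OF t] w_mean[OF t]])
    also have "integral {0..1} (\<lambda>x. \<Phi> x * w t x) = (LBINT x:{0..1}. \<Phi> x * w t x)"
      using LBINT_eq_integral[OF continuous_on_mult[OF \<Phi>(2) w_continuous[OF t]]] by simp
    finally show ?thesis by (simp add: profile_def)
  qed
  obtain C where C: "0 \<le> C"
    "\<And>N i. N \<ge> 1 \<Longrightarrow> i \<in> {1..int N} \<Longrightarrow> (\<integral>\<^sup>+ \<omega>. ennreal \<bar>curv (H N t \<omega>) i\<bar> \<partial>M N) \<le> ennreal C"
    using moment_bound[OF t] by blast
  define \<eta> where "\<eta> = \<delta> / (2 * (C + 1))"
  have \<eta>0: "0 < \<eta>" using \<delta> C by (simp add: \<eta>_def)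
  obtain d where d: "0 < d" "\<And>x y. \<bar>x - y\<bar> \<le> d \<Longrightarrow> \<bar>\<phi> x - \<phi> y\<bar> \<le> \<eta>"
    using periodic_uniformly_continuous[OF \<phi> \<eta>0] by blast
  obtain n :: nat where n: "2 / d \<le> real n" using real_arch_simple by blast
  from \<delta> have "0 < \<delta> / 2" by simp
  from ennreal_tendsto_0D[OF third_diff_weak_limit[OF t \<Phi>] this] eventually_ge_at_top[of "max 1 n"]
  show "eventually (\<lambda>N. (\<integral>\<^sup>+\<omega>. ennreal \<bar>centred_avg \<phi> N (H N t \<omega>) - integral {0..1} (\<lambda>x. \<phi> x * (profile t x - m))\<bar> \<partial>M N) \<le> ennreal \<delta>) sequentially"
  proof eventually_elim
    case (elim N)
    then have N: "N \<ge> 1" and nN: "2 / d \<le> real N" using n by auto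
    have dN: "2 / real N \<le> d" using nN d(1) N by (simp add: field_simps)
    have mod: "\<bar>\<phi> u - \<phi> v\<bar> \<le> \<eta>" if "\<bar>u - v\<bar> \<le> 2 / real N" for u v
      using that dN by (intro d(2)) linarith
    interpret prob_space "M N" by (rule prob_space_M[OF N])
    note [measurable] = observable_measurable[OF N t]
    let ?W = "\<lambda>\<omega> i. curv (H N t \<omega>) i"
    let ?S = "\<lambda>\<omega>. 1 / real N * (\<Sum>i\<in>{1..int N}. \<Phi> (grid N i) * ?W \<omega> i)"
    let ?L = "LBINT x:{0..1}. \<Phi> x * w t x"
    have "(\<integral>\<^sup>+\<omega>. ennreal \<bar>centred_avg \<phi> N (H N t \<omega>) - integral {0..1} (\<lambda>x. \<phi> x * (profile t x - m))\<bar> \<partial>M N)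
       \<le> (\<integral>\<^sup>+\<omega>. ennreal (\<eta> / real N) * (\<Sum>i\<in>{1..int N}. ennreal \<bar>?W \<omega> i\<bar>) + ennreal \<bar>?S \<omega> - ?L\<bar> \<partial>M N)"
    proof (rule nn_integral_mono)
      fix \<omega> assume "\<omega> \<in> space (M N)"
      from centred_avg_third_diff(1)[OF \<phi>(2,1) N H_periodic[OF N t this] mod, folded \<mu>_def, folded \<Phi>_def]
      have "\<bar>centred_avg \<phi> N (H N t \<omega>) + ?S \<omega>\<bar> \<le> \<eta> * (1 / real N * (\<Sum>i\<in>{1..int N}. \<bar>?W \<omega> i\<bar>))" .
      then have "\<bar>centred_avg \<phi> N (H N t \<omega>) - integral {0..1} (\<lambda>x. \<phi> x * (profile t x - m))\<bar>
         \<le> \<eta> * (1 / real N * (\<Sum>i\<in>{1..int N}. \<bar>?W \<omega> i\<bar>)) + \<bar>?S \<omega> - ?L\<bar>"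
        unfolding I by linarith
      then have "ennreal \<bar>centred_avg \<phi> N (H N t \<omega>) - integral {0..1} (\<lambda>x. \<phi> x * (profile t x - m))\<bar>
         \<le> ennreal (\<eta> / real N * (\<Sum>i\<in>{1..int N}. \<bar>?W \<omega> i\<bar>) + \<bar>?S \<omega> - ?L\<bar>)"
        by (intro ennreal_leI) simp
      also have "\<dots> = ennreal (\<eta> / real N) * (\<Sum>i\<in>{1..int N}. ennreal \<bar>?W \<omega> i\<bar>) + ennreal \<bar>?S \<omega> - ?L\<bar>"
        using \<eta>0 by (subst ennreal_plus) (auto simp: ennreal_mult sum_nonneg simp del: ennreal_plus times_divide_eq_left intro!: mult_nonneg_nonneg)
      finally show "ennreal \<bar>centred_avg \<phi> N (H N t \<omega>) - integral {0..1} (\<lambda>x. \<phi> x * (profile t x - m))\<bar>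
         \<le> ennreal (\<eta> / real N) * (\<Sum>i\<in>{1..int N}. ennreal \<bar>?W \<omega> i\<bar>) + ennreal \<bar>?S \<omega> - ?L\<bar>" .
    qed
    also have "\<dots> = ennreal (\<eta> / real N) * (\<Sum>i\<in>{1..int N}. \<integral>\<^sup>+\<omega>. ennreal \<bar>?W \<omega> i\<bar> \<partial>M N) + (\<integral>\<^sup>+\<omega>. ennreal \<bar>?S \<omega> - ?L\<bar> \<partial>M N)"
      by (simp add: nn_integral_add nn_integral_cmult nn_integral_sum del: sum_ennreal)
    also have "\<dots> \<le> ennreal (\<eta> / real N) * (\<Sum>i\<in>{1..int N}. ennreal C) + ennreal (\<delta> / 2)"
      using elim(1) by (intro add_mono mult_left_mono sum_mono C(2)[OF N]) auto
    also have "(\<Sum>i\<in>{1..int N}. ennreal C) = ennreal (\<Sum>i\<in>{1..int N}. C)" using C by (subst sum_ennreal) auto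
    also have "ennreal (\<eta> / real N) * ennreal (\<Sum>i\<in>{1..int N}. C) = ennreal (\<eta> * C)"
      using \<eta>0 C N by (subst ennreal_mult[symmetric]) auto
    also have "\<eta> * C \<le> \<delta> / 2" using C \<delta> by (simp add: \<eta>_def field_simps)
    then have "ennreal (\<eta> * C) + ennreal (\<delta> / 2) \<le> ennreal (\<delta> / 2) + ennreal (\<delta> / 2)" by (intro add_mono ennreal_leI) auto
    also have "\<dots> = ennreal \<delta>" using \<delta> by (subst ennreal_plus[symmetric]) auto
    finally show ?case .
  qed
qed

lemma grid_mean_limit:
  assumes \<phi>: "periodic_fun_simple' \<phi>" "continuous_on UNIV \<phi>"
  shows "(\<lambda>N. (\<Sum>i\<in>{1..int N}. \<phi> (grid N i)) / real N) \<longlonglongrightarrow> integral {0..1} \<phi>"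
proof (rule LIMSEQ_I)
  fix e :: real assume e: "0 < e"
  then have e2: "0 < e / 2" by simp
  obtain d where d: "0 < d" "\<And>x y. \<bar>x - y\<bar> \<le> d \<Longrightarrow> \<bar>\<phi> x - \<phi> y\<bar> \<le> e / 2"
    using periodic_uniformly_continuous[OF \<phi> e2] by blast
  obtain n :: nat where n: "2 / d \<le> real n" using real_arch_simple by blast
  have "norm ((\<Sum>i\<in>{1..int N}. \<phi> (grid N i)) / real N - integral {0..1} \<phi>) < e" if "N \<ge> max 1 n" for N
  proof -
    have N: "N \<ge> 1" and nN: "2 / d \<le> real N" using n that by auto
    have dN: "2 / real N \<le> d" using nN d(1) N by (simp add: field_simps)
    have mod: "\<bar>\<phi> u - \<phi> v\<bar> \<le> e / 2" if "\<bar>u - v\<bar> \<le> 2 / real N" for u v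
      using that dN by (intro d(2)) linarith
    have "periodic N (\<lambda>_. 0 :: int)" by (simp add: periodic_fun_simple_def)
    from centred_avg_third_diff(2)[OF \<phi>(2,1) N this mod] show ?thesis using e by simp
  qed
  then show "\<exists>no. \<forall>n\<ge>no. norm ((\<Sum>i\<in>{1..int n}. \<phi> (real_of_int i / real n)) / real n - integral {0..1} \<phi>) < e" by blast
qed

lemmas dynkin_at = metropolis_dynkin[OF K_pos _ process third_diff_integrable[OF _ order_refl]]

lemma mean_conserved:
  assumes t: "0 \<le> t"
  shows "tends_in_prob M (\<lambda>N \<omega>. height_avg (\<lambda>_. 1) N (H N t \<omega>)) m"
  unfolding tends_in_prob_def
proof (intro allI impI)
  fix \<delta> :: real assume \<delta>: "0 < \<delta>"
  have lim: "(\<lambda>N. measure (M N) {\<omega> \<in> space (M N). \<bar>height_avg (\<lambda>_. 1) N (H N 0 \<omega>) - m\<bar> > \<delta>}) \<longlonglongrightarrow> 0"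
    using initial_mean \<delta> by (simp add: tends_in_prob_def)
  have "eventually (\<lambda>N. measure (M N) {\<omega> \<in> space (M N). \<bar>height_avg (\<lambda>_. 1) N (H N 0 \<omega>) - m\<bar> > \<delta>}
      = measure (M N) {\<omega> \<in> space (M N). \<bar>height_avg (\<lambda>_. 1) N (H N t \<omega>) - m\<bar> > \<delta>}) sequentially"
    using eventually_ge_at_top[of 1]
  proof eventually_elim
    case (elim N)
    interpret prob_space "M N" by (rule prob_space_M[OF elim])
    note [measurable] = observable_measurable[OF elim t] observable_measurable[OF elim order_refl]
    have "AE \<omega> in M N. height_avg (\<lambda>_. 1) N (H N t \<omega>) = height_avg (\<lambda>_. 1) N (H N 0 \<omega>)"
      by (rule dynkin_at(4)[OF elim elim elim, where \<psi> = "\<lambda>_. 1" and B = 1]) (use t in \<open>auto simp: periodic_fun_simple'_def\<close>)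
    then have "AE \<omega> in M N. (\<omega> \<in> {\<omega> \<in> space (M N). \<bar>height_avg (\<lambda>_. 1) N (H N 0 \<omega>) - m\<bar> > \<delta>}) = (\<omega> \<in> {\<omega> \<in> space (M N). \<bar>height_avg (\<lambda>_. 1) N (H N t \<omega>) - m\<bar> > \<delta>})"
      by eventually_elim simp
    then show ?case by (rule finite_measure_eq_AE) measurable
  qed
  from Lim_transform_eventually[OF lim this]
  show "(\<lambda>N. measure (M N) {\<omega> \<in> space (M N). \<bar>height_avg (\<lambda>_. 1) N (H N t \<omega>) - m\<bar> > \<delta>}) \<longlonglongrightarrow> 0" .
qed

lemma profile_limit_profile:
  assumes t: "0 \<le> t"
  shows "profile_limit M (\<lambda>N. H N t) (profile t)"
  unfolding profile_limit_def
proof (intro conjI allI impI)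
  show "periodic_fun_simple' (profile t)" by (rule profile_periodic[OF t])
  show "set_integrable lborel {0..1} (profile t)"
    by (rule borel_integrable_atLeastAtMost') (rule continuous_on_subset[OF profile_continuous[OF t]], simp)
  fix \<phi> :: "real \<Rightarrow> real" assume "periodic_fun_simple' \<phi> \<and> continuous_on UNIV \<phi>"
  then have \<phi>: "periodic_fun_simple' \<phi>" "continuous_on UNIV \<phi>" by auto
  let ?b = "\<lambda>N. (\<Sum>i\<in>{1..int N}. \<phi> (grid N i)) / real N"
  have "tends_in_prob M (\<lambda>N \<omega>. centred_avg \<phi> N (H N t \<omega>) + ?b N * height_avg (\<lambda>_. 1) N (H N t \<omega>))
     (integral {0..1} (\<lambda>x. \<phi> x * (profile t x - m)) + integral {0..1} \<phi> * m)"
    by (rule tends_in_prob_combine[OF prob_space_M observable_measurable[OF _ t] observable_measurable[OF _ t]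
          centred_avg_limit[OF t \<phi>] mean_conserved[OF t] grid_mean_limit[OF \<phi>]])
  moreover have "(\<lambda>N \<omega>. centred_avg \<phi> N (H N t \<omega>) + ?b N * height_avg (\<lambda>_. 1) N (H N t \<omega>)) = (\<lambda>N \<omega>. height_avg \<phi> N (H N t \<omega>))"
    by (simp add: centred_avg_def)
  moreover have "integral {0..1} (\<lambda>x. \<phi> x * (profile t x - m)) + integral {0..1} \<phi> * m = (LBINT x:{0..1}. \<phi> x * profile t x)"
  proof -
    have "integral {0..1} (\<lambda>x. \<phi> x * (profile t x - m)) + integral {0..1} (\<lambda>x. \<phi> x * m) = integral {0..1} (\<lambda>x. \<phi> x * (profile t x - m) + \<phi> x * m)"
      by (intro integral_add[symmetric] continuous_integrable_unit continuous_on_mult continuous_on_diff continuous_on_const profile_continuous t \<phi>)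
    also have "\<dots> = integral {0..1} (\<lambda>x. \<phi> x * profile t x)" by (simp add: algebra_simps)
    also have "\<dots> = (LBINT x:{0..1}. \<phi> x * profile t x)"
      by (rule LBINT_eq_integral[symmetric]) (intro continuous_on_mult profile_continuous t \<phi>)
    finally show ?thesis by simp
  qed
  ultimately show "tends_in_prob M (\<lambda>N \<omega>. height_avg \<phi> N (H N t \<omega>)) (LBINT x:{0..1}. \<phi> x * profile t x)"
    by simp
qed

end

section \<open>The limiting equation\<close>

text \<open>
  The assumptions that identify the macroscopic current.
\<close>
locale local_equilibrium_metropolis = mesoscopic_metropolis +
  fixes J_hat :: "real \<Rightarrow> real"
  assumes J_hat_continuous: "continuous_on UNIV J_hat"
    and local_equilibrium: "\<And>t x. t > 0 \<Longrightarrow>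
      ((\<lambda>\<epsilon>. limsup (\<lambda>N. ennreal
          \<bar>(\<integral>\<omega>. window_avg (J K) N x \<epsilon> (H N t \<omega>) \<partial>M N)
            - J_hat (\<integral>\<omega>. window_avg (\<lambda>u. u) N x \<epsilon> (H N t \<omega>) \<partial>M N)\<bar>))
        \<longlongrightarrow> 0) (at_right 0)"
    and current_integrable: "\<And>N i s. N \<ge> 1 \<Longrightarrow> i \<in> {1..int N} \<Longrightarrow> s > 0 \<Longrightarrow>
      integrable (M N) (\<lambda>\<omega>. J K (curv (H N s \<omega>) i))"
    and current_bounded: "\<And>t. t \<ge> 0 \<Longrightarrow>
      (SUP N\<in>{1..}. SUP s\<in>{0<..t}. SUP i\<in>{1..int N}.
         ennreal \<bar>\<integral>\<omega>. J K (curv (H N s \<omega>) i) \<partial>M N\<bar>) < \<infinity>"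
begin

definition current :: "nat \<Rightarrow> real \<Rightarrow> int \<Rightarrow> real" where
  "current N s i = (\<integral>\<omega>. J K (curv (H N s \<omega>) i) \<partial>M N)"

lemma current_bound:
  assumes t: "0 \<le> t"
  obtains C where "0 \<le> C" "\<And>N s i. N \<ge> 1 \<Longrightarrow> 0 < s \<Longrightarrow> s \<le> t \<Longrightarrow> i \<in> {1..int N} \<Longrightarrow> \<bar>current N s i\<bar> \<le> C"
proof -
  define S where "S = (SUP N\<in>{1..}. SUP s\<in>{0<..t}. SUP i\<in>{1..int N}.
         ennreal \<bar>\<integral>\<omega>. J K (curv (H N s \<omega>) i) \<partial>M N\<bar>)"
  have "ennreal \<bar>current N s i\<bar> \<le> S" if "N \<ge> 1" "0 < s" "s \<le> t" "i \<in> {1..int N}" for N s i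
    unfolding S_def current_def
    by (rule SUP_upper2[of N], use that in simp, rule SUP_upper2[of s], use that in simp, rule SUP_upper, use that in simp)
  moreover have "S = ennreal (enn2real S)" using current_bounded[OF t] unfolding S_def[symmetric] by simp
  ultimately have "\<bar>current N s i\<bar> \<le> enn2real S" if "N \<ge> 1" "0 < s" "s \<le> t" "i \<in> {1..int N}" for N s i
    using that by (metis ennreal_le_iff enn2real_nonneg)
  then show thesis using that[of "enn2real S"] by simp
qed

lemma expected_window_current:
  assumes N: "N \<ge> 1" and s: "0 < s"
  shows "(\<integral>\<omega>. window_avg (J K) N x \<epsilon> (H N s \<omega>) \<partial>M N) = wavg (current N s) N x \<epsilon>"
proof -
  have i: "integrable (M N) (\<lambda>\<omega>. J K (curv (H N s \<omega>) i))" if "i \<in> window N x \<epsilon>" for i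
    using that window_subset by (intro current_integrable[OF N _ s]) blast
  show ?thesis
    unfolding window_avg_def wavg_def current_def using i
    by (simp add: Bochner_Integration.integral_sum)
qed

text \<open>
  Local equilibrium compares with \<open>J_hat\<close> at the mean of the window average; that mean is close to \<open>w\<close>, and
  \<open>J_hat\<close> is continuous.
\<close>
lemma window_current_limit:
  assumes s: "0 < s"
  shows "((\<lambda>\<epsilon>. limsup (\<lambda>N. ennreal \<bar>wavg (current N s) N x \<epsilon> - J_hat (w s x)\<bar>)) \<longlongrightarrow> 0) (at_right 0)"
proof (rule ennreal_tendsto_0I)
  fix \<delta> :: real assume \<delta>: "0 < \<delta>"
  then have \<delta>2: "0 < \<delta> / 2" by simp
  have "isCont J_hat (w s x)" using J_hat_continuous by (simp add: continuous_on_eq_continuous_at)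
  then obtain \<rho> where \<rho>: "0 < \<rho>" "\<And>y. \<bar>y - w s x\<bar> < \<rho> \<Longrightarrow> \<bar>J_hat y - J_hat (w s x)\<bar> < \<delta> / 2"
    unfolding continuous_at_eps_delta using \<delta>2 by (metis dist_real_def)
  have s0: "0 \<le> s" using s by simp
  from ennreal_tendsto_0D[OF w_limit_L1[OF s0, of x] \<rho>(1)] ennreal_tendsto_0D[OF local_equilibrium[OF s, of x] \<delta>2]
  show "eventually (\<lambda>\<epsilon>. limsup (\<lambda>N. ennreal \<bar>wavg (current N s) N x \<epsilon> - J_hat (w s x)\<bar>) \<le> ennreal \<delta>) (at_right 0)"
  proof eventually_elim
    case (elim \<epsilon>)
    from Limsup_lessD[OF elim(1)] Limsup_lessD[OF elim(2)]
    have "eventually (\<lambda>N. ennreal \<bar>wavg (current N s) N x \<epsilon> - J_hat (w s x)\<bar> \<le> ennreal \<delta>) sequentially"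
      using eventually_ge_at_top[of 1]
    proof eventually_elim
      case (elim N)
      interpret prob_space "M N" by (rule prob_space_M[OF elim(3)])
      let ?A = "\<lambda>\<omega>. window_avg (\<lambda>u. u) N x \<epsilon> (H N s \<omega>)"
      have int: "integrable (M N) ?A"
        unfolding window_avg_def using window_subset third_diff_integrable[OF elim(3) s0]
        by (intro integrable_mult_right Bochner_Integration.integrable_sum) blast
      have "ennreal (norm (\<integral>\<omega>. ?A \<omega> - w s x \<partial>M N)) \<le> (\<integral>\<^sup>+\<omega>. ennreal (norm (?A \<omega> - w s x)) \<partial>M N)"
        using int by (intro integral_norm_bound_ennreal) auto
      also have "\<dots> < ennreal \<rho>" using elim(1) by simp
      finally have "\<bar>(\<integral>\<omega>. ?A \<omega> \<partial>M N) - w s x\<bar> < \<rho>"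
        using int \<rho>(1) by (simp add: Bochner_Integration.integral_diff prob_space ennreal_less_iff)
      then have 1: "\<bar>J_hat (\<integral>\<omega>. ?A \<omega> \<partial>M N) - J_hat (w s x)\<bar> < \<delta> / 2" by (rule \<rho>(2))
      have 2: "\<bar>wavg (current N s) N x \<epsilon> - J_hat (\<integral>\<omega>. ?A \<omega> \<partial>M N)\<bar> < \<delta> / 2"
        using elim(2) \<delta>2 unfolding expected_window_current[OF elim(3) s] by (simp add: ennreal_less_iff)
      show ?case by (rule ennreal_leI) (use 1 2 in linarith)
    qed
    then show ?case by (rule Limsup_bounded)
  qed
qed

lemma current_weak_limit:
  assumes s: "0 < s" and \<phi>: "periodic_fun_simple' \<phi>" "continuous_on UNIV \<phi>"
  shows "(\<lambda>N. 1 / real N * (\<Sum>i\<in>{1..int N}. \<phi> (grid N i) * current N s i)) \<longlonglongrightarrow> (LBINT x:{0..1}. \<phi> x * J_hat (w s x))"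
proof -
  have s0: "0 \<le> s" using s by simp
  obtain C where C: "0 \<le> C" "\<And>N r i. N \<ge> 1 \<Longrightarrow> 0 < r \<Longrightarrow> r \<le> s \<Longrightarrow> i \<in> {1..int N} \<Longrightarrow> \<bar>current N r i\<bar> \<le> C"
    using current_bound[OF s0] by blast
  have const: "(\<integral>\<^sup>+\<omega>. ennreal c \<partial>M N) = ennreal c" if "N \<ge> 1" for N c
  proof -
    interpret prob_space "M N" by (rule prob_space_M[OF that])
    show ?thesis by (simp add: emeasure_space_1)
  qed
  have lim: "(\<lambda>N. \<integral>\<^sup>+\<omega>. ennreal \<bar>1 / real N * (\<Sum>i\<in>{1..int N}. \<phi> (grid N i) * current N s i) - (LBINT x:{0..1}. \<phi> x * J_hat (w s x))\<bar> \<partial>M N) \<longlonglongrightarrow> 0"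
  proof (rule mesoscopic_average[where a = "\<lambda>N \<omega>. current N s" and M = M])
    show "periodic_fun_simple' (\<lambda>x. J_hat (w s x))" using w_periodic[OF s0] by (simp add: periodic_fun_simple'_def)
    show "continuous_on UNIV (\<lambda>x. J_hat (w s x))"
      by (rule continuous_on_compose2[OF J_hat_continuous w_continuous[OF s0]]) simp
    show "(\<integral>\<^sup>+\<omega>. ennreal \<bar>current N s i\<bar> \<partial>M N) \<le> ennreal C" if "N \<ge> 1" "i \<in> {1..int N}" for N i
      unfolding const[OF that(1)] by (rule ennreal_leI[OF C(2)[OF that(1) s order_refl that(2)]])
    fix x
    have "limsup (\<lambda>N. \<integral>\<^sup>+\<omega>. ennreal \<bar>wavg (current N s) N x \<epsilon> - J_hat (w s x)\<bar> \<partial>M N)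
      = limsup (\<lambda>N. ennreal \<bar>wavg (current N s) N x \<epsilon> - J_hat (w s x)\<bar>)" for \<epsilon>
      by (rule Limsup_eq, rule eventually_mono[OF eventually_ge_at_top[of 1]]) (rule const)
    then show "((\<lambda>\<epsilon>. limsup (\<lambda>N. \<integral>\<^sup>+\<omega>. ennreal \<bar>wavg (current N s) N x \<epsilon> - J_hat (w s x)\<bar> \<partial>M N)) \<longlongrightarrow> 0) (at_right 0)"
      using window_current_limit[OF s, of x] by simp
  qed (use prob_space_M C \<phi> in auto)
  show ?thesis
  proof (rule LIMSEQ_I)
    fix e :: real assume e: "0 < e"
    from ennreal_tendsto_0D[OF lim e] eventually_ge_at_top[of 1]
    have "eventually (\<lambda>N. norm (1 / real N * (\<Sum>i\<in>{1..int N}. \<phi> (grid N i) * current N s i) - (LBINT x:{0..1}. \<phi> x * J_hat (w s x))) < e) sequentially"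
    proof eventually_elim
      case (elim N)
      then show ?case unfolding const[OF elim(2)] by (simp add: ennreal_less_iff)
    qed
    then show "\<exists>no. \<forall>N\<ge>no. norm (1 / real N * (\<Sum>i\<in>{1..int N}. \<phi> (grid N i) * current N s i) - (LBINT x:{0..1}. \<phi> x * J_hat (w s x))) < e"
      by (simp add: eventually_sequentially)
  qed
qed

text \<open>
  The mean of the generator applied to the average against \<open>\<psi>\<close>.
\<close>
definition flux :: "(real \<Rightarrow> real) \<Rightarrow> nat \<Rightarrow> real \<Rightarrow> real" where
  "flux \<psi> N s = (\<integral>\<omega>. (\<Sum>i\<in>{1..int N}. (\<psi> (grid N (i + 1)) - \<psi> (grid N i)) * J K (curv (H N s \<omega>) i)) \<partial>M N)"

lemma flux_eq:
  assumes "N \<ge> 1" "0 < s"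
  shows "flux \<psi> N s = (\<Sum>i\<in>{1..int N}. (\<psi> (grid N (i + 1)) - \<psi> (grid N i)) * current N s i)"
  unfolding flux_def current_def using current_integrable[OF assms(1) _ assms(2)]
  by (subst Bochner_Integration.integral_sum) auto

lemma flux_limit:
  assumes s: "0 < s" and p: "periodic_fun_simple' \<psi>'" and c: "continuous_on UNIV \<psi>'"
    and d: "\<And>x. (\<psi> has_real_derivative \<psi>' x) (at x)"
  shows "(\<lambda>N. flux \<psi> N s) \<longlonglongrightarrow> (LBINT x:{0..1}. \<psi>' x * J_hat (w s x))"
proof -
  have s0: "0 \<le> s" using s by simp
  obtain C where C: "0 \<le> C" "\<And>N r i. N \<ge> 1 \<Longrightarrow> 0 < r \<Longrightarrow> r \<le> s \<Longrightarrow> i \<in> {1..int N} \<Longrightarrow> \<bar>current N r i\<bar> \<le> C"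
    using current_bound[OF s0] by blast
  let ?R = "\<lambda>N. 1 / real N * (\<Sum>i\<in>{1..int N}. \<psi>' (grid N i) * current N s i)"
  have "(\<lambda>N. flux \<psi> N s - ?R N) \<longlonglongrightarrow> 0"
  proof (rule LIMSEQ_I)
    fix e :: real assume e: "0 < e"
    define \<eta> where "\<eta> = e / (2 * (C + 1))"
    have \<eta>0: "0 < \<eta>" using e C by (simp add: \<eta>_def)
    obtain \<rho> where \<rho>: "0 < \<rho>" "\<And>x y. \<bar>x - y\<bar> \<le> \<rho> \<Longrightarrow> \<bar>\<psi>' x - \<psi>' y\<bar> \<le> \<eta>"
      using periodic_uniformly_continuous[OF p c \<eta>0] by blast
    obtain n :: nat where n: "1 / \<rho> \<le> real n" using real_arch_simple by blast
    have "norm (flux \<psi> N s - ?R N - 0) < e" if "N \<ge> max 1 n" for N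
    proof -
      have N: "N \<ge> 1" and nN: "1 / \<rho> \<le> real N" using n that by auto
      have dN: "1 / real N \<le> \<rho>" using nN \<rho>(1) N by (simp add: field_simps)
      have "\<bar>flux \<psi> N s - ?R N\<bar> \<le> \<eta> * C"
        unfolding flux_eq[OF N s]
      proof (rule grid_average_bound[OF d N])
        show "\<bar>\<psi>' u - \<psi>' v\<bar> \<le> \<eta>" if "\<bar>u - v\<bar> \<le> 1 / real N" for u v
          using that dN by (intro \<rho>(2)) linarith
        show "\<bar>current N s i\<bar> \<le> C" if "i \<in> {1..int N}" for i by (rule C(2)[OF N s order_refl that])
      qed
      also have "\<eta> * C < e"
        using C(1) e mult_nonneg_nonneg[OF C(1) less_imp_le[OF e]] by (simp add: \<eta>_def field_simps add_nonneg_pos)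
      finally show ?thesis by simp
    qed
    then show "\<exists>no. \<forall>N\<ge>no. norm (flux \<psi> N s - ?R N - 0) < e" by blast
  qed
  from tendsto_add[OF this current_weak_limit[OF s p c]] show ?thesis by simp
qed

lemma flux_bound:
  assumes N: "N \<ge> 1" and s: "0 < s" and d: "\<And>x. (\<psi> has_real_derivative \<psi>' x) (at x)" and B: "\<And>x. \<bar>\<psi>' x\<bar> \<le> B"
    and C: "\<And>i. i \<in> {1..int N} \<Longrightarrow> \<bar>current N s i\<bar> \<le> C"
  shows "\<bar>flux \<psi> N s\<bar> \<le> B * C"
proof -
  have B0: "0 \<le> B" by (rule order_trans[OF abs_ge_zero B[of 0]])
  have step: "\<bar>\<psi> (grid N (i + 1)) - \<psi> (grid N i)\<bar> \<le> B / real N" for i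
  proof -
    have lt: "grid N i < grid N (i + 1)" using N by (simp add: divide_strict_right_mono)
    obtain z where e: "\<psi> (grid N (i + 1)) - \<psi> (grid N i) = (grid N (i + 1) - grid N i) * \<psi>' z"
      using MVT2[OF lt, of \<psi> \<psi>'] d by blast
    have "grid N (i + 1) - grid N i = 1 / real N" by (simp add: diff_divide_distrib[symmetric])
    then show ?thesis unfolding e using B[of z] by (simp add: abs_mult divide_right_mono)
  qed
  have "\<bar>flux \<psi> N s\<bar> \<le> (\<Sum>i\<in>{1..int N}. B / real N * C)"
    unfolding flux_eq[OF N s]
  proof (rule order_trans[OF sum_abs sum_mono])
    fix i assume "i \<in> {1..int N}"
    then show "\<bar>(\<psi> (grid N (i + 1)) - \<psi> (grid N i)) * current N s i\<bar> \<le> B / real N * C"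
      unfolding abs_mult using B0 by (intro mult_mono step C) auto
  qed
  then show ?thesis using N by simp
qed

text \<open>
  Pass to the limit in Dynkin's formula for the average against \<open>\<psi>\<close>. Its left-hand side converges
  because the averages converge in \<open>L\<^sup>1\<close>.
\<close>
lemma weak_solution:
  assumes t: "0 < t" and \<psi>: "periodic_fun_simple' \<psi>" "\<psi> C1_differentiable_on UNIV"
  shows "(LBINT x:{0..1}. \<psi> x * (profile t x - profile 0 x)) = (LBINT s:{0..t}. (LBINT x:{0..1}. deriv \<psi> x * J_hat (w s x)))"
proof -
  have t0: "0 \<le> t" using t by simp
  obtain D where D: "\<And>x. (\<psi> has_vector_derivative D x) (at x)" "continuous_on UNIV D"
    using \<psi>(2) by (auto simp: C1_differentiable_on_def)
  have D': "(\<psi> has_real_derivative D x) (at x)" for x using D(1) by (simp add: has_real_derivative_iff_has_vector_derivative)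
  then have dD: "deriv \<psi> = D" by (auto intro!: DERIV_imp_deriv)
  have cD: "continuous_on UNIV (deriv \<psi>)" using D(2) dD by simp
  have d: "(\<psi> has_real_derivative deriv \<psi> x) (at x)" for x using D' dD by simp
  have c: "continuous_on UNIV \<psi>" by (rule differentiable_continuous_UNIV[OF d])
  have pD: "periodic_fun_simple' (deriv \<psi>)"
  proof -
    have "deriv \<psi> (x + 1) = deriv \<psi> x" for x
    proof -
      have "((\<lambda>x. x + 1) has_real_derivative 1) (at x)" by (auto intro!: derivative_eq_intros)
      from DERIV_chain2[where f = \<psi> and g = "\<lambda>x. x + 1", OF d this]
      have "((\<lambda>x. \<psi> (x + 1)) has_real_derivative deriv \<psi> (x + 1)) (at x)" by simp
      moreover have "(\<lambda>x. \<psi> (x + 1)) = \<psi>" using \<psi>(1) by (auto simp: periodic_fun_simple'_def)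
      ultimately have "(\<psi> has_real_derivative deriv \<psi> (x + 1)) (at x)" by simp
      from DERIV_unique[OF this d] show ?thesis .
    qed
    then show ?thesis by (simp add: periodic_fun_simple'_def)
  qed
  obtain B where B: "0 \<le> B" "\<And>x. \<bar>\<psi> x\<bar> \<le> B" using periodic_continuous_bounded[OF \<psi>(1) c] by blast
  obtain B' where B': "0 \<le> B'" "\<And>x. \<bar>deriv \<psi> x\<bar> \<le> B'" using periodic_continuous_bounded[OF pD cD] by blast
  obtain C where C: "0 \<le> C" "\<And>N r i. N \<ge> 1 \<Longrightarrow> 0 < r \<Longrightarrow> r \<le> t \<Longrightarrow> i \<in> {1..int N} \<Longrightarrow> \<bar>current N r i\<bar> \<le> C"
    using current_bound[OF t0] by blast
  let ?L = "\<lambda>s. LBINT x:{0..1}. deriv \<psi> x * J_hat (w s x)"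
  have int: "integrable (M N) (\<lambda>\<omega>. centred_avg \<psi> N (H N r \<omega>))" if "N \<ge> 1" "0 \<le> r" for N r
    by (rule dynkin_at(1)[OF that(1) that(1) that(1) _ \<psi>(1) B(2) that(2)])
  have lhs: "(\<lambda>N. (\<integral>\<omega>. centred_avg \<psi> N (H N t \<omega>) \<partial>M N) - (\<integral>\<omega>. centred_avg \<psi> N (H N 0 \<omega>) \<partial>M N))
    \<longlonglongrightarrow> integral {0..1} (\<lambda>x. \<psi> x * (profile t x - m)) - integral {0..1} (\<lambda>x. \<psi> x * (profile 0 x - m))"
    using t0 by (intro tendsto_diff expectation_tendsto[OF prob_space_M int] centred_avg_limit \<psi>(1) c) auto
  have dyn: "set_integrable lborel {0..t} (flux \<psi> N)"
    "(\<integral>\<omega>. centred_avg \<psi> N (H N t \<omega>) \<partial>M N) - (\<integral>\<omega>. centred_avg \<psi> N (H N 0 \<omega>) \<partial>M N) = (LBINT s:{0..t}. flux \<psi> N s)" if "N \<ge> 1" for N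
    using dynkin_at(2,3)[OF that that that _ \<psi>(1) B(2) t0] by (auto simp: flux_def[abs_def])
  have meas: "(\<lambda>s. indicator {0..t} s * flux \<psi> (Suc N) s) \<in> borel_measurable lborel" for N
    using dyn(1)[of "Suc N"] by (auto simp: set_integrable_def)
  have ae0: "AE s in lborel. s \<noteq> (0 :: real)" by (rule AE_lborel_singleton)
  \<comment> \<open>Time 0 is cut out because the current is only bounded at positive times, and the index is shifted
    because nothing is known about \<open>M 0\<close>.\<close>
  have conv: "(\<lambda>N. indicator {0<..t} s * (indicator {0..t} s * flux \<psi> (Suc N) s)) \<longlonglongrightarrow> indicator {0<..t} s * ?L s" for s
  proof (cases "s \<in> {0<..t}")
    case True
    then have s: "0 < s" by simp
    from LIMSEQ_Suc[OF flux_limit[OF s pD cD d]] show ?thesis using True by simp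
  qed simp
  have meas': "(\<lambda>s. indicator {0<..t} s * (indicator {0..t} s * flux \<psi> (Suc N) s)) \<in> borel_measurable lborel" for N
    by (rule borel_measurable_times[OF _ meas]) simp
  have lim: "(\<lambda>N. \<integral>s. indicator {0<..t} s * (indicator {0..t} s * flux \<psi> (Suc N) s) \<partial>lborel) \<longlonglongrightarrow> (\<integral>s. indicator {0<..t} s * ?L s \<partial>lborel)"
  proof (rule integral_dominated_convergence[where w = "\<lambda>s. B' * C * indicator {0..t} s"])
    show "(\<lambda>s. indicator {0<..t} s * ?L s) \<in> borel_measurable lborel"
      by (rule borel_measurable_LIMSEQ_metric[OF meas' conv])
    show "(\<lambda>s. indicator {0<..t} s * (indicator {0..t} s * flux \<psi> (Suc N) s)) \<in> borel_measurable lborel" for N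
      by (rule meas')
    show "AE s in lborel. (\<lambda>N. indicator {0<..t} s * (indicator {0..t} s * flux \<psi> (Suc N) s)) \<longlonglongrightarrow> indicator {0<..t} s * ?L s"
      by (rule AE_I2) (rule conv)
    show "integrable lborel (\<lambda>s. B' * C * indicator {0..t} s)"
      by (intro integrable_mult_right integrable_real_indicator) (use t in auto)
    show "AE s in lborel. norm (indicator {0<..t} s * (indicator {0..t} s * flux \<psi> (Suc N) s)) \<le> B' * C * indicator {0..t} s" for N
    proof (rule AE_I2)
      fix s
      show "norm (indicator {0<..t} s * (indicator {0..t} s * flux \<psi> (Suc N) s)) \<le> B' * C * indicator {0..t} s"
      proof (cases "s \<in> {0<..t}")
        case True
        have "\<bar>flux \<psi> (Suc N) s\<bar> \<le> B' * C"
          by (rule flux_bound[OF _ _ d B'(2)]) (use True C(2) in auto)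
        then show ?thesis using True by simp
      qed (use B' C in \<open>simp add: indicator_def\<close>)
    qed
  qed
  have eq1: "(\<integral>s. indicator {0<..t} s * (indicator {0..t} s * flux \<psi> (Suc N) s) \<partial>lborel) = (LBINT s:{0..t}. flux \<psi> (Suc N) s)" for N
    unfolding set_lebesgue_integral_def
  proof (rule integral_cong_AE)
    show "AE s in lborel. indicator {0<..t} s * (indicator {0..t} s * flux \<psi> (Suc N) s) = indicator {0..t} s *\<^sub>R flux \<psi> (Suc N) s"
      using ae0 by eventually_elim (auto simp: indicator_def)
  qed (use meas[of N] in auto)
  have eq2: "(\<integral>s. indicator {0<..t} s * ?L s \<partial>lborel) = (LBINT s:{0..t}. ?L s)"
  proof -
    have "(\<integral>s. indicator {0<..t} s * ?L s \<partial>lborel) = (\<integral>s. indicator {0..t} s * ?L s \<partial>lborel)"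
    proof (rule integral_discrete_difference[of "{0}"])
      show "indicator {0<..t} s * ?L s = indicator {0..t} s * ?L s" if "s \<notin> {0}" for s
        using that by (auto simp: indicator_def)
    qed auto
    then show ?thesis by (simp add: set_lebesgue_integral_def)
  qed
  have "(\<lambda>N. (\<integral>\<omega>. centred_avg \<psi> (Suc N) (H (Suc N) t \<omega>) \<partial>M (Suc N)) - (\<integral>\<omega>. centred_avg \<psi> (Suc N) (H (Suc N) 0 \<omega>) \<partial>M (Suc N))) \<longlonglongrightarrow> (LBINT s:{0..t}. ?L s)"
    using lim unfolding eq1 eq2 by (simp add: dyn(2))
  from LIMSEQ_unique[OF this LIMSEQ_Suc[OF lhs]]
  have "(LBINT s:{0..t}. ?L s) = integral {0..1} (\<lambda>x. \<psi> x * (profile t x - m)) - integral {0..1} (\<lambda>x. \<psi> x * (profile 0 x - m))" .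
  also have "\<dots> = integral {0..1} (\<lambda>x. \<psi> x * (profile t x - m) - \<psi> x * (profile 0 x - m))"
  proof (rule integral_diff[symmetric])
    have "(\<lambda>x. \<psi> x * (profile r x - m)) integrable_on {0..1}" if "0 \<le> r" for r
      by (intro continuous_integrable_unit continuous_on_mult continuous_on_diff continuous_on_const c profile_continuous that)
    from this[OF t0] this[OF order_refl]
    show "(\<lambda>x. \<psi> x * (profile t x - m)) integrable_on {0..1}" "(\<lambda>x. \<psi> x * (profile 0 x - m)) integrable_on {0..1}" .
  qed
  also have "\<dots> = integral {0..1} (\<lambda>x. \<psi> x * (profile t x - profile 0 x))" by (simp add: algebra_simps)
  also have "\<dots> = (LBINT x:{0..1}. \<psi> x * (profile t x - profile 0 x))"
    using t0 by (intro LBINT_eq_integral[symmetric] continuous_on_mult continuous_on_diff c profile_continuous) auto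
  finally show ?thesis by simp
qed

end

theorem corollary4p6:
  fixes K m :: real
    and M :: "nat \<Rightarrow> 'a measure"
    and H :: "nat \<Rightarrow> real \<Rightarrow> 'a \<Rightarrow> int \<Rightarrow> int"
    and w :: "real \<Rightarrow> real \<Rightarrow> real"
    and J_hat :: "real \<Rightarrow> real"
  assumes "K > 0"
    and "\<And>N. N \<ge> 1 \<Longrightarrow> metropolis_process K N (M N) (H N)"
    and "tends_in_prob M (\<lambda>N \<omega>. height_avg (\<lambda>_. 1) N (H N 0 \<omega>)) m"
    and i_torus: "\<And>t. t \<ge> 0 \<Longrightarrow> periodic_fun_simple' (w t)"
    and i_cont: "continuous_on ({0..} \<times> UNIV) (\<lambda>(t, x). w t x)"
    and i_lim: "\<And>t x. t \<ge> 0 \<Longrightarrow>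
      ((\<lambda>\<epsilon>. limsup (\<lambda>N. \<integral>\<^sup>+ \<omega>.
          ennreal (\<bar>window_avg (\<lambda>u. u) N x \<epsilon> (H N t \<omega>) - w t x\<bar>\<^sup>2) \<partial>M N))
        \<longlongrightarrow> 0) (at_right 0)"
    and ii_cont: "continuous_on UNIV J_hat"
    and ii_lim: "\<And>t x. t > 0 \<Longrightarrow>
      ((\<lambda>\<epsilon>. limsup (\<lambda>N. ennreal
          \<bar>(\<integral>\<omega>. window_avg (J K) N x \<epsilon> (H N t \<omega>) \<partial>M N)
            - J_hat (\<integral>\<omega>. window_avg (\<lambda>u. u) N x \<epsilon> (H N t \<omega>) \<partial>M N)\<bar>))
        \<longlongrightarrow> 0) (at_right 0)"
    and iii: "\<And>t. t \<ge> 0 \<Longrightarrow>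
      (SUP N\<in>{1..}. SUP i\<in>{1..int N}.
         \<integral>\<^sup>+ \<omega>. ennreal \<bar>real_of_int (third_diff (H N t \<omega>) i)\<bar> \<partial>M N) < \<infinity>"
    and iv_integrable: "\<And>N i s. N \<ge> 1 \<Longrightarrow> i \<in> {1..int N} \<Longrightarrow> s > 0 \<Longrightarrow>
      integrable (M N) (\<lambda>\<omega>. J K (real_of_int (third_diff (H N s \<omega>) i)))"
    and iv: "\<And>t. t \<ge> 0 \<Longrightarrow>
      (SUP N\<in>{1..}. SUP s\<in>{0<..t}. SUP i\<in>{1..int N}.
         ennreal \<bar>\<integral>\<omega>. J K (real_of_int (third_diff (H N s \<omega>) i)) \<partial>M N\<bar>) < \<infinity>"
  shows "\<exists>h :: real \<Rightarrow> real \<Rightarrow> real.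
      rough_hydrodynamic_limit M H (h 0) h \<and>
      C3_in_x h \<and>
      (\<forall>t>0. \<forall>\<psi>. periodic_fun_simple' \<psi> \<and> \<psi> C1_differentiable_on UNIV \<longrightarrow>
         (LBINT x:{0..1}. \<psi> x * (h t x - h 0 x)) =
         (LBINT s:{0..t}. (LBINT x:{0..1}. deriv \<psi> x * J_hat (dx 3 h s x))))"
proof -
  interpret local_equilibrium_metropolis K m M H w J_hat
    by (intro local_equilibrium_metropolis.intro mesoscopic_metropolis.intro local_equilibrium_metropolis_axioms.intro)
      (assumption | rule assms)+
  show ?thesis
  proof (intro exI[of _ profile] conjI allI impI)
    show "rough_hydrodynamic_limit M H (profile 0) profile"
      unfolding rough_hydrodynamic_limit_def by (auto intro: profile_limit_profile)
    show "C3_in_x profile" by (rule profile_C3)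
    fix t :: real and \<psi> :: "real \<Rightarrow> real"
    assume t: "t > 0" and \<psi>: "periodic_fun_simple' \<psi> \<and> \<psi> C1_differentiable_on UNIV"
    have "(LBINT s:{0..t}. (LBINT x:{0..1}. deriv \<psi> x * J_hat (dx 3 profile s x))) = (LBINT s:{0..t}. (LBINT x:{0..1}. deriv \<psi> x * J_hat (w s x)))"
      by (rule set_lebesgue_integral_cong) (auto simp: profile_derivs(4))
    then show "(LBINT x:{0..1}. \<psi> x * (profile t x - profile 0 x)) =
         (LBINT s:{0..t}. (LBINT x:{0..1}. deriv \<psi> x * J_hat (dx 3 profile s x)))"
      using weak_solution[OF t] \<psi> by simp
  qed
qed

end
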